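(* Let $1<p<\infty$ and let $\lambda$ be a frequency. Then the monomials $(e^{-\lambda_ns})_{n}$ form a Schauder basis for $\mathcal{H}_p(\lambda)$.
   Context: A frequency is a strictly increasing sequence $\lambda=(\lambda_n)_{n\ge1}$ of non-negative real numbers tending to $\infty$. A $\lambda$-Dirichlet series is a formal sum $D=\sum a_n e^{-\lambda_n s}$ with complex coefficients $a_n$. A Dirichlet group is a pair $(G,\beta)$ of a compact abelian group $G$ and a continuous homomorphism $\beta\colon\mathbb{R}\to G$ with dense range. It is a $\lambda$-Dirichlet group if for every $n$ there is a (necessarily unique) character $h_{\lambda_n}\in\widehat{G}$ with $h_{\lambda_n}(\beta(t))=e^{-i\lambda_n t}$ for all $t\in\mathbb{R}$. $L_p(G)$ is taken with respect to the normalized Haar measure $m$, and $\widehat{f}(\gamma)=\int_G f\overline{\gamma}\,dm$ for $\gamma\in\widehat G$. $H_p^\lambda(G)$ is the space of all $f\in L_p(G)$ such that $\widehat f(\gamma)\ne0$ only if $\gamma=h_{\lambda_n}$ for some $n$. $\mathcal{H}_p(\lambda)$ is the Banach space of all $\lambda$-Dirichlet series $D=\sum a_ne^{-\lambda_ns}$ for which there is $f\in H_p^\lambda(G)$ with $\widehat f(h_{\lambda_n})=a_n$ for all $n$, with norm $\|D\|_p=\|f\|_p$; it does not depend on the choice of the $\lambda$-Dirichlet group $(G,\beta)$. *)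

theory Defs
  imports "HOL-Analysis.Analysis" "HOL-Library.Function_Algebras"
begin

text \<open>The sequence is indexed from 0, so \<open>lam n\<close> is the frequency usually written with index n + 1.\<close>

definition frequency :: "(nat \<Rightarrow> real) \<Rightarrow> bool" where
  "frequency lam \<longleftrightarrow>
     strict_mono lam \<and> (\<forall>n. 0 \<le> lam n) \<and> filterlim lam at_top sequentially"

text \<open>
  Abelian groups are written additively, and the group is the whole type. The Hausdorff axiom,
  part of ``compact group'', is the sort constraint \<^class>\<open>t2_space\<close>.
\<close>

definition dirichlet_group :: "(real \<Rightarrow> 'g::{topological_ab_group_add, t2_space}) \<Rightarrow> bool" where
  "dirichlet_group \<beta> \<longleftrightarrow>
     compact (UNIV :: 'g set) \<and>
     continuous_on UNIV \<beta> \<and> (\<forall>s t. \<beta> (s + t) = \<beta> s + \<beta> t) \<and>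
     closure (range \<beta>) = UNIV"

definition character :: "('g::{topological_ab_group_add, t2_space} \<Rightarrow> complex) \<Rightarrow> bool" where
  "character \<gamma> \<longleftrightarrow>
     continuous_on UNIV \<gamma> \<and> (\<forall>x y. \<gamma> (x + y) = \<gamma> x * \<gamma> y) \<and> (\<forall>x. norm (\<gamma> x) = 1)"

definition extends_frequency ::
  "(real \<Rightarrow> 'g::{topological_ab_group_add, t2_space}) \<Rightarrow> real \<Rightarrow> ('g \<Rightarrow> complex) \<Rightarrow> bool" where
  "extends_frequency \<beta> x \<gamma> \<longleftrightarrow>
     character \<gamma> \<and> (\<forall>t. \<gamma> (\<beta> t) = exp (- (\<i> * complex_of_real (x * t))))"

definition lambda_dirichlet_group ::
  "(nat \<Rightarrow> real) \<Rightarrow> (real \<Rightarrow> 'g::{topological_ab_group_add, t2_space}) \<Rightarrow> bool" where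
  "lambda_dirichlet_group lam \<beta> \<longleftrightarrow>
     dirichlet_group \<beta> \<and> (\<forall>n. \<exists>\<gamma>. extends_frequency \<beta> (lam n) \<gamma>)"

text \<open>The character \<open>h\<^sub>x\<close>; it is unique when it exists, since \<open>\<beta>\<close> has dense range.\<close>

definition freq_character ::
  "(real \<Rightarrow> 'g::{topological_ab_group_add, t2_space}) \<Rightarrow> real \<Rightarrow> 'g \<Rightarrow> complex" where
  "freq_character \<beta> x = (THE \<gamma>. extends_frequency \<beta> x \<gamma>)"

text \<open>
  The group need not be metrizable, so regularity is not automatic for a Borel measure and is
  required explicitly; it is what makes the normalized Haar measure unique.
\<close>

definition normalized_haar :: "'g::{topological_ab_group_add, t2_space} measure \<Rightarrow> bool" where
  "normalized_haar m \<longleftrightarrow>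
     sets m = sets borel \<and>
     emeasure m UNIV = 1 \<and>
     (\<forall>A\<in>sets borel. \<forall>x. emeasure m ((\<lambda>y. x + y) ` A) = emeasure m A) \<and>
     (\<forall>A\<in>sets borel. emeasure m A = (INF U\<in>{U. A \<subseteq> U \<and> open U}. emeasure m U)) \<and>
     (\<forall>A\<in>sets borel. emeasure m A = (SUP K\<in>{K. K \<subseteq> A \<and> compact K}. emeasure m K))"

text \<open>Elements of \<open>L\<^sub>p\<close> are represented by functions, not identified almost everywhere.\<close>

definition Lp :: "real \<Rightarrow> 'a measure \<Rightarrow> ('a \<Rightarrow> complex) set" where
  "Lp p m = {f \<in> borel_measurable m. integrable m (\<lambda>x. norm (f x) powr p)}"

definition Lp_norm :: "real \<Rightarrow> 'a measure \<Rightarrow> ('a \<Rightarrow> complex) \<Rightarrow> real" where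
  "Lp_norm p m f = (LINT x|m. norm (f x) powr p) powr (1 / p)"

definition fourier_coeff :: "'a measure \<Rightarrow> ('a \<Rightarrow> complex) \<Rightarrow> ('a \<Rightarrow> complex) \<Rightarrow> complex" where
  "fourier_coeff m f \<gamma> = (LINT x|m. f x * cnj (\<gamma> x))"

definition Hp_group ::
  "real \<Rightarrow> (nat \<Rightarrow> real) \<Rightarrow> 'g::{topological_ab_group_add, t2_space} measure \<Rightarrow> (real \<Rightarrow> 'g)
     \<Rightarrow> ('g \<Rightarrow> complex) set" where
  "Hp_group p lam m \<beta> =
     {f \<in> Lp p m. \<forall>\<gamma>. character \<gamma> \<longrightarrow> fourier_coeff m f \<gamma> \<noteq> 0 \<longrightarrow>
                      (\<exists>n. \<gamma> = freq_character \<beta> (lam n))}"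

text \<open>
  For a fixed frequency \<open>lam\<close>, the formal series with terms \<open>a n * exp (- lam n * s)\<close> is
  represented by its coefficient sequence \<open>a\<close>.
\<close>

type_synonym dirichlet_series = "nat \<Rightarrow> complex"

definition scale_series :: "complex \<Rightarrow> dirichlet_series \<Rightarrow> dirichlet_series" where
  "scale_series c a = (\<lambda>k. c * a k)"

definition monomial :: "nat \<Rightarrow> dirichlet_series" where
  "monomial n = (\<lambda>k. if k = n then 1 else 0)"

definition represents ::
  "(nat \<Rightarrow> real) \<Rightarrow> 'g::{topological_ab_group_add, t2_space} measure \<Rightarrow> (real \<Rightarrow> 'g)
     \<Rightarrow> ('g \<Rightarrow> complex) \<Rightarrow> dirichlet_series \<Rightarrow> bool" where
  "represents lam m \<beta> f a \<longleftrightarrow> (\<forall>n. fourier_coeff m f (freq_character \<beta> (lam n)) = a n)"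

definition Hp_series ::
  "real \<Rightarrow> (nat \<Rightarrow> real) \<Rightarrow> 'g::{topological_ab_group_add, t2_space} measure \<Rightarrow> (real \<Rightarrow> 'g)
     \<Rightarrow> dirichlet_series set" where
  "Hp_series p lam m \<beta> = {a. \<exists>f\<in>Hp_group p lam m \<beta>. represents lam m \<beta> f a}"

text \<open>
  The representing function is determined almost everywhere by its Fourier coefficients, so the
  value described below is unique for every series in \<open>Hp_series\<close>.
\<close>

definition Hp_norm ::
  "real \<Rightarrow> (nat \<Rightarrow> real) \<Rightarrow> 'g::{topological_ab_group_add, t2_space} measure \<Rightarrow> (real \<Rightarrow> 'g)
     \<Rightarrow> dirichlet_series \<Rightarrow> real" where
  "Hp_norm p lam m \<beta> a =
     (THE r. \<exists>f\<in>Hp_group p lam m \<beta>. represents lam m \<beta> f a \<and> r = Lp_norm p m f)"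

text \<open>
  Schauder bases of a normed space given by a scalar multiplication, a carrier \<open>V\<close> (closed under
  the linear operations) and a norm that is meaningful on \<open>V\<close>.
\<close>

definition schauder_basis ::
  "('k \<Rightarrow> 'v \<Rightarrow> 'v) \<Rightarrow> 'v set \<Rightarrow> ('v \<Rightarrow> real) \<Rightarrow> (nat \<Rightarrow> 'v::ab_group_add) \<Rightarrow> bool" where
  "schauder_basis smul V nrm b \<longleftrightarrow>
     range b \<subseteq> V \<and>
     (\<forall>x\<in>V. \<exists>!c. (\<lambda>N. nrm (x - (\<Sum>n<N. smul (c n) (b n)))) \<longlonglongrightarrow> 0)"

end

theory Submission
  imports Defs
begin

text \<open>
  Let \<open>h\<^sub>n\<close> be the character of frequency \<open>\<lambda>\<^sub>n\<close>. A series in \<open>\<H>\<^sub>p(\<lambda>)\<close> is a function \<open>f\<close> in \<open>L\<^sub>p(G)\<close> whose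
  Fourier coefficients live on the \<open>h\<^sub>n\<close>, and its partial sums are frequency cuts of \<open>f\<close>. They
  converge to \<open>f\<close> for the classical reason: the cuts are uniformly bounded operators (M. Riesz), and
  they converge on the polynomials in the \<open>h\<^sub>n\<close>, which are dense. Three facts are needed.

  \<^emph>\<open>The characters determine a function.\<close> A continuous \<open>f \<noteq> 0\<close> has a nonzero Fourier coefficient
  (\<open>continuous_function_has_nonzero_coefficient\<close>). This special case of the Peter-Weyl theorem is
  proved with the one-parameter subgroup \<open>\<beta>\<close> instead of a spectral theorem. Finite Fourier
  analysis of the translates \<open>f(\<cdot> + \<beta>(j/n))\<close>, \<open>j < n\<^sup>2\<close>, produces averages
  \<open>n\<^sup>-\<^sup>2 \<Sum>\<^sub>j f(\<cdot> + \<beta>(j/n)) e\<^sup>-\<^sup>i\<^sup>\<theta>\<^sup>j\<close> that do not become uniformly small. A translation by \<open>\<beta>(s)\<close>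
  multiplies them almost by a constant, so a cluster point of them is a multiple of a character, and
  that character occurs in \<open>f\<close>. Consequently characters separate points and, by the
  Stone-Weierstrass theorem, trigonometric polynomials are dense.

  \<^emph>\<open>The Riesz projection is bounded\<close> (\<open>riesz_bounded\<close>). Restriction to \<open>\<beta>\<close> orders the characters by
  their frequencies, and a polynomial with non-negative frequencies is analytic in the sense
  that the mean is multiplicative on such polynomials. Let \<open>1 < p \<le> 2\<close>. A positive polynomial \<open>g\<close>
  is the real part of an analytic \<open>F\<close> with the same mean. The mean of \<open>F\<^sup>p\<close> is the \<open>p\<close>-th power of the mean of \<open>F\<close>,
  and integrating the elementary inequality \<open>\<bar>z\<bar>\<^sup>p \<le> A (Re z)\<^sup>p - B Re (z\<^sup>p)\<close> over the values of \<open>F\<close>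
  bounds \<open>F\<close> by \<open>g\<close>. A real polynomial is a difference of two positive ones up to a uniformly small
  error, for which boundedness in \<open>L\<^sub>2\<close> suffices, and the case \<open>p > 2\<close> follows by duality.

  \<^emph>\<open>Approximation does not enlarge the spectrum\<close> (\<open>approximation_within_spectrum\<close>). Convolution with a
  non-negative trigonometric polynomial of mean one is a contraction of \<open>L\<^sub>p\<close>, and it moves a given
  polynomial as little as desired.

  A frequency cut is a Riesz projection conjugated with multiplication by some \<open>h\<^sub>n\<close>, hence bounded
  independently of \<open>n\<close>. The third fact also shows that a function is determined by its coefficients,
  which makes the norm of a series well defined, and coefficients are continuous in
  \<open>L\<^sub>p\<close>, which makes the expansion unique.
\<close>

section \<open>Haar measure on a Dirichlet group\<close>

lemma translate_eq_vimage:
  fixes x :: "'a::ab_group_add"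
  shows "(\<lambda>y. x + y) ` U = (\<lambda>y. y - x) -` U"
proof (rule set_eqI)
  fix z
  have "z \<in> (\<lambda>y. x + y) ` U" if "z - x \<in> U"
    using that by (rule rev_image_eqI) simp
  then show "z \<in> (\<lambda>y. x + y) ` U \<longleftrightarrow> z \<in> (\<lambda>y. y - x) -` U"
    by auto
qed

locale haar_on_dirichlet_group =
  fixes \<beta> :: "real \<Rightarrow> 'g::{topological_ab_group_add, t2_space}" and m :: "'g measure"
  assumes dirichlet: "dirichlet_group \<beta>" and haar: "normalized_haar m"
begin

abbreviation coeff :: "('g \<Rightarrow> complex) \<Rightarrow> ('g \<Rightarrow> complex) \<Rightarrow> complex" where
  "coeff \<equiv> fourier_coeff m"

lemma compact_UNIV: "compact (UNIV :: 'g set)"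
  and continuous_on_flow: "continuous_on UNIV \<beta>"
  and flow_add: "\<beta> (s + t) = \<beta> s + \<beta> t"
  and flow_dense: "closure (range \<beta>) = UNIV"
  using dirichlet by (auto simp: dirichlet_group_def)

lemma sets_m [measurable_cong, simp]: "sets m = sets borel"
  using haar by (simp add: normalized_haar_def)

lemma space_m [simp]: "space m = UNIV"
  using sets_eq_imp_space_eq[OF sets_m] by simp

lemma emeasure_UNIV: "emeasure m UNIV = 1"
  using haar by (simp add: normalized_haar_def)

lemma emeasure_translate: "A \<in> sets borel \<Longrightarrow> emeasure m ((\<lambda>y. x + y) ` A) = emeasure m A"
  using haar unfolding normalized_haar_def by blast

sublocale finite_measure m
  by (rule finite_measureI) (simp add: emeasure_UNIV)

lemma measure_UNIV [simp]: "measure m UNIV = 1"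
  by (simp add: measure_def emeasure_UNIV)

lemma continuous_measurable:
  fixes f :: "'g \<Rightarrow> 'b::topological_space"
  assumes "continuous_on UNIV f"
  shows "f \<in> borel_measurable m"
  using borel_measurable_continuous_onI[OF assms] by (simp cong: measurable_cong_sets)

lemma continuous_bounded:
  fixes f :: "'g \<Rightarrow> 'b::real_normed_vector"
  assumes "continuous_on UNIV f"
  obtains B where "B > 0" "\<And>x. norm (f x) \<le> B"
proof -
  have "bounded (range f)"
    using compact_continuous_image[OF assms compact_UNIV] by (rule compact_imp_bounded)
  then show thesis
    using that by (auto simp: bounded_pos)
qed

lemma continuous_integrable:
  fixes f :: "'g \<Rightarrow> 'b::{banach, second_countable_topology}"
  assumes "continuous_on UNIV f"
  shows "integrable m f"
proof -
  obtain B where "\<And>x. norm (f x) \<le> B"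
    using continuous_bounded[OF assms] by blast
  then show ?thesis
    by (intro integrable_const_bound[of _ B] continuous_measurable[OF assms]) auto
qed

lemma integral_shift:
  fixes f :: "'g \<Rightarrow> 'b::{banach, second_countable_topology}"
  assumes f: "f \<in> borel_measurable borel"
  shows "(LINT x|m. f (x + a)) = (LINT x|m. f x)"
proof -
  have meas: "(\<lambda>x. x + a) \<in> measurable m borel"
    by (intro continuous_measurable continuous_intros)
  have "distr m borel (\<lambda>x. x + a) = m"
  proof (rule measure_eqI)
    fix A assume "A \<in> sets (distr m borel (\<lambda>x. x + a))"
    then have A: "A \<in> sets borel" by simp
    have vimage: "(\<lambda>x. x + a) -` A = (\<lambda>y. (- a) + y) ` A"
      unfolding translate_eq_vimage by simp
    show "emeasure (distr m borel (\<lambda>x. x + a)) A = emeasure m A"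
      using emeasure_translate[OF A, of "- a"]
      unfolding emeasure_distr[OF meas A] space_m vimage by simp
  qed simp
  then have "(LINT x|m. f x) = (LINT x|distr m borel (\<lambda>x. x + a). f x)" by simp
  also have "\<dots> = (LINT x|m. f (x + a))"
    by (rule integral_distr[OF meas f])
  finally show ?thesis by simp
qed

lemma continuous_integral_shift:
  fixes f :: "'g \<Rightarrow> 'b::{banach, second_countable_topology}"
  assumes "continuous_on UNIV f"
  shows "(LINT x|m. f (x + a)) = (LINT x|m. f x)"
  using integral_shift[OF borel_measurable_continuous_onI[OF assms]] .

lemma finite_translates_cover:
  assumes "open U" "u \<in> (U :: 'g set)"
  obtains F where "finite F" "UNIV = (\<Union>x\<in>F. (\<lambda>y. x + y) ` U)"
proof -
  have op: "open ((\<lambda>y. x + y) ` U)" for x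
  proof -
    have "(\<lambda>y. x + y) ` U = (\<lambda>y. y - x) -` U"
      by (rule translate_eq_vimage)
    then show ?thesis
      using assms(1) by (auto intro!: open_vimage continuous_intros)
  qed
  have cov: "UNIV \<subseteq> (\<Union>x\<in>UNIV. (\<lambda>y. x + y) ` U)"
  proof
    fix y
    have "y = (y - u) + u" by simp
    then show "y \<in> (\<Union>x\<in>UNIV. (\<lambda>y. x + y) ` U)"
      using assms(2) by blast
  qed
  obtain F where F: "finite F" "UNIV \<subseteq> (\<Union>x\<in>F. (\<lambda>y. x + y) ` U)"
    using compactE_image[OF compact_UNIV op cov] by metis
  show thesis by (rule that[OF F(1)]) (rule subset_antisym[OF F(2) subset_UNIV])
qed

text \<open>
  Finitely many translates of an open set cover the group, and all of them have the same measure.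
\<close>

lemma measure_open_pos:
  assumes "open U" "u \<in> (U :: 'g set)"
  shows "measure m U > 0"
proof (rule ccontr)
  assume "\<not> measure m U > 0"
  then have zero: "measure m U = 0" using measure_nonneg[of m U] by linarith
  obtain F where F: "finite F" "UNIV = (\<Union>x\<in>F. (\<lambda>y. x + y) ` U)"
    using finite_translates_cover[OF assms] .
  have U: "U \<in> sets borel" using assms by simp
  have shift: "(\<lambda>y. x + y) ` U \<in> sets m" for x
  proof -
    have "(\<lambda>y. x + y) ` U = (\<lambda>y. y - x) -` U"
      by (rule translate_eq_vimage)
    then show ?thesis
      using assms(1) by (auto intro!: borel_open open_vimage continuous_intros)
  qed
  have "measure m ((\<lambda>y. x + y) ` U) = 0" for x
    using emeasure_translate[OF U, of x] zero by (simp add: measure_def)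
  then have "measure m (\<Union>x\<in>F. (\<lambda>y. x + y) ` U) \<le> (\<Sum>x\<in>F. 0)"
    using measure_subadditive_finite[of F "\<lambda>x. (\<lambda>y. x + y) ` U" m] F(1) shift
    by (auto simp: image_subset_iff)
  then show False using F(2) by simp
qed

lemma continuous_integral_pos:
  fixes f :: "'g \<Rightarrow> real"
  assumes f: "continuous_on UNIV f" and nonneg: "\<And>x. f x \<ge> 0" and pos: "f a > 0"
  shows "(LINT x|m. f x) > 0"
proof -
  define U where "U = {x. f x > f a / 2}"
  have U: "open U" "a \<in> U"
    unfolding U_def using f pos by (auto intro!: open_Collect_less continuous_intros)
  have "0 < f a / 2 * measure m U"
    using measure_open_pos[OF U] pos by simp
  also have "\<dots> = (LINT x|m. f a / 2 * indicator U x)"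
    using U by simp
  also have "\<dots> \<le> (LINT x|m. f x)"
  proof (rule integral_mono)
    show "integrable m (\<lambda>x. f a / 2 * indicator U x)"
      using U by (intro integrable_mult_right integrable_real_indicator)
        (auto simp: less_top[symmetric])
    show "integrable m f" by (rule continuous_integrable[OF f])
    show "f a / 2 * indicator U x \<le> f x" for x
      using nonneg[of x] by (auto simp: U_def indicator_def)
  qed
  finally show ?thesis .
qed

text \<open>
  By compactness, the neighbourhood of \<open>0\<close> can be chosen independently of the base point.
\<close>

lemma uniformly_continuous_at_zero:
  fixes f :: "'g \<Rightarrow> 'b::real_normed_vector"
  assumes f: "continuous_on UNIV f" and e: "e > 0"
  obtains U where "open U" "0 \<in> U" "\<And>x u. u \<in> U \<Longrightarrow> norm (f (x + u) - f x) < e"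
proof -
  define W where "W = {z :: 'g \<times> 'g. norm (f (fst z + snd z) - f (fst z)) < e}"
  have "open W"
    unfolding W_def
    by (intro open_Collect_less continuous_intros continuous_on_compose2[OF f]) auto
  have "\<exists>A V. open A \<and> open V \<and> x \<in> A \<and> 0 \<in> V \<and> A \<times> V \<subseteq> W" for x
  proof -
    have "(x, 0) \<in> W" using e by (simp add: W_def)
    then show ?thesis using open_prod_elim[OF \<open>open W\<close>] by (metis mem_Sigma_iff)
  qed
  then obtain A V where AV: "\<And>x. open (A x)" "\<And>x. open (V x)" "\<And>x. x \<in> A x" "\<And>x. 0 \<in> V x"
      "\<And>x. A x \<times> V x \<subseteq> W" by metis
  obtain F where F: "finite F" "UNIV \<subseteq> (\<Union>x\<in>F. A x)"
  proof (rule compactE_image[OF compact_UNIV, of UNIV A])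
    show "UNIV \<subseteq> (\<Union>x\<in>UNIV. A x)" using AV(3) by blast
  qed (use AV(1) in auto)
  show thesis
  proof
    show "open (\<Inter>x\<in>F. V x)" using F AV by auto
    show "0 \<in> (\<Inter>x\<in>F. V x)" using AV by auto
    show "norm (f (x + u) - f x) < e" if "u \<in> (\<Inter>x\<in>F. V x)" for x u
    proof -
      obtain y where "y \<in> F" "x \<in> A y" using F(2) by blast
      then have "(x, u) \<in> W" using AV(5)[of y] that by blast
      then show ?thesis by (simp add: W_def)
    qed
  qed
qed

end

section \<open>Characters as limits of approximate eigenfunctions\<close>

text \<open>
  Tychonoff's theorem for a product of discs. Since the index set may be uncountable, there need not
  be a convergent subsequence; the cluster point is a limit along a filter finer than \<open>sequentially\<close>.
\<close>

lemma pointwise_cluster_function: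
  fixes v :: "nat \<Rightarrow> 'a \<Rightarrow> complex"
  assumes bound: "\<And>k y. norm (v k y) \<le> B"
  obtains E u where "E \<le> sequentially" "E \<noteq> bot" "\<And>y. ((\<lambda>k. v k y) \<longlongrightarrow> u y) E"
proof -
  define K where "K = (PiE UNIV (\<lambda>_. cball 0 B) :: ('a \<Rightarrow> complex) set)"
  have "compactin (product_topology (\<lambda>_::'a. euclidean :: complex topology) UNIV) K"
    unfolding K_def by (auto simp: compactin_PiE)
  then have cpt: "compact K"
    by (simp add: euclidean_product_topology)
  have le: "filtermap v sequentially \<le> principal K"
    using bound by (auto simp: le_principal eventually_filtermap K_def PiE_UNIV_domain)
  have nt: "filtermap v sequentially \<noteq> bot"
    by (simp add: filtermap_bot_iff)
  obtain u where u: "inf (nhds u) (filtermap v sequentially) \<noteq> bot"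
    using cpt[unfolded compact_filter, THEN spec, THEN mp, OF nt, THEN mp, OF le[unfolded le_principal]] by (elim bexE)
  define E where "E = inf sequentially (filtercomap v (nhds u))"
  have "E \<noteq> bot"
  proof
    assume "E = bot"
    then have "eventually (\<lambda>_. False) E" by simp
    then obtain P Q where PQ: "eventually P sequentially" "eventually Q (filtercomap v (nhds u))"
        "\<And>k. P k \<Longrightarrow> Q k \<Longrightarrow> False"
      unfolding E_def eventually_inf by blast
    then obtain R where R: "eventually R (nhds u)" "\<And>k. R (v k) \<Longrightarrow> Q k"
      unfolding eventually_filtercomap by blast
    have "eventually (\<lambda>w. \<not> R w) (filtermap v sequentially)"
      unfolding eventually_filtermap
      by (rule eventually_mono[OF PQ(1)]) (use PQ(3) R(2) in blast)
    then have "eventually (\<lambda>_. False) (inf (nhds u) (filtermap v sequentially))"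
      unfolding eventually_inf using R(1) by blast
    then show False using u by (simp add: trivial_limit_def)
  qed
  moreover have "E \<le> sequentially" by (simp add: E_def)
  moreover have "((\<lambda>k. v k y) \<longlongrightarrow> u y) E" for y
  proof -
    have lim: "(v \<longlongrightarrow> u) E"
      unfolding E_def by (rule filterlim_mono[OF filterlim_filtercomap order_refl]) simp
    show ?thesis
    proof (rule topological_tendstoI)
      fix S :: "complex set" assume S: "open S" "u y \<in> S"
      have "open ((\<lambda>w::'a \<Rightarrow> complex. w y) -` S)"
        by (rule open_vimage[OF S(1) continuous_on_product_coordinates])
      then show "eventually (\<lambda>k. v k y \<in> S) E"
        using topological_tendstoD[OF lim, of "(\<lambda>w. w y) -` S"] S(2) by simp
    qed
  qed
  ultimately show thesis using that by blast
qed

text \<open>A value of modulus other than one would make the powers of it, or of its inverse, unbounded.\<close>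

lemma bounded_multiplicative_is_character:
  fixes \<gamma> :: "'g::{topological_ab_group_add, t2_space} \<Rightarrow> complex"
  assumes cont: "continuous_on UNIV \<gamma>" and mult: "\<And>x y. \<gamma> (x + y) = \<gamma> x * \<gamma> y"
    and nz: "\<gamma> 0 \<noteq> 0" and bound: "\<And>x. norm (\<gamma> x) \<le> B"
  shows "character \<gamma>"
proof -
  have le1: "norm (\<gamma> x) \<le> 1" for x
  proof (rule ccontr)
    assume "\<not> norm (\<gamma> x) \<le> 1"
    then obtain n where n: "B < norm (\<gamma> x) ^ n"
      using real_arch_pow[of "norm (\<gamma> x)" B] by auto
    have "\<exists>y. \<gamma> y = \<gamma> x ^ n" if "n > 0" for n
      using that
    proof (induction n rule: nat_induct_non_zero)
      case 1
      show ?case by (intro exI[of _ x]) simp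
    next
      case (Suc n)
      then obtain y where "\<gamma> y = \<gamma> x ^ n" by blast
      then show ?case by (intro exI[of _ "x + y"]) (simp add: mult)
    qed
    moreover have "n > 0"
    proof (rule ccontr)
      assume "\<not> n > 0"
      then have "B < 1" using n by simp
      then show False using bound[of x] \<open>\<not> norm (\<gamma> x) \<le> 1\<close> by linarith
    qed
    ultimately obtain y where "\<gamma> y = \<gamma> x ^ n" by blast
    then show False using bound[of y] n by (simp add: norm_power)
  qed
  have "\<gamma> 0 = 1" using mult[of 0 0] nz by simp
  have "norm (\<gamma> x) = 1" for x
  proof -
    have "norm (\<gamma> x) * norm (\<gamma> (- x)) = 1"
      using mult[of x "- x"] \<open>\<gamma> 0 = 1\<close> by (metis add.right_inverse norm_mult norm_one)
    moreover have "norm (\<gamma> x) * norm (\<gamma> (- x)) \<le> norm (\<gamma> x) * 1"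
      using le1[of "- x"] by (intro mult_left_mono) auto
    ultimately show ?thesis using le1[of x] by linarith
  qed
  then show ?thesis using cont mult by (auto simp: character_def)
qed

lemma norm_cnj_times_self: "norm z = 1 \<Longrightarrow> z * cnj z = 1"
  by (simp add: complex_norm_square[symmetric])

context haar_on_dirichlet_group
begin

lemma flow_zero: "\<beta> 0 = 0"
  using flow_add[of 0 0] by simp

text \<open>
  Let \<open>u\<close> be a cluster point of the \<open>v k\<close>. The factors \<open>c k\<close> need not converge, but they cancel in
  \<open>u (y + \<beta> s) u z = u y u (z + \<beta> s)\<close>. By density this holds with any group element in place of
  \<open>\<beta> s\<close>, so that \<open>u / u 0\<close> is a character. Equicontinuity makes the convergence uniform, hence the
  coefficients of the \<open>v k\<close> at this character come arbitrarily close to \<open>u 0 \<noteq> 0\<close>.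
\<close>

lemma approximate_eigenfunctions_give_character:
  fixes v :: "nat \<Rightarrow> 'g \<Rightarrow> complex"
  assumes cont: "\<And>k. continuous_on UNIV (v k)"
    and bound: "\<And>k y. norm (v k y) \<le> B"
    and equi: "\<And>e. e > 0 \<Longrightarrow>
      \<exists>U. open U \<and> 0 \<in> U \<and> (\<forall>k y. \<forall>w\<in>U. norm (v k (y + w) - v k y) \<le> e)"
    and eig: "\<And>s. s \<ge> 0 \<Longrightarrow> \<exists>c. \<forall>y. (\<lambda>k. v k (y + \<beta> s) - c k * v k y) \<longlonglongrightarrow> 0"
    and low: "\<And>k. norm (v k 0) \<ge> \<epsilon>" and pos: "\<epsilon> > 0"
  shows "\<exists>\<gamma> k. character \<gamma> \<and> coeff (v k) \<gamma> \<noteq> 0"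
proof -
  obtain E u where E: "E \<le> sequentially" "E \<noteq> bot"
    and lim: "\<And>y. ((\<lambda>k. v k y) \<longlongrightarrow> u y) E"
    using pointwise_cluster_function[of v B] bound by blast
  have u_bound: "norm (u y) \<le> B" for y
    by (rule tendsto_upperbound[OF tendsto_norm[OF lim[of y]]]) (use bound E(2) in auto)
  have u0: "norm (u 0) \<ge> \<epsilon>"
    by (rule tendsto_lowerbound[OF tendsto_norm[OF lim[of 0]]]) (use low E(2) in auto)
  then have u0nz: "u 0 \<noteq> 0" using pos by auto
  have u_equi: "\<exists>U. open U \<and> 0 \<in> U \<and> (\<forall>k y. \<forall>w\<in>U. norm (v k (y + w) - v k y) \<le> e) \<and>
      (\<forall>y. \<forall>w\<in>U. norm (u (y + w) - u y) \<le> e)" if e: "e > 0" for e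
  proof -
    obtain U where U: "open U" "0 \<in> U" "\<forall>k y. \<forall>w\<in>U. norm (v k (y + w) - v k y) \<le> e"
      using equi[OF e] by blast
    have "norm (u (y + w) - u y) \<le> e" if "w \<in> U" for y w
      by (rule tendsto_upperbound[OF tendsto_norm[OF tendsto_diff[OF lim lim]]])
         (use U(3) that E(2) in auto)
    then show ?thesis using U by blast
  qed
  have u_cont: "continuous_on UNIV u"
    unfolding continuous_on_eq_continuous_at[OF open_UNIV] isCont_def
  proof (intro ballI tendstoI)
    fix y e :: real and x :: 'g
    assume "e > 0"
    then obtain U where U: "open U" "0 \<in> U" "\<And>y w. w \<in> U \<Longrightarrow> norm (u (y + w) - u y) \<le> e / 2"
      using u_equi[of "e / 2"] by auto
    have "open ((\<lambda>z. z - x) -` U)"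
      using U(1) by (intro open_vimage continuous_intros)
    moreover have "x \<in> (\<lambda>z. z - x) -` U" using U(2) by simp
    moreover have "dist (u z) (u x) < e" if "z \<in> (\<lambda>z. z - x) -` U" for z
      using U(3)[of "z - x" x] that \<open>e > 0\<close> by (simp add: dist_norm)
    ultimately show "eventually (\<lambda>z. dist (u z) (u x) < e) (at x)"
      unfolding eventually_at_topological by blast
  qed
  have flow_pos: "u (y + \<beta> s) * u z = u y * u (z + \<beta> s)" if s: "s \<ge> 0" for s y z
  proof -
    obtain c where c: "\<And>y. (\<lambda>k. v k (y + \<beta> s) - c k * v k y) \<longlonglongrightarrow> 0"
      using eig[OF s] by blast
    have c': "((\<lambda>k. v k (y + \<beta> s) - c k * v k y) \<longlongrightarrow> 0) E" for y
      by (rule tendsto_mono[OF E(1) c])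
    have "((\<lambda>k. (v k (y + \<beta> s) - c k * v k y) * v k z - v k y * (v k (z + \<beta> s) - c k * v k z))
        \<longlongrightarrow> 0 * u z - u y * 0) E"
      by (intro tendsto_intros c' lim)
    then have "((\<lambda>k. v k (y + \<beta> s) * v k z - v k y * v k (z + \<beta> s)) \<longlongrightarrow> 0) E"
      by (simp add: algebra_simps)
    moreover have "((\<lambda>k. v k (y + \<beta> s) * v k z - v k y * v k (z + \<beta> s)) \<longlongrightarrow>
        u (y + \<beta> s) * u z - u y * u (z + \<beta> s)) E"
      by (intro tendsto_intros lim)
    ultimately have "0 = u (y + \<beta> s) * u z - u y * u (z + \<beta> s)"
      by (rule tendsto_unique[OF E(2)])
    then show ?thesis by simp
  qed
  have flow: "u (y + \<beta> s) * u z = u y * u (z + \<beta> s)" for s y z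
  proof (cases "s \<ge> 0")
    case False
    have inv: "w + \<beta> s + \<beta> (- s) = w" for w
      using flow_add[of s "- s"] flow_zero by (simp add: add.assoc)
    show ?thesis
      using flow_pos[of "- s" "y + \<beta> s" "z + \<beta> s"] False by (simp add: inv)
  qed (rule flow_pos)
  have u_mult: "u (y + w) * u z = u y * u (z + w)" for w y z
  proof -
    have "closed {w. u (y + w) * u z = u y * u (z + w)}"
      by (intro closed_Collect_eq continuous_intros continuous_on_compose2[OF u_cont]) auto
    moreover have "range \<beta> \<subseteq> {w. u (y + w) * u z = u y * u (z + w)}"
      using flow by auto
    ultimately have "closure (range \<beta>) \<subseteq> {w. u (y + w) * u z = u y * u (z + w)}"
      by (rule closure_minimal[rotated])
    then show ?thesis using flow_dense by auto
  qed
  define \<gamma> where "\<gamma> x = u x / u 0" for x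
  have \<gamma>: "character \<gamma>"
  proof (rule bounded_multiplicative_is_character)
    show "continuous_on UNIV \<gamma>"
      unfolding \<gamma>_def using u0nz by (intro continuous_intros u_cont) auto
    show "\<gamma> (x + y) = \<gamma> x * \<gamma> y" for x y
      using u_mult[of x y 0] u0nz by (simp add: \<gamma>_def field_simps)
    show "\<gamma> 0 \<noteq> 0" using u0nz by (simp add: \<gamma>_def)
    show "norm (\<gamma> x) \<le> B / norm (u 0)" for x
      using u_bound[of x] by (simp add: \<gamma>_def norm_divide divide_right_mono)
  qed
  have \<gamma>_cont: "continuous_on UNIV \<gamma>" and \<gamma>_norm: "norm (\<gamma> x) = 1" for x
    using \<gamma> by (auto simp: character_def)
  have coeff_u: "(LINT x|m. u x * cnj (\<gamma> x)) = u 0"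
  proof -
    have "u x * cnj (\<gamma> x) = u 0" for x
    proof -
      have "u x = u 0 * \<gamma> x" using u0nz by (simp add: \<gamma>_def)
      then have "u x * cnj (\<gamma> x) = u 0 * (\<gamma> x * cnj (\<gamma> x))" by simp
      then show ?thesis using norm_cnj_times_self[OF \<gamma>_norm[of x]] by simp
    qed
    then show ?thesis by simp
  qed
  show ?thesis
  proof (rule ccontr)
    assume "\<not> ?thesis"
    then have zero: "(LINT x|m. v k x * cnj (\<gamma> x)) = 0" for k
      using \<gamma> by (auto simp: fourier_coeff_def)
    have small: "norm (u 0) \<le> 3 * e" if e: "e > 0" for e
    proof -
      obtain U where U: "open U" "0 \<in> U"
        "\<And>k y w. w \<in> U \<Longrightarrow> norm (v k (y + w) - v k y) \<le> e"
        "\<And>y w. w \<in> U \<Longrightarrow> norm (u (y + w) - u y) \<le> e"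
        using u_equi[OF e] by blast
      obtain F where F: "finite F" "UNIV = (\<Union>x\<in>F. (\<lambda>y. x + y) ` U)"
        using finite_translates_cover[OF U(1,2)] .
      have "eventually (\<lambda>k. \<forall>x\<in>F. norm (v k x - u x) < e) E"
        using F(1) lim e by (intro eventually_ball_finite) (auto simp: tendsto_iff dist_norm)
      then obtain k where k: "\<And>x. x \<in> F \<Longrightarrow> norm (v k x - u x) < e"
        using E(2) eventually_happens' by blast
      have unif: "norm (u y - v k y) \<le> 3 * e" for y
      proof -
        obtain x w where xw: "x \<in> F" "w \<in> U" "y = x + w" using F(2) by blast
        have "u y - v k y = (u (x + w) - u x) - (v k x - u x) - (v k (x + w) - v k x)"
          using xw(3) by simp
        also have "norm \<dots> \<le> norm (u (x + w) - u x) + norm (v k x - u x) + norm (v k (x + w) - v k x)"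
          by (meson norm_triangle_ineq4 order_trans add_mono order_refl)
        finally show ?thesis using U(3)[OF xw(2), of k x] U(4)[OF xw(2), of x] k[OF xw(1)] by linarith
      qed
      have int: "integrable m (\<lambda>x. u x * cnj (\<gamma> x))" "integrable m (\<lambda>x. v k x * cnj (\<gamma> x))"
        by (intro continuous_integrable continuous_intros u_cont cont \<gamma>_cont)+
      have "u 0 = (LINT x|m. (u x - v k x) * cnj (\<gamma> x))"
        using coeff_u zero[of k] int by (simp add: left_diff_distrib)
      then have "norm (u 0) \<le> (LINT x|m. norm ((u x - v k x) * cnj (\<gamma> x)))"
        by (simp add: integral_norm_bound)
      also have "\<dots> \<le> (LINT x|m. 3 * e)"
        by (intro integral_mono continuous_integrable continuous_intros u_cont cont \<gamma>_cont)
           (use unif \<gamma>_norm in \<open>auto simp: norm_mult\<close>)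
      finally show ?thesis by simp
    qed
    show False using small[of "norm (u 0) / 6"] u0nz by simp
  qed
qed

end

section \<open>Every nonzero continuous function has a nonzero Fourier coefficient\<close>

lemma sum_cis_roots_of_unity:
  fixes a :: int
  assumes M: "M > 0" and a: "\<bar>a\<bar> < 2 * int M"
  shows "(\<Sum>k<2*M. cis (pi * real k * of_int a / real M)) = (if a = 0 then of_nat (2 * M) else 0)"
proof (cases "a = 0")
  case False
  define w where "w = cis (pi * of_int a / real M)"
  have pow: "cis (pi * real k * of_int a / real M) = w ^ k" for k
    by (simp add: w_def Complex.DeMoivre mult_ac)
  have "w ^ (2 * M) = cis (2 * pi * of_int a)"
    using M by (simp add: w_def Complex.DeMoivre mult_ac)
  then have "w ^ (2 * M) = 1" by (simp add: cis_multiple_2pi)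
  moreover have "w \<noteq> 1"
  proof
    assume "w = 1"
    then obtain n :: int where "pi * of_int a / real M = of_int (2 * n) * pi"
      unfolding w_def cis_conv_exp exp_eq_1 by auto
    then have "real_of_int a = of_int (2 * n * int M)"
      using M by (simp add: field_simps)
    then have "a = 2 * int M * n"
      unfolding of_int_eq_iff by (simp add: mult_ac)
    then have "\<bar>n\<bar> \<ge> 1" "\<bar>a\<bar> = 2 * int M * \<bar>n\<bar>"
      using False by (auto simp: abs_mult)
    then have "\<bar>a\<bar> \<ge> 2 * int M * 1"
      by (simp only:) (rule mult_left_mono, auto)
    then show False using a by simp
  qed
  ultimately have "(\<Sum>k<2*M. w ^ k) = 0"
    by (simp add: geometric_sum)
  then show ?thesis using False by (simp add: pow)
qed simp

lemma norm_sum_shift_le: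
  fixes h :: "nat \<Rightarrow> complex"
  assumes "\<And>j. norm (h j) \<le> B"
  shows "norm ((\<Sum>j<M. h (j + d)) - (\<Sum>j<M. h j)) \<le> 2 * real d * B"
proof (induction d)
  case (Suc d)
  have "(\<Sum>j<M. h (j + Suc d)) - (\<Sum>j<M. h (j + d)) = h (M + d) - h d"
    using sum_lessThan_telescope[of "\<lambda>j. h (j + d)" M] by (simp add: sum_subtractf)
  then have "(\<Sum>j<M. h (j + Suc d)) - (\<Sum>j<M. h j) =
      ((\<Sum>j<M. h (j + d)) - (\<Sum>j<M. h j)) + (h (M + d) - h d)"
    by (simp add: algebra_simps)
  then have "norm ((\<Sum>j<M. h (j + Suc d)) - (\<Sum>j<M. h j)) \<le>
      norm ((\<Sum>j<M. h (j + d)) - (\<Sum>j<M. h j)) + (norm (h (M + d)) + norm (h d))"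
    by (simp only:) (rule order_trans[OF norm_triangle_ineq add_left_mono[OF norm_triangle_ineq4]])
  then show ?case using Suc.IH assms[of "M + d"] assms[of d] by (simp add: algebra_simps)
qed simp

context haar_on_dirichlet_group
begin

definition autocorrelation :: "('g \<Rightarrow> complex) \<Rightarrow> 'g \<Rightarrow> complex" where
  "autocorrelation f w = (LINT x|m. f (x + w) * cnj (f x))"

text \<open>
  Put \<open>G\<^sub>k = \<Sum>\<^sub>j f(\<cdot> + \<beta>(s j)) e\<^sup>-\<^sup>i\<^sup>\<pi>\<^sup>j\<^sup>k\<^sup>/\<^sup>M\<close> for \<open>k < 2 M\<close>. Expanding \<open>\<Sum>\<^sub>k \<parallel>G\<^sub>k\<parallel>\<^sup>2 \<langle>f, G\<^sub>k\<rangle>\<close> gives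
  terms indexed by \<open>j, l, d < M\<close> with the frequency \<open>j - l - d\<close>. As there are \<open>2 M\<close> values of \<open>k\<close>,
  only the terms with \<open>j = l + d\<close> survive, and the sum is \<open>2 M\<close> times the left-hand side. The factors
  \<open>\<parallel>G\<^sub>k\<parallel>\<^sup>2\<close> are non-negative and have a known sum; the other factors are bounded by the hypothesis.
\<close>

lemma autocorrelation_sum_le:
  fixes f :: "'g \<Rightarrow> complex" and s \<eta> :: real and M :: nat
  assumes f: "continuous_on UNIV f" and M: "M > 0"
    and \<eta>: "\<And>\<theta> y. norm (\<Sum>j<M. f (y + \<beta> (s * real j)) * cis (- \<theta> * real j)) \<le> real M * \<eta>"
  shows "(\<Sum>j<M. \<Sum>l\<le>j. (norm (autocorrelation f (\<beta> (s * real (j - l)))))\<^sup>2)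
           \<le> (real M)\<^sup>2 * \<eta> * (LINT x|m. (norm (f x))\<^sup>2) * (LINT x|m. norm (f x))"
proof -
  define z where "z j = \<beta> (s * real j)" for j :: nat
  define e where "e k a = cis (pi * real k * of_int a / real M)" for k :: nat and a :: int
  define ip where "ip j l = (LINT x|m. f (x + z j) * cnj (f (x + z l)))" for j l
  define \<phi> where "\<phi> d = autocorrelation f (z d)" for d
  define G where "G k x = (\<Sum>j<M. f (x + z j) * e k (- int j))" for k x
  define p where "p k = (LINT x|m. (norm (G k x))\<^sup>2)" for k
  define F where "F k = (LINT x|m. G k x * cnj (f x))" for k
  define f1 where "f1 = (LINT x|m. norm (f x))"
  define f2 where "f2 = (LINT x|m. (norm (f x))\<^sup>2)"
  have e_add: "e k a * e k b = e k (a + b)" for k a b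
    by (simp add: e_def cis_mult add_divide_distrib ring_distribs)
  have e_cnj: "cnj (e k a) = e k (- a)" for k a
    by (simp add: e_def cis_cnj)
  have e_sum: "(\<Sum>k<2*M. e k a) = (if a = 0 then of_nat (2 * M) else 0)" if "\<bar>a\<bar> < 2 * int M" for a
    unfolding e_def by (rule sum_cis_roots_of_unity[OF M that])
  have shift_cont: "continuous_on UNIV (\<lambda>x. f (x + a))" for a
    by (intro continuous_on_compose2[OF f] continuous_intros) auto
  have G_cont: "continuous_on UNIV (G k)" for k
    unfolding G_def by (intro continuous_intros shift_cont)
  have G_bound: "norm (G k x) \<le> real M * \<eta>" for k x
  proof -
    have "G k x = (\<Sum>j<M. f (x + \<beta> (s * real j)) * cis (- (pi * real k / real M) * real j))"
      unfolding G_def e_def z_def by (intro sum.cong refl) (simp add: field_simps)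
    then show ?thesis using \<eta>[of x "pi * real k / real M"] by simp
  qed
  have ip_shift: "ip j l = \<phi> (j - l)" if "l \<le> j" for j l
  proof -
    have "z j = z l + z (j - l)"
      unfolding z_def flow_add[symmetric] using that by (simp add: of_nat_diff algebra_simps)
    then have "ip j l = (LINT x|m. f ((x + z l) + z (j - l)) * cnj (f (x + z l)))"
      by (simp add: ip_def add.assoc)
    also have "\<dots> = (LINT x|m. f (x + z (j - l)) * cnj (f x))"
      by (rule continuous_integral_shift) (intro continuous_intros shift_cont f)
    finally show ?thesis by (simp add: \<phi>_def autocorrelation_def)
  qed
  have ip_diag: "ip j j = of_real f2" for j
  proof -
    have "ip j j = \<phi> 0" using ip_shift[of j j] by simp
    also have "\<dots> = (LINT x|m. complex_of_real ((norm (f x))\<^sup>2))"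
      unfolding complex_norm_square by (simp add: \<phi>_def autocorrelation_def z_def flow_zero)
    also have "\<dots> = of_real f2" by (simp add: f2_def del: of_real_power)
    finally show ?thesis .
  qed
  have p_expand: "complex_of_real (p k) = (\<Sum>j<M. \<Sum>l<M. ip j l * e k (int l - int j))" for k
  proof -
    have "complex_of_real (p k) = (LINT x|m. complex_of_real ((norm (G k x))\<^sup>2))"
      by (simp add: p_def del: of_real_power)
    also have "\<dots> = (LINT x|m. (\<Sum>j<M. \<Sum>l<M. (f (x + z j) * cnj (f (x + z l))) * e k (int l - int j)))"
    proof (intro Bochner_Integration.integral_cong refl)
      fix x
      have "complex_of_real ((norm (G k x))\<^sup>2) = G k x * cnj (G k x)"
        by (rule complex_norm_square)
      also have "\<dots> = (\<Sum>j<M. \<Sum>l<M. (f (x + z j) * e k (- int j)) * (cnj (f (x + z l)) * e k (int l)))"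
        unfolding G_def by (simp add: sum_product e_cnj)
      also have "\<dots> = (\<Sum>j<M. \<Sum>l<M. (f (x + z j) * cnj (f (x + z l))) * e k (int l - int j))"
      proof (intro sum.cong refl)
        fix j l
        have "e k (int l - int j) = e k (- int j) * e k (int l)" by (simp add: e_add)
        then show "f (x + z j) * e k (- int j) * (cnj (f (x + z l)) * e k (int l)) =
            f (x + z j) * cnj (f (x + z l)) * e k (int l - int j)" by simp
      qed
      finally show "complex_of_real ((norm (G k x))\<^sup>2) =
          (\<Sum>j<M. \<Sum>l<M. (f (x + z j) * cnj (f (x + z l))) * e k (int l - int j))" .
    qed
    also have "\<dots> = (\<Sum>j<M. \<Sum>l<M. ip j l * e k (int l - int j))"
      unfolding ip_def
      by (subst Bochner_Integration.integral_sum
          | intro sum.cong refl continuous_integrable continuous_intros shift_cont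
          | simp)+
    finally show ?thesis .
  qed
  have F_expand: "F k = (\<Sum>d<M. \<phi> d * e k (- int d))" for k
  proof -
    have "F k = (LINT x|m. (\<Sum>d<M. (f (x + z d) * cnj (f x)) * e k (- int d)))"
      unfolding F_def G_def by (simp add: sum_distrib_right sum_distrib_left mult_ac)
    also have "\<dots> = (\<Sum>d<M. (LINT x|m. (f (x + z d) * cnj (f x)) * e k (- int d)))"
      by (rule Bochner_Integration.integral_sum)
         (intro continuous_integrable continuous_intros shift_cont f)
    also have "\<dots> = (\<Sum>d<M. \<phi> d * e k (- int d))"
      by (simp add: \<phi>_def autocorrelation_def)
    finally show ?thesis .
  qed
  have F_bound: "norm (F k) \<le> real M * \<eta> * f1" for k
  proof -
    have "norm (F k) \<le> (LINT x|m. norm (G k x * cnj (f x)))"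
      unfolding F_def by (rule integral_norm_bound)
    also have "\<dots> \<le> (LINT x|m. real M * \<eta> * norm (f x))"
      by (intro integral_mono continuous_integrable continuous_intros G_cont f)
         (auto simp: norm_mult G_bound intro!: mult_right_mono)
    also have "\<dots> = real M * \<eta> * f1" by (simp add: f1_def)
    finally show ?thesis .
  qed
  have p_nonneg: "p k \<ge> 0" for k unfolding p_def by simp
  have p_sum: "(\<Sum>k<2*M. p k) = 2 * real M * real M * f2"
  proof -
    have "complex_of_real (\<Sum>k<2*M. p k) = (\<Sum>k<2*M. \<Sum>j<M. \<Sum>l<M. ip j l * e k (int l - int j))"
      by (simp add: p_expand)
    also have "\<dots> = (\<Sum>j<M. \<Sum>k<2*M. \<Sum>l<M. ip j l * e k (int l - int j))"
      by (rule sum.swap)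
    also have "\<dots> = (\<Sum>j<M. \<Sum>l<M. \<Sum>k<2*M. ip j l * e k (int l - int j))"
      by (intro sum.cong refl sum.swap)
    also have "\<dots> = (\<Sum>j<M. \<Sum>l<M. ip j l * (if l = j then of_nat (2 * M) else 0))"
      by (intro sum.cong refl) (auto simp: sum_distrib_left[symmetric] e_sum)
    also have "\<dots> = (\<Sum>j<M. of_real f2 * of_nat (2 * M))"
    proof (intro sum.cong refl)
      fix j assume j: "j \<in> {..<M}"
      have "(\<Sum>l<M. ip j l * (if l = j then of_nat (2 * M) else 0))
          = (\<Sum>l<M. if l = j then ip j l * of_nat (2 * M) else 0)"
        by (intro sum.cong) auto
      also have "\<dots> = of_real f2 * of_nat (2 * M)"
        using j by (simp add: sum.delta ip_diag)
      finally show "(\<Sum>l<M. ip j l * (if l = j then of_nat (2 * M) else 0)) = of_real f2 * of_nat (2 * M)" .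
    qed
    also have "\<dots> = complex_of_real (2 * real M * real M * f2)" by simp
    finally show ?thesis unfolding of_real_eq_iff .
  qed
  define S where "S = (\<Sum>j<M. \<Sum>l\<le>j. (norm (\<phi> (j - l)))\<^sup>2)"
  have cnj_F: "cnj (F k) = (\<Sum>d<M. cnj (\<phi> d) * e k (int d))" for k
    unfolding F_expand by (simp add: e_cnj)
  have T: "(\<Sum>k<2*M. complex_of_real (p k) * cnj (F k)) = of_real (2 * real M * S)"
  proof -
    have "(\<Sum>k<2*M. complex_of_real (p k) * cnj (F k)) =
        (\<Sum>k<2*M. \<Sum>j<M. \<Sum>l<M. \<Sum>d<M. ip j l * cnj (\<phi> d) * e k (int l - int j + int d))"
    proof (intro sum.cong refl)
      fix k
      have "ip j l * e k (int l - int j) * (\<Sum>d<M. cnj (\<phi> d) * e k (int d)) =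
          (\<Sum>d<M. ip j l * cnj (\<phi> d) * e k (int l - int j + int d))" for j l
        by (simp add: sum_distrib_left e_add[symmetric] mult_ac)
      then show "complex_of_real (p k) * cnj (F k) =
          (\<Sum>j<M. \<Sum>l<M. \<Sum>d<M. ip j l * cnj (\<phi> d) * e k (int l - int j + int d))"
        unfolding p_expand cnj_F by (simp add: sum_distrib_right)
    qed
    also have "\<dots> = (\<Sum>j<M. \<Sum>k<2*M. \<Sum>l<M. \<Sum>d<M. ip j l * cnj (\<phi> d) * e k (int l - int j + int d))"
      by (rule sum.swap)
    also have "\<dots> = (\<Sum>j<M. \<Sum>l<M. \<Sum>k<2*M. \<Sum>d<M. ip j l * cnj (\<phi> d) * e k (int l - int j + int d))"
      by (intro sum.cong refl sum.swap)
    also have "\<dots> = (\<Sum>j<M. \<Sum>l<M. \<Sum>d<M. \<Sum>k<2*M. ip j l * cnj (\<phi> d) * e k (int l - int j + int d))"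
      by (intro sum.cong refl sum.swap)
    also have "\<dots> = (\<Sum>j<M. \<Sum>l<M. \<Sum>d<M. ip j l * cnj (\<phi> d) * (if l + d = j then of_nat (2 * M) else 0))"
      by (intro sum.cong refl) (auto simp: sum_distrib_left[symmetric] e_sum)
    also have "\<dots> = (\<Sum>j<M. \<Sum>l\<le>j. of_nat (2 * M) * complex_of_real ((norm (\<phi> (j - l)))\<^sup>2))"
    proof (rule sum.cong[OF refl])
      fix j assume j: "j \<in> {..<M}"
      have "(\<Sum>d<M. ip j l * cnj (\<phi> d) * (if l + d = j then of_nat (2 * M) else 0)) =
          (if l \<le> j then of_nat (2 * M) * complex_of_real ((norm (\<phi> (j - l)))\<^sup>2) else 0)" for l
      proof (cases "l \<le> j")
        case True
        have "(\<Sum>d<M. ip j l * cnj (\<phi> d) * (if l + d = j then of_nat (2 * M) else 0)) =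
            (\<Sum>d<M. if d = j - l then ip j l * cnj (\<phi> d) * of_nat (2 * M) else 0)"
          using True by (intro sum.cong) auto
        also have "\<dots> = ip j l * cnj (\<phi> (j - l)) * of_nat (2 * M)"
          using j by (simp add: sum.delta)
        also have "\<dots> = of_nat (2 * M) * complex_of_real ((norm (\<phi> (j - l)))\<^sup>2)"
          unfolding complex_norm_square ip_shift[OF True] by simp
        finally show ?thesis using True by simp
      qed auto
      then have "(\<Sum>l<M. \<Sum>d<M. ip j l * cnj (\<phi> d) * (if l + d = j then of_nat (2 * M) else 0)) =
          (\<Sum>l<M. if l \<le> j then of_nat (2 * M) * complex_of_real ((norm (\<phi> (j - l)))\<^sup>2) else 0)"
        by simp
      also have "\<dots> = (\<Sum>l\<in>{l \<in> {..<M}. l \<le> j}. of_nat (2 * M) * complex_of_real ((norm (\<phi> (j - l)))\<^sup>2))"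
        by (rule sum.inter_filter[symmetric]) simp
      also have "{l \<in> {..<M}. l \<le> j} = {..j}" using j by auto
      finally show "(\<Sum>l<M. \<Sum>d<M. ip j l * cnj (\<phi> d) * (if l + d = j then of_nat (2 * M) else 0)) =
          (\<Sum>l\<le>j. of_nat (2 * M) * complex_of_real ((norm (\<phi> (j - l)))\<^sup>2))" .
    qed
    also have "\<dots> = of_real (2 * real M * S)"
      by (simp add: S_def sum_distrib_left)
    finally show ?thesis .
  qed
  have S_nonneg: "S \<ge> 0" unfolding S_def by (intro sum_nonneg) auto
  have "2 * real M * S = norm (\<Sum>k<2*M. complex_of_real (p k) * cnj (F k))"
    unfolding T norm_of_real using S_nonneg by simp
  also have "\<dots> \<le> (\<Sum>k<2*M. norm (complex_of_real (p k) * cnj (F k)))"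
    by (rule norm_sum)
  also have "\<dots> \<le> (\<Sum>k<2*M. p k * (real M * \<eta> * f1))"
    by (intro sum_mono) (auto simp: norm_mult p_nonneg F_bound intro!: mult_left_mono)
  also have "\<dots> = 2 * real M * ((real M)\<^sup>2 * \<eta> * f2 * f1)"
    by (simp add: sum_distrib_right[symmetric] p_sum power2_eq_square)
  finally have "S \<le> (real M)\<^sup>2 * \<eta> * f2 * f1"
    using M by simp
  then show ?thesis
    by (simp add: S_def \<phi>_def z_def f1_def f2_def)
qed

text \<open>
  The autocorrelation is bounded away from zero near the identity, and by the pigeonhole
  principle a fixed proportion of the differences of any long sequence is near the identity.
\<close>

lemma autocorrelation_sum_ge:
  fixes f :: "'g \<Rightarrow> complex"
  assumes f: "continuous_on UNIV f" and nz: "f a \<noteq> 0"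
  obtains \<kappa> where "\<kappa> > 0"
    "\<And>s M. \<kappa> * (real M)\<^sup>2 \<le> (\<Sum>j<M. \<Sum>l\<le>j. (norm (autocorrelation f (\<beta> (s * real (j - l)))))\<^sup>2)"
proof -
  define f1 where "f1 = (LINT x|m. norm (f x))"
  define f2 where "f2 = (LINT x|m. (norm (f x))\<^sup>2)"
  have f1_pos: "f1 > 0"
    unfolding f1_def using nz by (intro continuous_integral_pos[of _ a] continuous_intros f) auto
  have f2_pos: "f2 > 0"
    unfolding f2_def using nz by (intro continuous_integral_pos[of _ a] continuous_intros f) auto
  have shift_cont: "continuous_on UNIV (\<lambda>x. f (x + a))" for a
    by (intro continuous_on_compose2[OF f] continuous_intros) auto
  have pos: "f2 / (2 * f1) > 0" using f1_pos f2_pos by simp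
  obtain U where U: "open U" "0 \<in> U" "\<And>x u. u \<in> U \<Longrightarrow> norm (f (x + u) - f x) < f2 / (2 * f1)"
    using uniformly_continuous_at_zero[OF f pos] by blast
  have ac: "norm (autocorrelation f w) \<ge> f2 / 2" if w: "w \<in> U" for w
  proof -
    have "autocorrelation f w - of_real f2 = (LINT x|m. f (x + w) * cnj (f x)) - (LINT x|m. complex_of_real ((norm (f x))\<^sup>2))"
      by (simp add: autocorrelation_def f2_def del: of_real_power)
    also have "\<dots> = (LINT x|m. f (x + w) * cnj (f x) - complex_of_real ((norm (f x))\<^sup>2))"
      by (rule Bochner_Integration.integral_diff[symmetric])
         (intro continuous_integrable continuous_intros shift_cont f)+
    also have "\<dots> = (LINT x|m. (f (x + w) - f x) * cnj (f x))"
      unfolding complex_norm_square by (simp add: algebra_simps)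
    also have "norm \<dots> \<le> (LINT x|m. norm ((f (x + w) - f x) * cnj (f x)))"
      by (rule integral_norm_bound)
    also have "\<dots> \<le> (LINT x|m. f2 / (2 * f1) * norm (f x))"
    proof (intro integral_mono)
      show "norm ((f (x + w) - f x) * cnj (f x)) \<le> f2 / (2 * f1) * norm (f x)" for x
        unfolding norm_mult complex_mod_cnj using U(3)[OF w, of x] by (intro mult_right_mono) auto
    qed (intro continuous_integrable continuous_intros shift_cont f)+
    also have "\<dots> = f2 / 2" using f1_pos by (simp add: f1_def)
    finally have *: "norm (autocorrelation f w - of_real f2) \<le> f2 / 2" .
    have "norm (complex_of_real f2) \<le> norm (autocorrelation f w) + norm (autocorrelation f w - of_real f2)"
      using norm_triangle_ineq4[of "autocorrelation f w" "autocorrelation f w - of_real f2"] by simp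
    then show ?thesis using * f2_pos by simp
  qed
  have "open ((\<lambda>z. fst z - snd z) -` U :: ('g \<times> 'g) set)"
    using U(1) by (intro open_vimage continuous_intros)
  moreover have "(0, 0) \<in> (\<lambda>z. fst z - snd z) -` U" using U(2) by simp
  ultimately obtain A B where AB: "open A" "open B" "(0, 0) \<in> A \<times> B" "A \<times> B \<subseteq> (\<lambda>z. fst z - snd z) -` U"
    by (rule open_prod_elim)
  define V where "V = A \<inter> B"
  have V: "open V" "0 \<in> V" "\<And>x y. x \<in> V \<Longrightarrow> y \<in> V \<Longrightarrow> x - y \<in> U"
    using AB by (auto simp: V_def)
  obtain C where C: "finite C" "UNIV = (\<Union>x\<in>C. (\<lambda>y. x + y) ` V)"
    using finite_translates_cover[OF V(1,2)] .
  \<comment> \<open>The class of a point is a translate of \<open>V\<close> that contains it.\<close>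
  have "\<exists>c. c \<in> C \<and> x \<in> (\<lambda>y. c + y) ` V" for x using C(2) by blast
  then obtain cl where cl: "\<And>x. cl x \<in> C" "\<And>x. x \<in> (\<lambda>y. cl x + y) ` V" by metis
  define K where "K = card C"
  have K: "K > 0" using C(1) cl(1) by (auto simp: K_def card_gt_0_iff)
  have same: "x - y \<in> U" if eq: "cl x = cl y" for x y
  proof -
    obtain v w where "v \<in> V" "w \<in> V" "x = cl x + v" "y = cl y + w" using cl(2) by blast
    then have "x - y = v - w" using eq by (metis add_diff_cancel_left)
    then show ?thesis using V(3) \<open>v \<in> V\<close> \<open>w \<in> V\<close> by simp
  qed
  define \<kappa> where "\<kappa> = (f2 / 2)\<^sup>2 / (2 * (real K)\<^sup>2)"
  show thesis
  proof (rule that)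
    show "\<kappa> > 0" using f2_pos K by (simp add: \<kappa>_def)
    fix s :: real and M :: nat
    define z where "z j = \<beta> (s * real j)" for j :: nat
    define J where "J c = {j \<in> {..<M}. cl (z j) = c}" for c
    have "\<exists>c\<in>C. M \<le> K * card (J c)"
    proof (rule ccontr)
      assume neg: "\<not> (\<exists>c\<in>C. M \<le> K * card (J c))"
      have "M = card (\<Union>c\<in>C. J c)"
      proof -
        have "(\<Union>c\<in>C. J c) = {..<M}" using cl(1) by (auto simp: J_def)
        then show ?thesis by simp
      qed
      also have "\<dots> \<le> (\<Sum>c\<in>C. card (J c))" by (rule card_UN_le[OF C(1)])
      finally have "K * M \<le> (\<Sum>c\<in>C. K * card (J c))" by (simp add: sum_distrib_left[symmetric])
      also have "\<dots> < (\<Sum>c\<in>C. M)"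
        using neg C(1) K by (intro sum_strict_mono) (auto simp: K_def)
      also have "\<dots> = K * M" by (simp add: K_def)
      finally show False by simp
    qed
    then obtain c where c: "M \<le> K * card (J c)" by blast
    define P where "P = {(j, l). j \<in> J c \<and> l \<in> J c \<and> l \<le> j}"
    have fin: "finite (J c)" by (simp add: J_def)
    have finP: "finite P" by (rule finite_subset[of _ "J c \<times> J c"]) (auto simp: P_def fin)
    have "J c \<times> J c \<subseteq> P \<union> prod.swap ` P"
      by (auto simp: P_def image_iff)
    then have "card (J c \<times> J c) \<le> card (P \<union> prod.swap ` P)"
      using finP by (intro card_mono) auto
    also have "\<dots> \<le> card P + card P"
      using card_Un_le[of P "prod.swap ` P"] card_image_le[OF finP, of prod.swap] by linarith
    finally have cardP: "card (J c) * card (J c) \<le> 2 * card P"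
      unfolding card_cartesian_product by linarith
    have "(real M)\<^sup>2 \<le> (real (K * card (J c)))\<^sup>2"
      using c by (intro power_mono) (auto simp del: of_nat_mult)
    also have "\<dots> = (real K)\<^sup>2 * real (card (J c) * card (J c))"
      by (simp add: power2_eq_square)
    also have "\<dots> \<le> (real K)\<^sup>2 * real (2 * card P)"
      using cardP by (intro mult_left_mono) (auto simp del: of_nat_mult)
    finally have *: "(real M)\<^sup>2 / (2 * (real K)\<^sup>2) \<le> real (card P)"
      using K by (simp add: field_simps)
    have diff: "\<beta> (s * real (j - l)) = z j - z l" if "l \<le> j" for j l
    proof -
      have "z j = \<beta> (s * real (j - l)) + z l"
        unfolding z_def flow_add[symmetric] using that by (simp add: of_nat_diff algebra_simps)
      then show ?thesis by simp
    qed
    have "\<kappa> * (real M)\<^sup>2 = (f2 / 2)\<^sup>2 * ((real M)\<^sup>2 / (2 * (real K)\<^sup>2))"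
      by (simp add: \<kappa>_def)
    also have "\<dots> \<le> (f2 / 2)\<^sup>2 * real (card P)"
      using * by (intro mult_left_mono) auto
    also have "\<dots> = (\<Sum>(j, l)\<in>P. (f2 / 2)\<^sup>2)" by simp
    also have "\<dots> \<le> (\<Sum>(j, l)\<in>P. (norm (autocorrelation f (\<beta> (s * real (j - l)))))\<^sup>2)"
    proof (rule sum_mono, clarify)
      fix j l assume "(j, l) \<in> P"
      then have "l \<le> j" "cl (z j) = cl (z l)" by (auto simp: P_def J_def)
      then have "\<beta> (s * real (j - l)) \<in> U" using same diff by simp
      then show "(f2 / 2)\<^sup>2 \<le> (norm (autocorrelation f (\<beta> (s * real (j - l)))))\<^sup>2"
        using ac f2_pos by (intro power_mono) auto
    qed
    also have "\<dots> \<le> (\<Sum>(j, l)\<in>Sigma {..<M} (\<lambda>j. {..j}). (norm (autocorrelation f (\<beta> (s * real (j - l)))))\<^sup>2)"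
      by (intro sum_mono2) (auto simp: P_def J_def)
    also have "\<dots> = (\<Sum>j<M. \<Sum>l\<le>j. (norm (autocorrelation f (\<beta> (s * real (j - l)))))\<^sup>2)"
      by (rule sum.Sigma[symmetric]) auto
    finally show "\<kappa> * (real M)\<^sup>2 \<le> (\<Sum>j<M. \<Sum>l\<le>j. (norm (autocorrelation f (\<beta> (s * real (j - l)))))\<^sup>2)" .
  qed
qed

lemma fourier_coeff_translate:
  fixes f :: "'g \<Rightarrow> complex"
  assumes f: "continuous_on UNIV f" and \<gamma>: "character \<gamma>"
  shows "coeff (\<lambda>x. f (x + b)) \<gamma> = \<gamma> b * coeff f \<gamma>"
proof -
  have \<gamma>_cont: "continuous_on UNIV \<gamma>" and \<gamma>_norm: "\<And>x. norm (\<gamma> x) = 1"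
    and \<gamma>_add: "\<And>x y. \<gamma> (x + y) = \<gamma> x * \<gamma> y"
    using \<gamma> by (auto simp: character_def)
  have "cnj (\<gamma> x) = \<gamma> b * cnj (\<gamma> (x + b))" for x
    using norm_cnj_times_self[OF \<gamma>_norm[of b]] by (simp add: \<gamma>_add mult.left_commute)
  then have "f (x + b) * cnj (\<gamma> x) = \<gamma> b * (f (x + b) * cnj (\<gamma> (x + b)))" for x
    by (metis mult.left_commute)
  then have "coeff (\<lambda>x. f (x + b)) \<gamma> = (LINT x|m. \<gamma> b * (f (x + b) * cnj (\<gamma> (x + b))))"
    unfolding fourier_coeff_def by (intro Bochner_Integration.integral_cong refl)
  also have "\<dots> = \<gamma> b * (LINT x|m. f (x + b) * cnj (\<gamma> (x + b)))"
    by (rule integral_mult_right_zero)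
  also have "(LINT x|m. f (x + b) * cnj (\<gamma> (x + b))) = coeff f \<gamma>"
    unfolding fourier_coeff_def
    by (rule continuous_integral_shift) (intro continuous_intros f \<gamma>_cont)
  finally show ?thesis .
qed

text \<open>
  The bounds on the autocorrelation show that for each step \<open>1 / (k + 1)\<close> some exponential average of
  \<open>(k + 1)\<^sup>2\<close> translates of \<open>f\<close> has a supremum that exceeds a constant \<open>\<eta>\<close>. Moving a large value
  to \<open>0\<close> gives approximate eigenfunctions: the step tends to zero, so every \<open>\<beta> s\<close> is nearly a
  multiple of it, and the time \<open>k + 1\<close> over which the average extends tends to infinity.
\<close>

theorem continuous_function_has_nonzero_coefficient:
  fixes f :: "'g \<Rightarrow> complex"
  assumes f: "continuous_on UNIV f" and nz: "f a \<noteq> 0"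
  shows "\<exists>\<gamma>. character \<gamma> \<and> coeff f \<gamma> \<noteq> 0"
proof -
  define f1 where "f1 = (LINT x|m. norm (f x))"
  define f2 where "f2 = (LINT x|m. (norm (f x))\<^sup>2)"
  have f1_pos: "f1 > 0"
    unfolding f1_def using nz by (intro continuous_integral_pos[of _ a] continuous_intros f) auto
  have f2_pos: "f2 > 0"
    unfolding f2_def using nz by (intro continuous_integral_pos[of _ a] continuous_intros f) auto
  obtain \<kappa> where \<kappa>: "\<kappa> > 0"
    "\<And>s M. \<kappa> * (real M)\<^sup>2 \<le> (\<Sum>j<M. \<Sum>l\<le>j. (norm (autocorrelation f (\<beta> (s * real (j - l)))))\<^sup>2)"
    using autocorrelation_sum_ge[OF f nz] by blast
  define \<eta> where "\<eta> = \<kappa> / (2 * f1 * f2)"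
  have \<eta>: "\<eta> > 0" using \<kappa>(1) f1_pos f2_pos by (simp add: \<eta>_def)
  define M :: "nat \<Rightarrow> nat" where "M k = (Suc k)\<^sup>2" for k
  define z where "z k j = \<beta> (1 / real (Suc k) * real j)" for k j :: nat
  have M_pos: "M k > 0" for k by (simp add: M_def)
  have "\<exists>\<theta> y. norm (\<Sum>j<M k. f (y + z k j) * cis (- \<theta> * real j)) > real (M k) * \<eta>" for k
  proof (rule ccontr)
    assume "\<not> ?thesis"
    then have "norm (\<Sum>j<M k. f (y + \<beta> (1 / real (Suc k) * real j)) * cis (- \<theta> * real j)) \<le> real (M k) * \<eta>" for \<theta> y
      by (auto simp: not_less z_def)
    from autocorrelation_sum_le[OF f M_pos this] \<kappa>(2)[of "M k" "1 / real (Suc k)"]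
    have "\<kappa> * (real (M k))\<^sup>2 \<le> (real (M k))\<^sup>2 * \<eta> * f2 * f1"
      unfolding f1_def f2_def by linarith
    also have "\<dots> = (\<kappa> / 2) * (real (M k))\<^sup>2"
      using f1_pos f2_pos by (simp add: \<eta>_def)
    finally show False using \<kappa>(1) M_pos[of k] by simp
  qed
  then obtain \<theta> y where \<theta>y: "\<And>k. norm (\<Sum>j<M k. f (y k + z k j) * cis (- \<theta> k * real j)) > real (M k) * \<eta>"
    by metis
  define v where "v k x = (\<Sum>j<M k. f (x + y k + z k j) * cis (- \<theta> k * real j)) / of_nat (M k)" for k x
  obtain B where B: "B > 0" "\<And>x. norm (f x) \<le> B" using continuous_bounded[OF f] by blast
  have shift_cont: "continuous_on UNIV (\<lambda>x. f (x + a + b))" for a b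
    by (intro continuous_on_compose2[OF f] continuous_intros) auto
  have average: "norm ((\<Sum>j<M k. g j * cis (- \<theta> k * real j)) / of_nat (M k)) \<le> e"
    if "\<And>j. norm (g j) \<le> e" for k e g
  proof -
    have "norm (\<Sum>j<M k. g j * cis (- \<theta> k * real j)) \<le> (\<Sum>j<M k. e)"
      by (rule sum_norm_le) (simp add: norm_mult that)
    then show ?thesis using M_pos[of k] by (simp add: norm_divide field_simps)
  qed
  have v_equi: "\<exists>U. open U \<and> 0 \<in> U \<and> (\<forall>k y. \<forall>w\<in>U. norm (v k (y + w) - v k y) \<le> e)" if e: "e > 0" for e
  proof -
    obtain U where U: "open U" "0 \<in> U" "\<And>x u. u \<in> U \<Longrightarrow> norm (f (x + u) - f x) < e"
      using uniformly_continuous_at_zero[OF f e] by blast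
    have "norm (v k (x + w) - v k x) \<le> e" if w: "w \<in> U" for k x w
    proof -
      have "v k (x + w) - v k x =
          (\<Sum>j<M k. (f ((x + y k + z k j) + w) - f (x + y k + z k j)) * cis (- \<theta> k * real j)) / of_nat (M k)"
        by (simp add: v_def diff_divide_distrib sum_subtractf left_diff_distrib add_ac)
      then show ?thesis using U(3)[OF w] by (simp only:) (intro average less_imp_le)
    qed
    then show ?thesis using U by blast
  qed
  have v_bound: "norm (v k x) \<le> B" for k x
    unfolding v_def by (intro average B)
  have "\<exists>\<gamma> k. character \<gamma> \<and> coeff (v k) \<gamma> \<noteq> 0"
  proof (rule approximate_eigenfunctions_give_character)
    show "continuous_on UNIV (v k)" for k
      unfolding v_def using M_pos[of k] by (intro continuous_intros shift_cont) auto
    show "norm (v k x) \<le> B" for k x by (rule v_bound)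
    show "norm (v k 0) \<ge> \<eta>" for k
      using \<theta>y[of k] M_pos[of k] by (simp add: v_def norm_divide field_simps)
    show "\<eta> > 0" by (rule \<eta>)
    fix s :: real assume s: "s \<ge> 0"
    \<comment> \<open>The number of steps of length \<open>1 / (k + 1)\<close> that fit into the time \<open>s\<close>.\<close>
    define d where "d k = nat \<lfloor>s * real (Suc k)\<rfloor>" for k
    have d_le: "real (d k) \<le> s * real (Suc k)" and d_ge: "s * real (Suc k) < real (d k) + 1" for k
      using s by (simp_all add: d_def of_nat_nat)
    define c where "c k = cis (\<theta> k * real (d k))" for k
    have step: "norm (v k (x + z k (d k)) - c k * v k x) \<le> 2 * s * B / real (Suc k)" for k x
    proof -
      define h where "h j = f (x + y k + z k j) * cis (- \<theta> k * real j)" for j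
      have z_add: "z k (j + i) = z k j + z k i" for i j
        unfolding z_def flow_add[symmetric] by (simp add: add_divide_distrib)
      have "f (x + z k (d k) + y k + z k j) * cis (- \<theta> k * real j) = c k * h (j + d k)" for j
      proof -
        have "x + z k (d k) + y k + z k j = x + y k + z k (j + d k)"
          unfolding z_add by (simp add: add_ac)
        moreover have "cis (- \<theta> k * real j) = c k * cis (- \<theta> k * real (j + d k))"
          by (simp add: c_def cis_mult algebra_simps)
        ultimately show ?thesis by (simp only: h_def mult_ac)
      qed
      then have "v k (x + z k (d k)) = c k * (\<Sum>j<M k. h (j + d k)) / of_nat (M k)"
        by (simp add: v_def sum_distrib_left)
      then have "v k (x + z k (d k)) - c k * v k x =
          c k * ((\<Sum>j<M k. h (j + d k)) - (\<Sum>j<M k. h j)) / of_nat (M k)"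
        by (simp add: v_def h_def diff_divide_distrib right_diff_distrib)
      also have "norm \<dots> \<le> 2 * real (d k) * B / real (M k)"
        unfolding norm_divide norm_mult
        using norm_sum_shift_le[of h B, where M = "M k" and d = "d k"] B(2) M_pos[of k]
        by (auto simp: c_def h_def norm_mult divide_right_mono)
      also have "\<dots> \<le> 2 * (s * real (Suc k)) * B / real (M k)"
        using d_le[of k] B(1) by (intro divide_right_mono mult_right_mono mult_left_mono) auto
      also have "\<dots> = 2 * s * B / real (Suc k)"
        unfolding M_def power2_eq_square of_nat_mult
        by (simp only: divide_simps) (simp del: of_nat_Suc)
      finally show ?thesis .
    qed
    have step0: "(\<lambda>k. v k (x + z k (d k)) - c k * v k x) \<longlonglongrightarrow> 0" for x
    proof (rule Lim_null_comparison)
      show "(\<lambda>k. 2 * s * B / real (Suc k)) \<longlonglongrightarrow> 0"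
        using LIMSEQ_Suc[OF lim_const_over_n[of "2 * s * B"]] .
    qed (use step in auto)
    have rest: "(\<lambda>k. v k (x + \<beta> s) - v k (x + z k (d k))) \<longlonglongrightarrow> 0" for x
    proof (rule tendstoI)
      fix e :: real assume "e > 0"
      then obtain U where U: "open U" "0 \<in> U" "\<And>k y w. w \<in> U \<Longrightarrow> norm (v k (y + w) - v k y) \<le> e / 2"
        using v_equi[of "e / 2"] by auto
      have "(\<lambda>k. s - real (d k) / real (Suc k)) \<longlonglongrightarrow> 0"
      proof (rule Lim_null_comparison)
        show "(\<lambda>k. 1 / real (Suc k)) \<longlonglongrightarrow> 0"
          using LIMSEQ_Suc[OF lim_const_over_n[of "1::real"]] .
        have "norm (s - real (d k) / real (Suc k)) \<le> 1 / real (Suc k)" for k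
        proof -
          have "s - real (d k) / real (Suc k) = (s * real (Suc k) - real (d k)) / real (Suc k)"
            by (simp add: diff_divide_distrib del: of_nat_Suc)
          moreover have "\<bar>s * real (Suc k) - real (d k)\<bar> \<le> 1"
            using d_le[of k] d_ge[of k] by linarith
          ultimately show ?thesis
            by (simp add: abs_divide divide_right_mono del: of_nat_Suc)
        qed
        then show "eventually (\<lambda>k. norm (s - real (d k) / real (Suc k)) \<le> 1 / real (Suc k)) sequentially"
          by simp
      qed
      moreover have "isCont \<beta> 0"
        using continuous_on_flow by (simp add: continuous_on_eq_continuous_at)
      ultimately have "(\<lambda>k. \<beta> (s - real (d k) / real (Suc k))) \<longlonglongrightarrow> \<beta> 0"
        by (rule isCont_tendsto_compose[rotated])
      then have "eventually (\<lambda>k. \<beta> (s - real (d k) / real (Suc k)) \<in> U) sequentially"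
        using U(1,2) by (auto simp: flow_zero dest: topological_tendstoD)
      then show "eventually (\<lambda>k. dist (v k (x + \<beta> s) - v k (x + z k (d k))) 0 < e) sequentially"
      proof eventually_elim
        case (elim k)
        have eq: "x + \<beta> s = (x + z k (d k)) + \<beta> (s - real (d k) / real (Suc k))"
          unfolding z_def add.assoc flow_add[symmetric] by simp
        show ?case
          using U(3)[OF elim, of k "x + z k (d k)", folded eq] \<open>e > 0\<close> by (simp add: dist_norm)
      qed
    qed
    show "\<exists>c. \<forall>x. (\<lambda>k. v k (x + \<beta> s) - c k * v k x) \<longlonglongrightarrow> 0"
    proof (intro exI[of _ c] allI)
      show "(\<lambda>k. v k (x + \<beta> s) - c k * v k x) \<longlonglongrightarrow> 0" for x
        using tendsto_add[OF rest[of x] step0[of x]] by simp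
    qed
  qed (rule v_equi)
  then obtain \<gamma> k where \<gamma>: "character \<gamma>" and coeff: "coeff (v k) \<gamma> \<noteq> 0" by blast
  have \<gamma>_cont: "continuous_on UNIV \<gamma>"
    using \<gamma> by (auto simp: character_def)
  have "coeff f \<gamma> \<noteq> 0"
  proof
    assume zero: "coeff f \<gamma> = 0"
    have shift: "(LINT x|m. f (x + b) * cnj (\<gamma> x)) = 0" for b
      using fourier_coeff_translate[OF f \<gamma>, of b] zero by (simp add: fourier_coeff_def)
    have "coeff (v k) \<gamma> =
        (LINT x|m. (\<Sum>j<M k. (f (x + (y k + z k j)) * cnj (\<gamma> x)) * (cis (- \<theta> k * real j) / of_nat (M k))))"
      unfolding fourier_coeff_def v_def
      by (simp add: sum_divide_distrib sum_distrib_right sum_distrib_left mult_ac add_ac)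
    also have "\<dots> = (\<Sum>j<M k. (LINT x|m. (f (x + (y k + z k j)) * cnj (\<gamma> x)) * (cis (- \<theta> k * real j) / of_nat (M k))))"
    proof (rule Bochner_Integration.integral_sum)
      show "integrable m (\<lambda>x. f (x + (y k + z k j)) * cnj (\<gamma> x) * (cis (- \<theta> k * real j) / of_nat (M k)))" for j
        by (intro continuous_integrable continuous_intros continuous_on_compose2[OF f] \<gamma>_cont)
           (use M_pos[of k] in auto)
    qed
    also have "\<dots> = 0" by (simp add: shift)
    finally show False using coeff by simp
  qed
  then show ?thesis using \<gamma> by blast
qed

end

section \<open>Trigonometric polynomials\<close>

text \<open>
  The set \<open>A\<close> of admissible characters is a parameter because it is needed that products of analytic
  polynomials are analytic and that approximations of \<open>f\<close> involve no characters but those of \<open>f\<close>.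
\<close>

inductive trig_poly :: "('g::{topological_ab_group_add, t2_space} \<Rightarrow> complex) set \<Rightarrow> ('g \<Rightarrow> complex) \<Rightarrow> bool"
  for A where
  single: "\<gamma> \<in> A \<Longrightarrow> trig_poly A (\<lambda>x. c * \<gamma> x)"
| zero: "trig_poly A (\<lambda>x. 0)"
| add: "trig_poly A f \<Longrightarrow> trig_poly A g \<Longrightarrow> trig_poly A (\<lambda>x. f x + g x)"

lemma characterD:
  assumes "character \<gamma>"
  shows "continuous_on UNIV \<gamma>" "\<gamma> (x + y) = \<gamma> x * \<gamma> y" "norm (\<gamma> x) = 1"
    "\<gamma> x * cnj (\<gamma> x) = 1" "\<gamma> 0 = 1" "\<gamma> (- x) = cnj (\<gamma> x)" "\<gamma> x \<noteq> 0"
proof -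
  show *: "continuous_on UNIV \<gamma>" "\<And>x y. \<gamma> (x + y) = \<gamma> x * \<gamma> y" "\<And>x. norm (\<gamma> x) = 1"
    using assms by (auto simp: character_def)
  show inv: "\<gamma> x * cnj (\<gamma> x) = 1" for x by (rule norm_cnj_times_self[OF *(3)])
  show nz: "\<gamma> x \<noteq> 0" for x using *(3)[of x] by auto
  show one: "\<gamma> 0 = 1" using *(2)[of 0 0] nz[of 0] by simp
  have "\<gamma> x * \<gamma> (- x) = \<gamma> x * cnj (\<gamma> x)"
    using *(2)[of x "- x"] one inv by simp
  then show "\<gamma> (- x) = cnj (\<gamma> x)" using nz[of x] by simp
qed

lemma character_one: "character (\<lambda>_. 1)"
  by (simp add: character_def)

lemma character_mult: "character \<gamma> \<Longrightarrow> character \<delta> \<Longrightarrow> character (\<lambda>x. \<gamma> x * \<delta> x)"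
  unfolding character_def by (auto intro!: continuous_intros simp: norm_mult)

lemma character_cnj: "character \<gamma> \<Longrightarrow> character (\<lambda>x. cnj (\<gamma> x))"
  unfolding character_def by (auto intro!: continuous_intros)

abbreviation characters :: "('g::{topological_ab_group_add, t2_space} \<Rightarrow> complex) set" where
  "characters \<equiv> Collect character"

lemma trig_poly_cmult: "trig_poly A f \<Longrightarrow> trig_poly A (\<lambda>x. c * f x)"
proof (induction rule: trig_poly.induct)
  case (single \<gamma> d)
  then show ?case using trig_poly.single[of \<gamma> A "c * d"] by (simp add: mult.assoc)
qed (auto simp: distrib_left intro: trig_poly.intros)

lemma trig_poly_diff: "trig_poly A f \<Longrightarrow> trig_poly A g \<Longrightarrow> trig_poly A (\<lambda>x. f x - g x)"
  using trig_poly.add[of A f "\<lambda>x. - 1 * g x"] trig_poly_cmult[of A g "- 1"] by simp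

lemma trig_poly_sum:
  assumes "\<And>i. i \<in> I \<Longrightarrow> trig_poly A (f i)"
  shows "trig_poly A (\<lambda>x. \<Sum>i\<in>I. f i x)"
  using assms by (induction I rule: infinite_finite_induct) (auto intro: trig_poly.intros)

lemma trig_poly_mono: "trig_poly A f \<Longrightarrow> A \<subseteq> B \<Longrightarrow> trig_poly B f"
  by (induction rule: trig_poly.induct) (auto intro: trig_poly.intros)

lemma trig_poly_mult:
  assumes C: "\<And>\<gamma> \<delta>. \<gamma> \<in> A \<Longrightarrow> \<delta> \<in> B \<Longrightarrow> (\<lambda>x. \<gamma> x * \<delta> x) \<in> C"
    and f: "trig_poly A f" and g: "trig_poly B g"
  shows "trig_poly C (\<lambda>x. f x * g x)"
  using f
proof (induction rule: trig_poly.induct)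
  case (single \<gamma> c)
  from g show ?case
  proof (induction rule: trig_poly.induct)
    case (single \<delta> d)
    then show ?case
      using trig_poly.single[OF C[OF \<open>\<gamma> \<in> A\<close>], of \<delta> "c * d"] by (simp add: mult_ac)
  qed (auto simp: distrib_left intro: trig_poly.intros)
qed (auto simp: distrib_right intro: trig_poly.intros)

lemma trig_poly_cnj:
  assumes C: "\<And>\<gamma>. \<gamma> \<in> A \<Longrightarrow> (\<lambda>x. cnj (\<gamma> x)) \<in> C" and f: "trig_poly A f"
  shows "trig_poly C (\<lambda>x. cnj (f x))"
  using f
proof (induction rule: trig_poly.induct)
  case (single \<gamma> c)
  then show ?case using trig_poly.single[OF C, of \<gamma> "cnj c"] by simp
qed (auto intro: trig_poly.intros)

lemma trig_poly_characters_mult: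
  "trig_poly characters f \<Longrightarrow> trig_poly characters g \<Longrightarrow> trig_poly characters (\<lambda>x. f x * g x)"
  by (rule trig_poly_mult) (auto intro: character_mult)

lemma trig_poly_characters_cnj:
  "trig_poly characters f \<Longrightarrow> trig_poly characters (\<lambda>x. cnj (f x))"
  by (rule trig_poly_cnj) (auto intro: character_cnj)

lemma trig_poly_const: "(\<lambda>_. 1) \<in> A \<Longrightarrow> trig_poly A (\<lambda>x. c)"
  using trig_poly.single[of "\<lambda>_. 1" A c] by simp

lemma trig_poly_character: "\<gamma> \<in> A \<Longrightarrow> trig_poly A \<gamma>"
  using trig_poly.single[of \<gamma> A 1] by simp

lemma trig_poly_Re:
  assumes "trig_poly characters f"
  shows "trig_poly characters (\<lambda>x. complex_of_real (Re (f x)))"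
proof -
  have "trig_poly characters (\<lambda>x. 1 / 2 * (f x + cnj (f x)))"
    by (intro trig_poly_cmult trig_poly.add trig_poly_characters_cnj assms)
  then show ?thesis by (simp add: complex_add_cnj)
qed

lemma trig_poly_Im:
  assumes "trig_poly characters f"
  shows "trig_poly characters (\<lambda>x. complex_of_real (Im (f x)))"
  using trig_poly_Re[OF trig_poly_cmult[OF assms, of "- \<i>"]] by simp

lemma trig_poly_continuous:
  assumes "trig_poly A f" "A \<subseteq> characters"
  shows "continuous_on UNIV f"
  using assms(1)
proof (induction rule: trig_poly.induct)
  case (single \<gamma> c)
  then show ?case using assms(2) characterD(1)[of \<gamma>] by (auto intro!: continuous_intros)
qed (auto intro!: continuous_intros)

lemma trig_poly_representation:
  assumes "trig_poly A f"
  shows "\<exists>F c. finite F \<and> F \<subseteq> A \<and> f = (\<lambda>x. \<Sum>\<gamma>\<in>F. c \<gamma> * \<gamma> x)"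
  using assms
proof (induction rule: trig_poly.induct)
  case (single \<gamma> c)
  then show ?case by (intro exI[of _ "{\<gamma>}"] exI[of _ "\<lambda>_. c"]) auto
next
  case zero
  show ?case by (intro exI[of _ "{}"]) auto
next
  case (add f g)
  obtain F c where F: "finite F" "F \<subseteq> A" "f = (\<lambda>x. \<Sum>\<gamma>\<in>F. c \<gamma> * \<gamma> x)"
    using add.IH(1) by blast
  obtain G d where G: "finite G" "G \<subseteq> A" "g = (\<lambda>x. \<Sum>\<gamma>\<in>G. d \<gamma> * \<gamma> x)"
    using add.IH(2) by blast
  define c' where "c' \<gamma> = (if \<gamma> \<in> F then c \<gamma> else 0)" for \<gamma>
  define d' where "d' \<gamma> = (if \<gamma> \<in> G then d \<gamma> else 0)" for \<gamma>
  have "f x = (\<Sum>\<gamma>\<in>F \<union> G. c' \<gamma> * \<gamma> x)" for x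
    unfolding F(3) using F G by (intro sum.mono_neutral_cong_left) (auto simp: c'_def)
  moreover have "g x = (\<Sum>\<gamma>\<in>F \<union> G. d' \<gamma> * \<gamma> x)" for x
    unfolding G(3) using F G by (intro sum.mono_neutral_cong_left) (auto simp: d'_def)
  ultimately have "(\<lambda>x. f x + g x) = (\<lambda>x. \<Sum>\<gamma>\<in>F \<union> G. (c' \<gamma> + d' \<gamma>) * \<gamma> x)"
    by (simp add: sum.distrib distrib_right)
  then show ?case
    using F G by (intro exI[of _ "F \<union> G"] exI[of _ "\<lambda>\<gamma>. c' \<gamma> + d' \<gamma>"]) auto
qed

lemma Urysohn_compact:
  fixes S T :: "'a::t2_space set"
  assumes "compact (UNIV :: 'a set)" "closed S" "closed T" "S \<inter> T = {}"
  obtains g :: "'a \<Rightarrow> real" where "continuous_on UNIV g" "\<And>x. 0 \<le> g x \<and> g x \<le> 1"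
    "\<And>x. x \<in> S \<Longrightarrow> g x = 0" "\<And>x. x \<in> T \<Longrightarrow> g x = 1"
proof -
  have "Hausdorff_space (euclidean :: 'a topology)"
    unfolding Hausdorff_space_def disjnt_def by (simp add: open_openin[symmetric]) (metis hausdorff)
  then have "normal_space (euclidean :: 'a topology)"
    using assms(1) by (intro compact_Hausdorff_or_regular_imp_normal_space)
      (auto simp: compact_space_def)
  then obtain g :: "'a \<Rightarrow> real" where g: "continuous_map euclidean (top_of_set {0..1}) g"
      "g ` S \<subseteq> {0}" "g ` T \<subseteq> {1}"
    using Urysohn_lemma[of euclidean S T 0 1] assms by (auto simp: disjnt_def)
  then have "continuous_on UNIV g" "g \<in> UNIV \<rightarrow> {0..1}"
    by (auto simp: continuous_map_in_subtopology)
  moreover from this have "0 \<le> g x \<and> g x \<le> 1" for x by (simp add: Pi_iff)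
  ultimately show thesis using g(2,3) by (intro that[of g]) auto
qed

context haar_on_dirichlet_group
begin

lemma integrable_times_cnj_character:
  assumes "integrable m f" "character \<gamma>"
  shows "integrable m (\<lambda>x. f x * cnj (\<gamma> x))"
proof (rule Bochner_Integration.integrable_bound[OF assms(1)])
  have [measurable]: "\<gamma> \<in> borel_measurable m" "f \<in> borel_measurable m"
    using continuous_measurable[OF characterD(1)[OF assms(2)]] assms(1) by auto
  show "(\<lambda>x. f x * cnj (\<gamma> x)) \<in> borel_measurable m"
    by (intro borel_measurable_times borel_measurable_continuous_on[where f = cnj] continuous_intros) auto
qed (use characterD(3)[OF assms(2)] in \<open>auto simp: norm_mult\<close>)

lemma fourier_coeff_add:
  assumes "integrable m f" "integrable m g" "character \<gamma>"
  shows "coeff (\<lambda>x. f x + g x) \<gamma> = coeff f \<gamma> + coeff g \<gamma>"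
  unfolding fourier_coeff_def distrib_right
  by (intro Bochner_Integration.integral_add integrable_times_cnj_character assms)

lemma fourier_coeff_diff:
  assumes "integrable m f" "integrable m g" "character \<gamma>"
  shows "coeff (\<lambda>x. f x - g x) \<gamma> = coeff f \<gamma> - coeff g \<gamma>"
  unfolding fourier_coeff_def left_diff_distrib
  by (intro Bochner_Integration.integral_diff integrable_times_cnj_character assms)

lemma fourier_coeff_cmult: "coeff (\<lambda>x. c * f x) \<gamma> = c * coeff f \<gamma>"
  by (simp add: fourier_coeff_def mult.assoc)

lemma norm_fourier_coeff_le:
  assumes "integrable m f" "character \<gamma>"
  shows "norm (coeff f \<gamma>) \<le> (LINT x|m. norm (f x))"
proof -
  have "norm (coeff f \<gamma>) \<le> (LINT x|m. norm (f x * cnj (\<gamma> x)))"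
    unfolding fourier_coeff_def by (rule integral_norm_bound)
  then show ?thesis using characterD(3)[OF assms(2)] by (simp add: norm_mult)
qed

text \<open>Translation multiplies the integral of a character by one of its values.\<close>

lemma character_integral:
  assumes \<gamma>: "character \<gamma>"
  shows "(LINT x|m. \<gamma> x) = (if \<gamma> = (\<lambda>_. 1) then 1 else 0)"
proof (cases "\<gamma> = (\<lambda>_. 1)")
  case False
  then obtain a where a: "\<gamma> a \<noteq> 1" by auto
  have "(LINT x|m. \<gamma> x) = (LINT x|m. \<gamma> (x + a))"
    by (rule continuous_integral_shift[symmetric]) (rule characterD(1)[OF \<gamma>])
  also have "\<dots> = (LINT x|m. \<gamma> x) * \<gamma> a"
    by (simp add: characterD(2)[OF \<gamma>])
  finally show ?thesis using a False by simp
qed simp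

lemma fourier_coeff_character:
  assumes \<gamma>: "character \<gamma>" and \<delta>: "character \<delta>"
  shows "coeff \<gamma> \<delta> = (if \<gamma> = \<delta> then 1 else 0)"
proof -
  have "(\<lambda>x. \<gamma> x * cnj (\<delta> x)) = (\<lambda>_. 1) \<longleftrightarrow> \<gamma> = \<delta>"
  proof
    assume eq: "(\<lambda>x. \<gamma> x * cnj (\<delta> x)) = (\<lambda>_. 1)"
    have "\<gamma> x = \<delta> x" for x
    proof -
      have "\<gamma> x * cnj (\<delta> x) = \<delta> x * cnj (\<delta> x)"
        using fun_cong[OF eq, of x] characterD(4)[OF \<delta>, of x] by simp
      then show ?thesis using characterD(7)[OF \<delta>, of x] by simp
    qed
    then show "\<gamma> = \<delta>" by auto
  qed (use characterD(4)[OF \<delta>] in auto)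
  then show ?thesis
    unfolding fourier_coeff_def
    using character_integral[OF character_mult[OF \<gamma> character_cnj[OF \<delta>]]] by simp
qed

lemma fourier_coeff_sum_characters:
  assumes F: "finite F" "F \<subseteq> characters" and \<delta>: "character \<delta>"
  shows "coeff (\<lambda>x. \<Sum>\<gamma>\<in>F. c \<gamma> * \<gamma> x) \<delta> = (if \<delta> \<in> F then c \<delta> else 0)"
proof -
  have "coeff (\<lambda>x. \<Sum>\<gamma>\<in>F. c \<gamma> * \<gamma> x) \<delta> = (LINT x|m. (\<Sum>\<gamma>\<in>F. c \<gamma> * (\<gamma> x * cnj (\<delta> x))))"
    by (simp add: fourier_coeff_def sum_distrib_right mult.assoc)
  also have "\<dots> = (\<Sum>\<gamma>\<in>F. LINT x|m. c \<gamma> * (\<gamma> x * cnj (\<delta> x)))"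
    using F \<delta> by (intro Bochner_Integration.integral_sum integrable_mult_right
        integrable_times_cnj_character continuous_integrable characterD(1)) auto
  also have "\<dots> = (\<Sum>\<gamma>\<in>F. if \<gamma> = \<delta> then c \<gamma> else 0)"
    using F(2) fourier_coeff_character[OF _ \<delta>]
    by (intro sum.cong refl) (auto simp: fourier_coeff_def)
  also have "\<dots> = (if \<delta> \<in> F then c \<delta> else 0)"
    using F(1) by (simp add: sum.delta)
  finally show ?thesis .
qed

definition spectrum :: "('g \<Rightarrow> complex) \<Rightarrow> ('g \<Rightarrow> complex) set" where
  "spectrum f = {\<gamma>. character \<gamma> \<and> coeff f \<gamma> \<noteq> 0}"

lemma trig_poly_spectrum:
  assumes f: "trig_poly A f" and A: "A \<subseteq> characters"
  shows finite_spectrum: "finite (spectrum f)" and spectrum_subset: "spectrum f \<subseteq> A"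
    and trig_poly_eq: "\<And>S x. finite S \<Longrightarrow> spectrum f \<subseteq> S \<Longrightarrow> S \<subseteq> characters \<Longrightarrow>
      f x = (\<Sum>\<gamma>\<in>S. coeff f \<gamma> * \<gamma> x)"
proof -
  obtain F c where F: "finite F" "F \<subseteq> A" and f_eq: "f = (\<lambda>x. \<Sum>\<gamma>\<in>F. c \<gamma> * \<gamma> x)"
    using trig_poly_representation[OF f] by blast
  have coeff: "coeff f \<delta> = (if \<delta> \<in> F then c \<delta> else 0)" if "character \<delta>" for \<delta>
    unfolding f_eq using F A that by (intro fourier_coeff_sum_characters) auto
  show "spectrum f \<subseteq> A" using F(2) by (auto simp: spectrum_def coeff split: if_splits)
  have sF: "spectrum f \<subseteq> F" by (auto simp: spectrum_def coeff split: if_splits)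
  then show "finite (spectrum f)" using F(1) by (rule finite_subset)
  fix S x assume S: "finite S" "spectrum f \<subseteq> S" "S \<subseteq> characters"
  have "(\<Sum>\<gamma>\<in>F. coeff f \<gamma> * \<gamma> x) = (\<Sum>\<gamma>\<in>spectrum f. coeff f \<gamma> * \<gamma> x)"
    using F A sF by (intro sum.mono_neutral_right) (auto simp: spectrum_def)
  moreover have "(\<Sum>\<gamma>\<in>S. coeff f \<gamma> * \<gamma> x) = (\<Sum>\<gamma>\<in>spectrum f. coeff f \<gamma> * \<gamma> x)"
    using S by (intro sum.mono_neutral_right) (auto simp: spectrum_def)
  moreover have "f x = (\<Sum>\<gamma>\<in>F. coeff f \<gamma> * \<gamma> x)"
    unfolding f_eq[THEN fun_cong] using F A coeff by (intro sum.cong) (auto simp flip: f_eq)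
  ultimately show "f x = (\<Sum>\<gamma>\<in>S. coeff f \<gamma> * \<gamma> x)" by simp
qed

text \<open>
  If no character separated \<open>x\<close> from \<open>y\<close>, then all Fourier coefficients of \<open>f(\<cdot> + (x - y)) - f\<close>
  would vanish for every continuous \<open>f\<close>, which would therefore have period \<open>x - y\<close>.
\<close>

lemma characters_separate_points:
  fixes x y :: 'g
  assumes "x \<noteq> y"
  shows "\<exists>\<gamma>. character \<gamma> \<and> \<gamma> x \<noteq> \<gamma> y"
proof (rule ccontr)
  assume none: "\<not> ?thesis"
  define d where "d = x - y"
  have d: "d \<noteq> 0" using assms by (simp add: d_def)
  have one: "\<gamma> d = 1" if \<gamma>: "character \<gamma>" for \<gamma>
  proof -
    have "\<gamma> d = \<gamma> x * cnj (\<gamma> y)"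
      using characterD(2)[OF \<gamma>, of x "- y"] characterD(6)[OF \<gamma>, of y] by (simp add: d_def)
    then show ?thesis using none \<gamma> characterD(4)[OF \<gamma>, of y] by auto
  qed
  obtain g :: "'g \<Rightarrow> real" where g: "continuous_on UNIV g" "g 0 = 0" "g d = 1"
    using Urysohn_compact[OF compact_UNIV, of "{0}" "{d}"] d by auto
  define F where "F z = complex_of_real (g (z + d)) - complex_of_real (g z)" for z
  have cont: "continuous_on UNIV (\<lambda>z. complex_of_real (g z))"
    "continuous_on UNIV (\<lambda>z. complex_of_real (g (z + d)))"
    by (intro continuous_intros g(1) continuous_on_compose2[OF g(1)]; auto)+
  have "continuous_on UNIV F"
    unfolding F_def by (intro continuous_intros cont)
  moreover have "F 0 \<noteq> 0" using g by (simp add: F_def)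
  ultimately obtain \<gamma> where \<gamma>: "character \<gamma>" "coeff F \<gamma> \<noteq> 0"
    using continuous_function_has_nonzero_coefficient by blast
  have "coeff F \<gamma> = coeff (\<lambda>z. complex_of_real (g (z + d))) \<gamma> -
      coeff (\<lambda>z. complex_of_real (g z)) \<gamma>"
    unfolding F_def by (intro fourier_coeff_diff continuous_integrable cont \<gamma>)
  also have "\<dots> = 0"
    using fourier_coeff_translate[OF cont(1) \<gamma>(1), of d] one[OF \<gamma>(1)] by simp
  finally show False using \<gamma>(2) by simp
qed

theorem trig_polys_dense_real:
  fixes f :: "'g \<Rightarrow> real"
  assumes f: "continuous_on UNIV f" and e: "e > 0"
  obtains h where "trig_poly characters (\<lambda>x. complex_of_real (h x))" "\<And>x. \<bar>f x - h x\<bar> < e"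
proof -
  define R where "R = {h :: 'g \<Rightarrow> real. trig_poly characters (\<lambda>x. complex_of_real (h x))}"
  interpret function_ring_on R UNIV
  proof
    show "compact (UNIV :: 'g set)" by (rule compact_UNIV)
    show "continuous_on UNIV h" if "h \<in> R" for h
    proof -
      have "continuous_on UNIV (\<lambda>x. complex_of_real (h x))"
        using that by (intro trig_poly_continuous[of characters]) (auto simp: R_def)
      from continuous_on_Re[OF this] show ?thesis by simp
    qed
    show "(\<lambda>x. h x + k x) \<in> R" if "h \<in> R" "k \<in> R" for h k
      using that trig_poly.add by (auto simp: R_def)
    show "(\<lambda>x. h x * k x) \<in> R" if "h \<in> R" "k \<in> R" for h k
      using that trig_poly_characters_mult by (auto simp: R_def)
    show "(\<lambda>_. c) \<in> R" for c
      by (auto simp: R_def intro!: trig_poly_const character_one)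
    show "\<exists>h\<in>R. h x \<noteq> h y" if xy: "x \<noteq> y" for x y
    proof -
      obtain \<gamma> where \<gamma>: "character \<gamma>" "\<gamma> x \<noteq> \<gamma> y"
        using characters_separate_points[OF xy] by blast
      then have R: "(\<lambda>x. Re (\<gamma> x)) \<in> R" "(\<lambda>x. Im (\<gamma> x)) \<in> R"
        unfolding R_def by (simp_all add: trig_poly_Re trig_poly_Im trig_poly_character)
      show ?thesis
      proof (cases "Re (\<gamma> x) = Re (\<gamma> y)")
        case True
        then have "Im (\<gamma> x) \<noteq> Im (\<gamma> y)" using \<gamma>(2) by (auto simp: complex_eq_iff)
        then show ?thesis by (rule bexI[OF _ R(2)])
      next
        case False
        then show ?thesis by (rule bexI[OF _ R(1)])
      qed
    qed
  qed
  show thesis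
    using Stone_Weierstrass_basic[OF f e] that by (auto simp: R_def)
qed

corollary trig_polys_dense:
  fixes f :: "'g \<Rightarrow> complex"
  assumes f: "continuous_on UNIV f" and e: "e > 0"
  obtains h where "trig_poly characters h" "\<And>x. norm (f x - h x) < e"
proof -
  obtain a where a: "trig_poly characters (\<lambda>x. complex_of_real (a x))" "\<And>x. \<bar>Re (f x) - a x\<bar> < e / 2"
    using trig_polys_dense_real[of "\<lambda>x. Re (f x)" "e / 2"] f e by (auto intro: continuous_intros)
  obtain b where b: "trig_poly characters (\<lambda>x. complex_of_real (b x))" "\<And>x. \<bar>Im (f x) - b x\<bar> < e / 2"
    using trig_polys_dense_real[of "\<lambda>x. Im (f x)" "e / 2"] f e by (auto intro: continuous_intros)
  show thesis
  proof
    show "trig_poly characters (\<lambda>x. complex_of_real (a x) + \<i> * complex_of_real (b x))"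
      by (intro trig_poly.add trig_poly_cmult a b)
    show "norm (f x - (complex_of_real (a x) + \<i> * complex_of_real (b x))) < e" for x
    proof -
      have "norm (f x - (complex_of_real (a x) + \<i> * complex_of_real (b x))) \<le> \<bar>Re (f x) - a x\<bar> + \<bar>Im (f x) - b x\<bar>"
        using cmod_le[of "f x - (complex_of_real (a x) + \<i> * complex_of_real (b x))"] by simp
      then show ?thesis using a(2)[of x] b(2)[of x] by linarith
    qed
  qed
qed

end

section \<open>Frequencies of characters\<close>

text \<open>
  Integrating the functional equation shows that a continuous character of the line is
  differentiable, and differentiating it shows that the derivative is a multiple of the character.
\<close>

lemma real_line_character:
  fixes \<phi> :: "real \<Rightarrow> complex"
  assumes cont: "continuous_on UNIV \<phi>" and mult: "\<And>s t. \<phi> (s + t) = \<phi> s * \<phi> t"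
    and norm1: "\<And>t. norm (\<phi> t) = 1"
  obtains x where "\<And>t. \<phi> t = exp (- (\<i> * complex_of_real (x * t)))"
proof -
  have zero: "\<phi> 0 = 1" using mult[of 0 0] norm1[of 0] by auto
  have "\<exists>\<Psi>. \<forall>t. -\<infinity> < ereal t \<longrightarrow> ereal t < \<infinity> \<longrightarrow> (\<Psi> has_vector_derivative \<phi> t) (at t)"
    using cont by (intro einterval_antiderivative) (auto simp: continuous_on_eq_continuous_at)
  then obtain \<Psi> where \<Psi>: "\<And>t. (\<Psi> has_vector_derivative \<phi> t) (at t)" by auto
  have \<Psi>_shift: "((\<lambda>t. \<Psi> (t + a)) has_vector_derivative \<phi> (t + a)) (at t)" for a t
    using vector_diff_chain_at[of "\<lambda>t. t + a" 1 t \<Psi> "\<phi> (t + a)"] \<Psi>[of "t + a"]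
    by (simp add: o_def has_vector_derivative_add_const)
  have key: "\<phi> t * (\<Psi> a - \<Psi> 0) = \<Psi> (t + a) - \<Psi> t" for t a
  proof -
    have "\<exists>c. \<forall>b\<in>UNIV. \<Psi> (b + t) - \<phi> t * \<Psi> b = c"
    proof (rule has_vector_derivative_zero_constant)
      fix b :: real
      have "((\<lambda>b. \<Psi> (b + t) - \<phi> t * \<Psi> b) has_vector_derivative (\<phi> (b + t) - \<phi> t * \<phi> b)) (at b)"
        by (intro has_vector_derivative_diff has_vector_derivative_mult_right \<Psi> \<Psi>_shift)
      then show "((\<lambda>b. \<Psi> (b + t) - \<phi> t * \<Psi> b) has_vector_derivative 0) (at b within UNIV)"
        by (simp add: mult mult.commute)
    qed auto
    then obtain c where c: "\<And>b. \<Psi> (b + t) - \<phi> t * \<Psi> b = c" by blast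
    show ?thesis using c[of a] c[of 0] by (simp add: algebra_simps)
  qed
  have "\<exists>a. \<Psi> a \<noteq> \<Psi> 0"
  proof (rule ccontr)
    assume "\<not> ?thesis"
    then have "\<Psi> = (\<lambda>_. \<Psi> 0)" by auto
    then have "(\<Psi> has_vector_derivative 0) (at 0)" by (metis has_vector_derivative_const)
    from vector_derivative_unique_at[OF \<Psi>[of 0] this] show False using zero by simp
  qed
  then obtain a where a: "\<Psi> a - \<Psi> 0 \<noteq> 0" by auto
  define \<kappa> where "\<kappa> = (\<phi> a - 1) / (\<Psi> a - \<Psi> 0)"
  have \<phi>_eq: "\<phi> = (\<lambda>t. (\<Psi> (t + a) - \<Psi> t) * (1 / (\<Psi> a - \<Psi> 0)))"
    using key[of _ a] a by (auto simp: field_simps)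
  have deriv: "(\<phi> has_vector_derivative \<kappa> * \<phi> t) (at t)" for t
  proof -
    have "((\<lambda>t. (\<Psi> (t + a) - \<Psi> t) * (1 / (\<Psi> a - \<Psi> 0))) has_vector_derivative
        (\<phi> (t + a) - \<phi> t) * (1 / (\<Psi> a - \<Psi> 0))) (at t)"
      by (intro has_vector_derivative_mult_left has_vector_derivative_diff \<Psi> \<Psi>_shift)
    moreover have "(\<phi> (t + a) - \<phi> t) * (1 / (\<Psi> a - \<Psi> 0)) = \<kappa> * \<phi> t"
      by (simp add: \<kappa>_def mult field_simps)
    ultimately show ?thesis by (simp only: \<phi>_eq[symmetric])
  qed
  have exp_deriv: "((\<lambda>t. exp (- \<kappa> * complex_of_real t)) has_vector_derivative
      exp (- \<kappa> * complex_of_real t) * (- \<kappa>)) (at t)" for t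
  proof -
    have "((\<lambda>z. exp (- \<kappa> * z)) has_field_derivative exp (- \<kappa> * complex_of_real t) * (- \<kappa>))
        (at (complex_of_real t))"
      by (auto intro!: derivative_eq_intros)
    then show ?thesis by (rule has_vector_derivative_real_field)
  qed
  have "\<exists>c. \<forall>t\<in>UNIV. \<phi> t * exp (- \<kappa> * complex_of_real t) = c"
  proof (rule has_vector_derivative_zero_constant)
    fix t :: real
    have "((\<lambda>t. \<phi> t * exp (- \<kappa> * complex_of_real t)) has_vector_derivative
        (\<phi> t * (exp (- \<kappa> * complex_of_real t) * (- \<kappa>)) + \<kappa> * \<phi> t * exp (- \<kappa> * complex_of_real t))) (at t)"
      by (intro has_vector_derivative_mult deriv exp_deriv)
    then show "((\<lambda>t. \<phi> t * exp (- \<kappa> * complex_of_real t)) has_vector_derivative 0) (at t within UNIV)"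
      by (simp add: algebra_simps)
  qed auto
  then obtain c where c: "\<And>t. \<phi> t * exp (- \<kappa> * complex_of_real t) = c" by blast
  have "c = 1" using c[of 0] zero by simp
  have \<phi>_exp: "\<phi> t = exp (\<kappa> * complex_of_real t)" for t
    using c[of t] \<open>c = 1\<close> by (simp add: exp_minus field_simps)
  have "Re \<kappa> = 0" using norm1[of 1] \<phi>_exp[of 1] by simp
  then have eq: "\<kappa> * complex_of_real t = - (\<i> * complex_of_real (- Im \<kappa> * t))" for t
    by (simp add: complex_eq_iff)
  show thesis
    by (rule that[of "- Im \<kappa>"]) (simp only: \<phi>_exp eq)
qed

text \<open>
  On the right half plane, \<open>z = r e\<^sup>i\<^sup>\<theta>\<close> with \<open>\<bar>\<theta>\<bar> < \<pi>/2\<close>. For \<open>\<bar>\<theta>\<bar>\<close> close to \<open>\<pi>/2\<close> the number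
  \<open>cos (p \<theta>)\<close> is bounded away from zero and negative, because \<open>\<pi>/2 < p \<pi>/2 \<le> \<pi>\<close>; for all other
  \<open>\<theta>\<close> the number \<open>cos \<theta>\<close> is bounded away from zero.
\<close>

lemma right_half_plane_powr_bound:
  fixes p :: real
  assumes p: "1 < p" "p \<le> 2"
  obtains A B where "A > 0" "B > 0"
    "\<And>z. Re z > 0 \<Longrightarrow> norm z powr p \<le> A * Re z powr p - B * Re (z powr of_real p)"
proof -
  define \<theta>0 where "\<theta>0 = (pi / 2 + pi / (2 * p)) / 2"
  have "pi / (2 * p) < pi / 2" using p by (simp add: field_simps)
  then have \<theta>0: "pi / (2 * p) < \<theta>0" "\<theta>0 < pi / 2" by (auto simp: \<theta>0_def)
  have \<theta>0_pos: "0 < \<theta>0" using \<theta>0(1) p by (smt (verit) divide_pos_pos pi_gt_zero mult_pos_pos)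
  have p\<theta>0: "pi / 2 < p * \<theta>0" using \<theta>0(1) p by (simp add: field_simps)
  have p\<theta>_le: "p * \<theta> \<le> pi" if "\<theta> \<le> pi / 2" "0 \<le> \<theta>" for \<theta>
    using mult_mono[of p 2 \<theta> "pi / 2"] that p by simp
  define b where "b = - cos (p * \<theta>0)"
  have b: "b > 0"
  proof -
    have "cos (p * \<theta>0) < cos (pi / 2)"
      using p\<theta>0 p\<theta>_le[of \<theta>0] \<theta>0 \<theta>0_pos by (intro cos_monotone_0_pi) auto
    then show ?thesis by (simp add: b_def)
  qed
  define a where "a = cos \<theta>0 powr p"
  have a: "a > 0" using cos_gt_zero[OF \<theta>0_pos \<theta>0(2)] by (simp add: a_def)
  define B where "B = 1 / b"
  define A where "A = (1 + B) / a"
  have B: "B > 0" using b by (simp add: B_def)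
  have A: "A > 0" using a B by (simp add: A_def)
  have angle: "1 \<le> A * cos \<theta> powr p - B * cos (p * \<theta>)" if "0 \<le> \<theta>" "\<theta> < pi / 2" for \<theta>
  proof (cases "\<theta> \<le> \<theta>0")
    case True
    have "cos \<theta>0 \<le> cos \<theta>" using True that \<theta>0 by (intro cos_monotone_0_pi_le) auto
    then have "a \<le> cos \<theta> powr p"
      unfolding a_def using cos_gt_zero[OF \<theta>0_pos \<theta>0(2)] p by (intro powr_mono2) auto
    then have "(1 + B) * a \<le> (1 + B) * cos \<theta> powr p"
      using B by (intro mult_left_mono) auto
    then have "1 + B \<le> A * cos \<theta> powr p"
      using a by (simp add: A_def pos_le_divide_eq)
    moreover have "B * cos (p * \<theta>) \<le> B * 1" using B by (intro mult_left_mono) auto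
    ultimately show ?thesis by linarith
  next
    case False
    have "cos (p * \<theta>) \<le> cos (p * \<theta>0)"
      using False that p \<theta>0_pos p\<theta>_le[of \<theta>] by (intro cos_monotone_0_pi_le) (auto intro: mult_left_mono)
    then have "B * cos (p * \<theta>) \<le> B * (- b)"
      using B by (intro mult_left_mono) (auto simp: b_def)
    also have "\<dots> = - 1" using b by (simp add: B_def)
    finally have "B * cos (p * \<theta>) \<le> - 1" .
    moreover have "A * cos \<theta> powr p \<ge> 0" using A by simp
    ultimately show ?thesis by linarith
  qed
  show thesis
  proof (rule that[OF A B])
    fix z :: complex assume z: "Re z > 0"
    then have z0: "z \<noteq> 0" by auto
    define \<theta> where "\<theta> = \<bar>Arg z\<bar>"
    have \<theta>: "0 \<le> \<theta>" "\<theta> < pi / 2" using z Arg_Re_pos[of z] by (auto simp: \<theta>_def)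
    have Re_z: "Re z = norm z * cos \<theta>"
    proof -
      have "Re z = Re (rcis (norm z) (Arg z))" by (simp add: rcis_cmod_Arg)
      then show ?thesis by (simp add: \<theta>_def)
    qed
    have Re_zp: "Re (z powr of_real p) = norm z powr p * cos (p * \<theta>)"
    proof -
      have "Re (z powr of_real p) = exp (p * ln (norm z)) * cos (p * Arg z)"
        using z0 by (simp add: powr_def Ln_Arg Re_exp)
      moreover have "cos (p * Arg z) = cos (p * \<theta>)"
        by (cases "Arg z \<ge> 0") (auto simp: \<theta>_def)
      ultimately show ?thesis using z0 by (simp add: powr_def)
    qed
    have "norm z powr p * 1 \<le> norm z powr p * (A * cos \<theta> powr p - B * cos (p * \<theta>))"
      by (intro mult_left_mono angle \<theta>) auto
    also have "\<dots> = A * Re z powr p - B * Re (z powr of_real p)"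
      using cos_gt_zero_pi[of \<theta>] \<theta> by (simp add: Re_z Re_zp powr_mult algebra_simps)
    finally show "norm z powr p \<le> A * Re z powr p - B * Re (z powr of_real p)" by simp
  qed
qed

section \<open>Means of powers\<close>

lemma powr_norm_add_le:
  fixes a b :: "'a::real_normed_vector"
  assumes "p \<ge> 0"
  shows "norm (a + b) powr p \<le> 2 powr p * (norm a powr p + norm b powr p)"
proof -
  define M where "M = max (norm a) (norm b)"
  have "norm (a + b) \<le> 2 * M"
    using norm_triangle_ineq[of a b] by (auto simp: M_def)
  then have "norm (a + b) powr p \<le> (2 * M) powr p"
    using assms by (intro powr_mono2) auto
  also have "\<dots> = 2 powr p * M powr p"
    by (simp add: powr_mult)
  also have "\<dots> \<le> 2 powr p * (norm a powr p + norm b powr p)"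
    by (intro mult_left_mono) (auto simp: M_def max_def)
  finally show ?thesis .
qed

lemma le_powr_scaled:
  fixes t d p :: real
  assumes "t \<ge> 0" "d > 0" "p \<ge> 1"
  shows "t \<le> d + d powr (1 - p) * t powr p"
proof (cases "t \<le> d")
  case False
  have "t = d powr (1 - p) * (d powr (p - 1) * t)"
    using assms by (simp add: powr_add[symmetric] flip: mult.assoc)
  also have "\<dots> \<le> d powr (1 - p) * (t powr (p - 1) * t)"
    using assms False by (intro mult_left_mono mult_right_mono powr_mono2) auto
  also have "t powr (p - 1) * t = t powr p"
    using assms False powr_add[of t "p - 1" 1] by simp
  finally show ?thesis using assms by linarith
qed (simp add: add_increasing2)

lemma powr_le_scaled_square:
  fixes t d p :: real
  assumes "t \<ge> 0" "d > 0" "0 \<le> p" "p \<le> 2"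
  shows "t powr p \<le> d powr p * (1 + t\<^sup>2 / d\<^sup>2)"
proof -
  have "(t / d) powr p \<le> 1 + (t / d)\<^sup>2"
  proof (cases "t / d \<le> 1")
    case True
    then have "(t / d) powr p \<le> 1 powr p" using assms by (intro powr_mono2) auto
    then show ?thesis by (simp add: add_increasing2)
  next
    case False
    then have "(t / d) powr p \<le> (t / d) powr 2" using assms by (intro powr_mono) auto
    then show ?thesis using False by simp
  qed
  then have "d powr p * (t / d) powr p \<le> d powr p * (1 + (t / d)\<^sup>2)"
    by (intro mult_left_mono) auto
  moreover have "d powr p * (t / d) powr p = t powr p"
    using assms by (simp add: powr_divide)
  ultimately show ?thesis by (simp add: power_divide)
qed

context haar_on_dirichlet_group
begin

definition freq :: "('g \<Rightarrow> complex) \<Rightarrow> real" where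
  "freq \<gamma> = (SOME x. extends_frequency \<beta> x \<gamma>)"

lemma exp_frequency_inj:
  assumes "\<And>t. exp (- (\<i> * complex_of_real (x * t))) = exp (- (\<i> * complex_of_real (y * t)))"
  shows "x = y"
proof (rule ccontr)
  assume "x \<noteq> y"
  define t where "t = pi / (y - x)"
  have "cis (pi) = exp (\<i> * complex_of_real ((y - x) * t))"
    using \<open>x \<noteq> y\<close> by (simp add: t_def cis_conv_exp)
  also have "\<dots> = exp (- (\<i> * complex_of_real (x * t))) / exp (- (\<i> * complex_of_real (y * t)))"
    by (simp add: exp_diff[symmetric] algebra_simps)
  also have "\<dots> = 1" using assms[of t] by simp
  finally show False by simp
qed

lemma extends_freq:
  assumes \<gamma>: "character \<gamma>"
  shows "extends_frequency \<beta> (freq \<gamma>) \<gamma>"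
proof -
  have "continuous_on UNIV (\<lambda>t. \<gamma> (\<beta> t))"
    by (rule continuous_on_compose2[OF characterD(1)[OF \<gamma>] continuous_on_flow]) auto
  then obtain x where "\<And>t. \<gamma> (\<beta> t) = exp (- (\<i> * complex_of_real (x * t)))"
    by (rule real_line_character[of "\<lambda>t. \<gamma> (\<beta> t)"])
       (auto simp: flow_add characterD(2)[OF \<gamma>] characterD(3)[OF \<gamma>])
  then have "extends_frequency \<beta> x \<gamma>" using \<gamma> by (auto simp: extends_frequency_def)
  then show ?thesis unfolding freq_def by (rule someI)
qed

lemma freq_unique:
  assumes "extends_frequency \<beta> x \<gamma>"
  shows "freq \<gamma> = x"
proof (rule exp_frequency_inj)
  have "extends_frequency \<beta> (freq \<gamma>) \<gamma>"
    using assms extends_freq by (auto simp: extends_frequency_def)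
  then show "exp (- (\<i> * complex_of_real (freq \<gamma> * t))) = exp (- (\<i> * complex_of_real (x * t)))" for t
    using assms unfolding extends_frequency_def by metis
qed

lemma extends_frequency_unique:
  assumes \<gamma>: "extends_frequency \<beta> x \<gamma>" and \<delta>: "extends_frequency \<beta> x \<delta>"
  shows "\<gamma> = \<delta>"
proof -
  have "continuous_on UNIV \<gamma>" "continuous_on UNIV \<delta>"
    using \<gamma> \<delta> characterD(1) by (auto simp: extends_frequency_def)
  then have "closed {z. \<gamma> z = \<delta> z}" by (intro closed_Collect_eq)
  moreover have "range \<beta> \<subseteq> {z. \<gamma> z = \<delta> z}"
    using \<gamma> \<delta> by (auto simp: extends_frequency_def)
  ultimately have "closure (range \<beta>) \<subseteq> {z. \<gamma> z = \<delta> z}" by (rule closure_minimal[rotated])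
  then show ?thesis using flow_dense by auto
qed

lemma freq_inj: "character \<gamma> \<Longrightarrow> character \<delta> \<Longrightarrow> freq \<gamma> = freq \<delta> \<Longrightarrow> \<gamma> = \<delta>"
  using extends_frequency_unique[of "freq \<gamma>" \<gamma> \<delta>] extends_freq[of \<gamma>] extends_freq[of \<delta>] by simp

lemma freq_mult:
  assumes "character \<gamma>" "character \<delta>"
  shows "freq (\<lambda>x. \<gamma> x * \<delta> x) = freq \<gamma> + freq \<delta>"
proof (rule freq_unique)
  show "extends_frequency \<beta> (freq \<gamma> + freq \<delta>) (\<lambda>x. \<gamma> x * \<delta> x)"
    using extends_freq[OF assms(1)] extends_freq[OF assms(2)]
    by (auto simp: extends_frequency_def character_mult exp_add[symmetric] algebra_simps)
qed

lemma freq_cnj: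
  assumes "character \<gamma>"
  shows "freq (\<lambda>x. cnj (\<gamma> x)) = - freq \<gamma>"
proof (rule freq_unique)
  show "extends_frequency \<beta> (- freq \<gamma>) (\<lambda>x. cnj (\<gamma> x))"
    using extends_freq[OF assms]
    by (auto simp: extends_frequency_def character_cnj exp_cnj)
qed

lemma freq_one: "freq (\<lambda>_. 1) = 0"
  by (rule freq_unique) (simp add: extends_frequency_def character_one)

lemma freq_eq_0_iff: "character \<gamma> \<Longrightarrow> freq \<gamma> = 0 \<longleftrightarrow> \<gamma> = (\<lambda>_. 1)"
  using freq_inj[OF _ character_one] freq_one by auto

lemma freq_character_eq: "extends_frequency \<beta> x \<gamma> \<Longrightarrow> freq_character \<beta> x = \<gamma>"
  unfolding freq_character_def using extends_frequency_unique by (intro the_equality)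

text \<open>
  The \<open>p\<close>-th power of the norm of \<open>L\<^sub>p\<close>. It satisfies the triangle inequality only up to the factor
  \<open>2\<^sup>p\<close>, which is harmless for boundedness and for convergence to zero, and pointwise inequalities
  between powers can be integrated directly.
\<close>

definition pmean :: "real \<Rightarrow> ('g \<Rightarrow> complex) \<Rightarrow> real" where
  "pmean p f = (LINT x|m. norm (f x) powr p)"

lemma pmean_nonneg: "pmean p f \<ge> 0"
  unfolding pmean_def by simp

lemma continuous_in_Lp:
  fixes f :: "'g \<Rightarrow> complex"
  assumes f: "continuous_on UNIV f" and p: "p > 0"
  shows "f \<in> Lp p m"
proof -
  have "continuous_on UNIV (\<lambda>x. norm (f x) powr p)"
    using p by (intro continuous_on_powr' continuous_intros f) auto
  then show ?thesis
    using continuous_integrable continuous_measurable[OF f] by (auto simp: Lp_def)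
qed

lemma Lp_add:
  assumes f: "f \<in> Lp p m" and g: "g \<in> Lp p m" and p: "p > 0"
  shows "(\<lambda>x. f x + g x) \<in> Lp p m"
    and "pmean p (\<lambda>x. f x + g x) \<le> 2 powr p * (pmean p f + pmean p g)"
proof -
  have [measurable]: "f \<in> borel_measurable m" "g \<in> borel_measurable m"
    and int: "integrable m (\<lambda>x. norm (f x) powr p)" "integrable m (\<lambda>x. norm (g x) powr p)"
    using f g by (auto simp: Lp_def)
  have bound: "integrable m (\<lambda>x. 2 powr p * (norm (f x) powr p + norm (g x) powr p))"
    by (intro integrable_mult_right Bochner_Integration.integrable_add int)
  have le: "norm (f x + g x) powr p \<le> 2 powr p * (norm (f x) powr p + norm (g x) powr p)" for x
    using p by (intro powr_norm_add_le) auto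
  have int': "integrable m (\<lambda>x. norm (f x + g x) powr p)"
    by (rule Bochner_Integration.integrable_bound[OF bound]) (use le in auto)
  then show "(\<lambda>x. f x + g x) \<in> Lp p m" by (simp add: Lp_def)
  have "pmean p (\<lambda>x. f x + g x) \<le> (LINT x|m. 2 powr p * (norm (f x) powr p + norm (g x) powr p))"
    unfolding pmean_def by (intro integral_mono int' bound le)
  also have "\<dots> = 2 powr p * (pmean p f + pmean p g)"
    using int by (simp add: pmean_def)
  finally show "pmean p (\<lambda>x. f x + g x) \<le> 2 powr p * (pmean p f + pmean p g)" .
qed

lemma pmean_cmult: "pmean p (\<lambda>x. c * f x) = norm c powr p * pmean p f"
  by (simp add: pmean_def norm_mult powr_mult)

lemma Lp_cmult:
  assumes "f \<in> Lp p m"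
  shows "(\<lambda>x. c * f x) \<in> Lp p m"
  using assms by (auto simp: Lp_def norm_mult powr_mult)

lemma Lp_diff:
  assumes f: "f \<in> Lp p m" and g: "g \<in> Lp p m" and p: "p > 0"
  shows "(\<lambda>x. f x - g x) \<in> Lp p m"
    and "pmean p (\<lambda>x. f x - g x) \<le> 2 powr p * (pmean p f + pmean p g)"
  using Lp_add[OF f Lp_cmult[OF g, of "- 1"] p] pmean_cmult[of p "- 1" g] by auto

lemma Lp_integrable:
  assumes f: "f \<in> Lp p m" and p: "p \<ge> 1"
  shows "integrable m f"
proof (rule Bochner_Integration.integrable_bound)
  show "integrable m (\<lambda>x. 1 + norm (f x) powr p)"
    using f by (intro Bochner_Integration.integrable_add) (auto simp: Lp_def)
  show "f \<in> borel_measurable m" using f by (simp add: Lp_def)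
  show "AE x in m. norm (f x) \<le> norm (1 + norm (f x) powr p)"
    using le_powr_scaled[of "norm (f _)" 1 p] p by (auto simp: add_nonneg_nonneg)
qed

text \<open>
  A substitute for the inclusion of \<open>L\<^sub>p\<close> in \<open>L\<^sub>1\<close>: the mean is small if \<open>pmean p f\<close> is small
  compared with \<open>d\<^sup>p\<close>.
\<close>

lemma mean_norm_le:
  assumes f: "f \<in> Lp p m" and p: "p \<ge> 1" and d: "d > 0"
  shows "(LINT x|m. norm (f x)) \<le> d + d powr (1 - p) * pmean p f"
proof -
  have int: "integrable m (\<lambda>x. norm (f x) powr p)" using f by (simp add: Lp_def)
  have "(LINT x|m. norm (f x)) \<le> (LINT x|m. d + d powr (1 - p) * norm (f x) powr p)"
    using Lp_integrable[OF f p] int p d by (intro integral_mono) (auto intro: le_powr_scaled)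
  also have "\<dots> = d + d powr (1 - p) * pmean p f"
    using int by (simp add: pmean_def)
  finally show ?thesis .
qed

lemma pmean_mono:
  assumes "f \<in> Lp p m" "g \<in> Lp p m" "p \<ge> 0" "\<And>x. norm (f x) \<le> norm (g x)"
  shows "pmean p f \<le> pmean p g"
  unfolding pmean_def using assms by (intro integral_mono) (auto simp: Lp_def intro: powr_mono2)

section \<open>Analytic polynomials\<close>

definition nonneg_characters :: "('g \<Rightarrow> complex) set" where
  "nonneg_characters = {\<gamma>. character \<gamma> \<and> freq \<gamma> \<ge> 0}"

lemma nonneg_subset: "nonneg_characters \<subseteq> characters"
  by (auto simp: nonneg_characters_def)

lemma one_nonneg: "(\<lambda>_. 1) \<in> nonneg_characters"
  by (simp add: nonneg_characters_def character_one freq_one)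

lemma analytic_mult:
  assumes "trig_poly nonneg_characters f" "trig_poly nonneg_characters g"
  shows "trig_poly nonneg_characters (\<lambda>x. f x * g x)"
  by (rule trig_poly_mult[OF _ assms]) (auto simp: nonneg_characters_def character_mult freq_mult)

text \<open>A product of characters of non-negative frequency is trivial only if both factors are.\<close>

lemma analytic_mean_mult:
  assumes f: "trig_poly nonneg_characters f" and g: "trig_poly nonneg_characters g"
  shows "(LINT x|m. f x * g x) = (LINT x|m. f x) * (LINT x|m. g x)"
proof -
  have int: "integrable m h" if "trig_poly nonneg_characters h" for h
    by (intro continuous_integrable trig_poly_continuous[OF that] nonneg_subset)
  from f show ?thesis
  proof (induction rule: trig_poly.induct)
    case (single \<gamma> c)
    from g show ?case
    proof (induction rule: trig_poly.induct)
      case (single \<delta> d)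
      have \<gamma>\<delta>: "character \<gamma>" "character \<delta>" "freq \<gamma> \<ge> 0" "freq \<delta> \<ge> 0"
        using \<open>\<gamma> \<in> _\<close> \<open>\<delta> \<in> _\<close> by (auto simp: nonneg_characters_def)
      have "(\<lambda>x. \<gamma> x * \<delta> x) = (\<lambda>_. 1) \<longleftrightarrow> freq \<gamma> + freq \<delta> = 0"
        using freq_eq_0_iff[OF character_mult[OF \<gamma>\<delta>(1,2)]] freq_mult[OF \<gamma>\<delta>(1,2)] by simp
      also have "\<dots> \<longleftrightarrow> \<gamma> = (\<lambda>_. 1) \<and> \<delta> = (\<lambda>_. 1)"
        using \<gamma>\<delta> freq_eq_0_iff by (metis add_nonneg_eq_0_iff)
      finally have iff: "(\<lambda>x. \<gamma> x * \<delta> x) = (\<lambda>_. 1) \<longleftrightarrow> \<gamma> = (\<lambda>_. 1) \<and> \<delta> = (\<lambda>_. 1)" .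
      have "(LINT x|m. (c * \<gamma> x) * (d * \<delta> x)) = c * d * (LINT x|m. \<gamma> x * \<delta> x)"
        by (simp add: mult_ac flip: integral_mult_right_zero)
      also have "\<dots> = (LINT x|m. c * \<gamma> x) * (LINT x|m. d * \<delta> x)"
        using character_integral[OF \<gamma>\<delta>(1)] character_integral[OF \<gamma>\<delta>(2)]
          character_integral[OF character_mult[OF \<gamma>\<delta>(1,2)]] iff by auto
      finally show ?case .
    next
      case (add h k)
      have c\<gamma>: "trig_poly nonneg_characters (\<lambda>x. c * \<gamma> x)"
        using \<open>\<gamma> \<in> _\<close> by (rule trig_poly.single)
      show ?case
        using add int[OF analytic_mult[OF c\<gamma> add.hyps(1)]] int[OF analytic_mult[OF c\<gamma> add.hyps(2)]]
          int[OF add.hyps(1)] int[OF add.hyps(2)]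
        by (simp add: distrib_left)
    qed simp
  next
    case (add h k)
    show ?case
      using add int[OF analytic_mult[OF add.hyps(1) g]] int[OF analytic_mult[OF add.hyps(2) g]]
        int[OF add.hyps(1)] int[OF add.hyps(2)]
      by (simp add: distrib_right)
  qed simp
qed

lemma analytic_power:
  assumes "trig_poly nonneg_characters f"
  shows "trig_poly nonneg_characters (\<lambda>x. f x ^ n) \<and> (LINT x|m. f x ^ n) = (LINT x|m. f x) ^ n"
proof (induction n)
  case 0
  show ?case by (simp add: trig_poly_const one_nonneg)
next
  case (Suc n)
  then show ?case using analytic_mult[OF assms] analytic_mean_mult[OF assms] by simp
qed

text \<open>
  Expand the power into its binomial series around \<open>1\<close> and integrate term by term, using that the
  mean is multiplicative.
\<close>

lemma analytic_mean_powr: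
  assumes F: "trig_poly nonneg_characters F" and \<rho>: "\<rho> < 1" "\<And>x. norm (F x - 1) \<le> \<rho>"
  shows "(LINT x|m. F x powr a) = (LINT x|m. F x) powr a"
proof -
  define Z where "Z x = F x - 1" for x
  have Z: "trig_poly nonneg_characters Z"
    unfolding Z_def by (intro trig_poly_diff F trig_poly_const one_nonneg)
  have Z_cont: "continuous_on UNIV Z" by (rule trig_poly_continuous[OF Z nonneg_subset])
  have F_cont: "continuous_on UNIV F" by (rule trig_poly_continuous[OF F nonneg_subset])
  have Z_bound: "norm (Z x) \<le> \<rho>" for x using \<rho>(2) by (simp add: Z_def)
  have \<rho>0: "\<rho> \<ge> 0" using Z_bound[of 0] norm_ge_zero order_trans by blast
  obtain r where r: "\<rho> < r" "r < 1" using \<rho>(1) dense by blast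
  have "summable (\<lambda>n. (a gchoose n) * complex_of_real r ^ n)"
    using gen_binomial_complex[of "complex_of_real r" a] r \<rho>0 by (auto simp: sums_iff)
  then have "summable (\<lambda>n. norm ((a gchoose n) * complex_of_real \<rho> ^ n))"
    by (rule powser_insidea) (use r \<rho>0 in auto)
  then have summ: "summable (\<lambda>n. norm (a gchoose n) * \<rho> ^ n)"
    using \<rho>0 by (simp add: norm_mult norm_power)
  have term_le: "norm ((a gchoose n) * Z x ^ n) \<le> norm (a gchoose n) * \<rho> ^ n" for n x
    unfolding norm_mult norm_power by (intro mult_left_mono power_mono Z_bound) auto
  have int: "integrable m (\<lambda>x. (a gchoose n) * Z x ^ n)" for n
    by (intro continuous_integrable continuous_intros Z_cont)
  have sums1: "(\<lambda>n. LINT x|m. (a gchoose n) * Z x ^ n) sums (LINT x|m. (\<Sum>n. (a gchoose n) * Z x ^ n))"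
  proof (rule sums_integral[OF int])
    show "AE x in m. summable (\<lambda>n. norm ((a gchoose n) * Z x ^ n))"
      by (intro AE_I2 summable_comparison_test[OF _ summ]) (use term_le in auto)
    have "norm (LINT x|m. norm ((a gchoose n) * Z x ^ n)) \<le> norm (a gchoose n) * \<rho> ^ n" for n
    proof -
      have "(LINT x|m. norm ((a gchoose n) * Z x ^ n)) \<le> (LINT x|m. norm (a gchoose n) * \<rho> ^ n)"
        by (intro integral_mono integrable_norm int term_le) simp
      then show ?thesis by simp
    qed
    then show "summable (\<lambda>n. LINT x|m. norm ((a gchoose n) * Z x ^ n))"
      by (intro summable_comparison_test[OF _ summ]) auto
  qed
  have "(\<Sum>n. (a gchoose n) * Z x ^ n) = F x powr a" for x
    using gen_binomial_complex[of "Z x" a] Z_bound[of x] \<rho>(1) by (simp add: sums_iff Z_def)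
  with sums1 have sums2: "(\<lambda>n. (a gchoose n) * (LINT x|m. Z x) ^ n) sums (LINT x|m. F x powr a)"
    using analytic_power[OF Z] by simp
  have "norm (LINT x|m. Z x) \<le> (LINT x|m. norm (Z x))" by (rule integral_norm_bound)
  also have "\<dots> \<le> (LINT x|m. \<rho>)"
    by (intro integral_mono integrable_norm continuous_integrable Z_cont Z_bound) simp
  finally have "norm (LINT x|m. Z x) < 1" using \<rho>(1) by simp
  from gen_binomial_complex[OF this] sums2
  have "(LINT x|m. F x powr a) = (1 + (LINT x|m. Z x)) powr a" by (rule sums_unique2[rotated])
  also have "1 + (LINT x|m. Z x) = (LINT x|m. F x)"
    unfolding Z_def using continuous_integrable[OF F_cont] by simp
  finally show ?thesis .
qed

text \<open>
  All values of \<open>F\<close> lie in a compact subset of the open right half plane, hence in a disc around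
  some large \<open>R\<close> that stays away from \<open>0\<close>. After division by \<open>R\<close> the mean of \<open>F\<^sup>p\<close> is known, and the
  pointwise inequality can be integrated.
\<close>

lemma analytic_pmean_le:
  assumes p: "1 < p"
    and AB: "A > 0" "B > 0" "\<And>z. Re z > 0 \<Longrightarrow> norm z powr p \<le> A * Re z powr p - B * Re (z powr of_real p)"
    and F: "trig_poly nonneg_characters F" and \<delta>: "\<delta> > 0" "\<And>x. Re (F x) \<ge> \<delta>"
    and mean: "(LINT x|m. F x) = complex_of_real c"
  shows "pmean p F + B * \<bar>c\<bar> powr p \<le> A * (LINT x|m. Re (F x) powr p)"
proof -
  have F_cont: "continuous_on UNIV F" by (rule trig_poly_continuous[OF F nonneg_subset])
  obtain M where M: "M > 0" "\<And>x. norm (F x) \<le> M" using continuous_bounded[OF F_cont] by blast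
  \<comment> \<open>The disc around \<open>R\<close> of radius \<open>\<rho> R < R\<close> contains all values of \<open>F\<close>.\<close>
  define R where "R = M\<^sup>2 / \<delta>"
  have R: "R > 0" using M \<delta>(1) by (simp add: R_def)
  define G where "G x = F x * complex_of_real (1 / R)" for x
  define \<rho> where "\<rho> = sqrt (1 - (M / R)\<^sup>2)"
  have G: "trig_poly nonneg_characters G"
    unfolding G_def using trig_poly_cmult[OF F, of "complex_of_real (1 / R)"] by (simp add: mult.commute)
  have ReG: "Re (G x) = Re (F x) / R" for x by (simp add: G_def)
  have G_close: "norm (G x - 1) \<le> \<rho>" for x
  proof -
    have "(norm (G x - 1))\<^sup>2 = (norm (G x))\<^sup>2 - 2 * Re (G x) + 1"
      unfolding cmod_power2 by (simp add: power2_eq_square algebra_simps)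
    also have "norm (G x) = norm (F x) / R" using R by (simp add: G_def norm_mult norm_divide)
    also have "(norm (F x) / R)\<^sup>2 - 2 * Re (G x) + 1 \<le> (M / R)\<^sup>2 - 2 * (\<delta> / R) + 1"
      using M(2)[of x] \<delta>(2)[of x] R
      by (intro add_mono diff_mono power_mono) (auto simp: ReG divide_right_mono)
    also have "\<delta> / R = (M / R)\<^sup>2"
      using \<delta>(1) M(1) by (simp add: R_def power2_eq_square field_simps)
    finally have "(norm (G x - 1))\<^sup>2 \<le> 1 - (M / R)\<^sup>2" by simp
    then show ?thesis unfolding \<rho>_def by (rule real_le_rsqrt)
  qed
  have "\<rho> < 1"
    unfolding \<rho>_def using M(1) R by (simp add: real_sqrt_lt_1_iff)
  then have "(LINT x|m. G x powr of_real p) = (LINT x|m. G x) powr of_real p"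
    using analytic_mean_powr[OF G _ G_close] by blast
  also have "(LINT x|m. G x) = complex_of_real (c / R)"
    unfolding G_def using mean by simp
  finally have mean_powr: "(LINT x|m. G x powr of_real p) = complex_of_real (c / R) powr of_real p" .
  have c: "c \<ge> \<delta>"
  proof -
    have "\<delta> = (LINT x|m. \<delta>)" by simp
    also have "\<dots> \<le> (LINT x|m. Re (F x))"
      by (intro integral_mono continuous_integrable continuous_intros F_cont \<delta>)
    also have "\<dots> = Re (LINT x|m. F x)" by (intro integral_Re continuous_integrable F_cont)
    finally show ?thesis using mean by simp
  qed
  have G_cont: "continuous_on UNIV G" by (rule trig_poly_continuous[OF G nonneg_subset])
  have ReG_pos: "Re (G x) > 0" for x using \<delta>(1) \<delta>(2)[of x] R by (simp add: ReG)
  then have ReG_nz: "G x \<noteq> 0" for x by (metis less_irrefl zero_complex.sel(1))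
  have powr_cont: "continuous_on UNIV (\<lambda>x. G x powr of_real p)"
    using ReG_nz less_imp_le[OF ReG_pos]
    by (intro continuous_on_powr_complex G_cont continuous_intros) auto
  have cont1: "continuous_on UNIV (\<lambda>x. norm (G x) powr p)"
    using p by (intro continuous_on_powr' continuous_intros G_cont) auto
  have cont2: "continuous_on UNIV (\<lambda>x. Re (G x) powr p)"
    using p less_imp_le[OF ReG_pos] by (intro continuous_on_powr' continuous_intros G_cont) auto
  note cont = cont1 cont2
  have "pmean p G \<le> (LINT x|m. A * Re (G x) powr p - B * Re (G x powr of_real p))"
    unfolding pmean_def
    by (intro integral_mono continuous_integrable continuous_intros cont powr_cont AB(3) ReG_pos)
  also have "\<dots> = (LINT x|m. A * Re (G x) powr p) - (LINT x|m. B * Re (G x powr of_real p))"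
    by (intro Bochner_Integration.integral_diff continuous_integrable continuous_intros cont powr_cont)
  also have "(LINT x|m. B * Re (G x powr of_real p)) = B * Re (LINT x|m. G x powr of_real p)"
    using integral_Re[OF continuous_integrable[OF powr_cont]] by simp
  also have "Re (LINT x|m. G x powr of_real p) = (c / R) powr p"
    unfolding mean_powr using c \<delta>(1) R by (simp add: powr_of_real del: of_real_divide)
  also have "(LINT x|m. A * Re (G x) powr p) = A * ((LINT x|m. Re (F x) powr p) / R powr p)"
    using \<delta> R by (simp add: ReG powr_divide order_trans[OF less_imp_le])
  also have "(c / R) powr p = c powr p / R powr p"
    using c \<delta>(1) R by (simp add: powr_divide)
  also have "pmean p G = pmean p F / R powr p"
    using R by (simp add: pmean_def G_def norm_divide powr_divide)
  finally show ?thesis using c \<delta>(1) R by (simp add: field_simps)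
qed

end

section \<open>The Riesz projection\<close>

lemma le_if_le_add_small:
  fixes x y K :: real
  assumes "\<And>d. 0 < d \<Longrightarrow> d \<le> 1 \<Longrightarrow> x \<le> y + K * d"
  shows "x \<le> y"
proof (rule field_le_epsilon)
  fix e :: real assume e: "0 < e"
  define d where "d = min 1 (e / (\<bar>K\<bar> + 1))"
  have d: "0 < d" "d \<le> 1" "d \<le> e / (\<bar>K\<bar> + 1)" using e by (auto simp: d_def)
  have "K * d \<le> (\<bar>K\<bar> + 1) * d" using d(1) by (intro mult_right_mono) auto
  also have "\<dots> \<le> e" using d(3) by (simp add: field_simps)
  finally show "x \<le> y + e" using assms[OF d(1,2)] by linarith
qed

context haar_on_dirichlet_group
begin

definition spectral_part :: "('g \<Rightarrow> complex) set \<Rightarrow> ('g \<Rightarrow> complex) \<Rightarrow> 'g \<Rightarrow> complex" where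
  "spectral_part S f x = (\<Sum>\<gamma>\<in>spectrum f \<inter> S. coeff f \<gamma> * \<gamma> x)"

lemma spectrum_characters: "spectrum f \<subseteq> characters"
  by (auto simp: spectrum_def)

lemma spectral_part_eq:
  assumes "finite T" "spectrum f \<subseteq> T" "T \<subseteq> characters"
  shows "spectral_part S f x = (\<Sum>\<gamma>\<in>T \<inter> S. coeff f \<gamma> * \<gamma> x)"
  unfolding spectral_part_def
  using assms by (intro sum.mono_neutral_left) (auto simp: spectrum_def)

lemma trig_poly_spectral_part:
  "trig_poly (characters \<inter> S) (spectral_part S f)"
  unfolding spectral_part_def[abs_def]
  by (intro trig_poly_sum trig_poly.single) (auto simp: spectrum_def)

lemma trig_poly_spectral_part': "trig_poly characters (spectral_part S f)"
  using trig_poly_mono[OF trig_poly_spectral_part] by blast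

lemma trig_poly_integrable: "trig_poly characters f \<Longrightarrow> integrable m f"
  by (intro continuous_integrable trig_poly_continuous[of characters]) auto

lemma trig_poly_Lp: "trig_poly characters f \<Longrightarrow> p > 0 \<Longrightarrow> f \<in> Lp p m"
  by (intro continuous_in_Lp trig_poly_continuous[of characters]) auto

lemma finite_spectrum': "trig_poly characters f \<Longrightarrow> finite (spectrum f)"
  by (rule finite_spectrum) auto

lemma spectral_part_add:
  assumes f: "trig_poly characters f" and g: "trig_poly characters g"
  shows "spectral_part S (\<lambda>x. f x + g x) x = spectral_part S f x + spectral_part S g x"
proof -
  define T where "T = spectrum f \<union> spectrum g"
  have T: "finite T" "T \<subseteq> characters" "spectrum f \<subseteq> T" "spectrum g \<subseteq> T"
    using finite_spectrum'[OF f] finite_spectrum'[OF g] by (auto simp: T_def spectrum_def)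
  have coeff: "coeff (\<lambda>x. f x + g x) \<gamma> = coeff f \<gamma> + coeff g \<gamma>"
    if "character \<gamma>" for \<gamma>
    by (intro fourier_coeff_add trig_poly_integrable f g that)
  have "spectrum (\<lambda>x. f x + g x) \<subseteq> T"
    by (auto simp: T_def spectrum_def coeff)
  then have "spectral_part S (\<lambda>x. f x + g x) x =
      (\<Sum>\<gamma>\<in>T \<inter> S. (coeff f \<gamma> + coeff g \<gamma>) * \<gamma> x)"
    using T coeff by (subst spectral_part_eq[of T]) (auto intro!: sum.cong)
  also have "\<dots> = spectral_part S f x + spectral_part S g x"
    using T by (simp add: spectral_part_eq[of T] distrib_right sum.distrib)
  finally show ?thesis .
qed

lemma spectral_part_cmult:
  assumes f: "trig_poly characters f"
  shows "spectral_part S (\<lambda>x. c * f x) x = c * spectral_part S f x"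
proof -
  have "spectrum (\<lambda>x. c * f x) \<subseteq> spectrum f"
    by (auto simp: spectrum_def fourier_coeff_cmult)
  then have "spectral_part S (\<lambda>x. c * f x) x = (\<Sum>\<gamma>\<in>spectrum f \<inter> S. c * coeff f \<gamma> * \<gamma> x)"
    by (subst spectral_part_eq[OF finite_spectrum'[OF f]])
       (auto simp: fourier_coeff_cmult spectrum_def)
  then show ?thesis by (simp add: spectral_part_def sum_distrib_left mult.assoc)
qed

lemma spectral_part_diff:
  assumes f: "trig_poly characters f" and g: "trig_poly characters g"
  shows "spectral_part S (\<lambda>x. f x - g x) x = spectral_part S f x - spectral_part S g x"
  using spectral_part_add[OF f trig_poly_cmult[OF g, of "- 1"], of S x]
    spectral_part_cmult[OF g, of S "- 1" x] by simp

lemma fourier_coeff_spectral_part: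
  assumes f: "trig_poly characters f" and \<gamma>: "character \<gamma>"
  shows "coeff (spectral_part S f) \<gamma> = (if \<gamma> \<in> S then coeff f \<gamma> else 0)"
  unfolding spectral_part_def[abs_def]
  using finite_spectrum'[OF f] spectrum_characters \<gamma>
  by (subst fourier_coeff_sum_characters) (auto simp: spectrum_def)

lemma trig_poly_inner_product:
  assumes f: "trig_poly characters f" and g: "continuous_on UNIV g"
    and T: "finite T" "spectrum f \<subseteq> T" "T \<subseteq> characters"
  shows "(LINT x|m. f x * cnj (g x)) = (\<Sum>\<gamma>\<in>T. coeff f \<gamma> * cnj (coeff g \<gamma>))"
proof -
  have \<gamma>: "continuous_on UNIV \<gamma>" if "\<gamma> \<in> T" for \<gamma> using T(3) that characterD(1) by auto
  have "(LINT x|m. f x * cnj (g x)) = (LINT x|m. (\<Sum>\<gamma>\<in>T. coeff f \<gamma> * cnj (g x * cnj (\<gamma> x))))"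
    using trig_poly_eq[OF f _ T] by (simp add: sum_distrib_right sum_distrib_left mult_ac)
  also have "\<dots> = (\<Sum>\<gamma>\<in>T. (LINT x|m. coeff f \<gamma> * cnj (g x * cnj (\<gamma> x))))"
    by (intro Bochner_Integration.integral_sum continuous_integrable continuous_intros g \<gamma>)
  also have "\<dots> = (\<Sum>\<gamma>\<in>T. coeff f \<gamma> * cnj (coeff g \<gamma>))"
    unfolding fourier_coeff_def by (simp only: integral_mult_right_zero Bochner_Integration.integral_cnj)
  finally show ?thesis .
qed

lemma spectral_part_self_adjoint:
  assumes f: "trig_poly characters f" and g: "trig_poly characters g"
  shows "(LINT x|m. spectral_part S f x * cnj (g x)) = (LINT x|m. f x * cnj (spectral_part S g x))"
proof -
  have cont: "continuous_on UNIV h" if "trig_poly characters h" for h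
    by (rule trig_poly_continuous[OF that]) auto
  have sub: "spectrum (spectral_part S f) \<subseteq> spectrum f"
    by (auto simp: spectrum_def fourier_coeff_spectral_part[OF f] split: if_splits)
  show ?thesis
    unfolding trig_poly_inner_product[OF trig_poly_spectral_part' cont[OF g] finite_spectrum'[OF f] sub spectrum_characters]
      trig_poly_inner_product[OF f cont[OF trig_poly_spectral_part'] finite_spectrum'[OF f] order_refl spectrum_characters]
    by (intro sum.cong refl) (auto simp: spectrum_def fourier_coeff_spectral_part f g)
qed

lemma mean_square_trig_poly:
  assumes f: "trig_poly characters f" and T: "finite T" "spectrum f \<subseteq> T" "T \<subseteq> characters"
  shows "(LINT x|m. (norm (f x))\<^sup>2) = (\<Sum>\<gamma>\<in>T. (norm (coeff f \<gamma>))\<^sup>2)"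
proof -
  have "complex_of_real (LINT x|m. (norm (f x))\<^sup>2) = (LINT x|m. f x * cnj (f x))"
    by (simp add: complex_norm_square[symmetric] del: of_real_power)
  also have "\<dots> = (\<Sum>\<gamma>\<in>T. coeff f \<gamma> * cnj (coeff f \<gamma>))"
    by (rule trig_poly_inner_product[OF f trig_poly_continuous[OF f order_refl] T])
  also have "\<dots> = complex_of_real (\<Sum>\<gamma>\<in>T. (norm (coeff f \<gamma>))\<^sup>2)"
    by (simp add: complex_norm_square[symmetric] del: of_real_power)
  finally show ?thesis unfolding of_real_eq_iff .
qed

lemma mean_square_spectral_part_le:
  assumes f: "trig_poly characters f"
  shows "(LINT x|m. (norm (spectral_part S f x))\<^sup>2) \<le> (LINT x|m. (norm (f x))\<^sup>2)"
proof -
  have sub: "spectrum (spectral_part S f) \<subseteq> spectrum f"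
    by (auto simp: spectrum_def fourier_coeff_spectral_part[OF f] split: if_splits)
  show ?thesis
    unfolding mean_square_trig_poly[OF f finite_spectrum'[OF f] order_refl spectrum_characters]
      mean_square_trig_poly[OF trig_poly_spectral_part' finite_spectrum'[OF f] sub spectrum_characters]
    by (intro sum_mono) (auto simp: spectrum_def fourier_coeff_spectral_part[OF f])
qed

definition pos_characters :: "('g \<Rightarrow> complex) set" where
  "pos_characters = {\<gamma>. character \<gamma> \<and> freq \<gamma> > 0}"

abbreviation riesz :: "('g \<Rightarrow> complex) \<Rightarrow> 'g \<Rightarrow> complex" where
  "riesz \<equiv> spectral_part pos_characters"

lemma fourier_coeff_cnj: "coeff (\<lambda>x. cnj (f x)) (\<lambda>x. cnj (\<gamma> x)) = cnj (coeff f \<gamma>)"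
  unfolding fourier_coeff_def by (subst Bochner_Integration.integral_cnj[symmetric]) simp

text \<open>
  Conjugation reverses the sign of the frequency, and the only character of frequency \<open>0\<close> is \<open>1\<close>.
\<close>

lemma real_trig_poly_decomposition:
  assumes h: "trig_poly characters (\<lambda>x. complex_of_real (h x))"
  shows "complex_of_real (h x) = complex_of_real (LINT x|m. h x)
    + riesz (\<lambda>x. complex_of_real (h x)) x + cnj (riesz (\<lambda>x. complex_of_real (h x)) x)"
proof -
  define g where "g = (\<lambda>x. complex_of_real (h x))"
  define T where "T = spectrum g"
  define N where "N = {\<gamma> \<in> T. freq \<gamma> < 0}"
  define P where "P = T \<inter> pos_characters"
  have g: "trig_poly characters g" using h by (simp add: g_def)
  have T: "finite T" "T \<subseteq> characters"
    using finite_spectrum'[OF g] by (auto simp: T_def spectrum_def)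
  have coeff_cnj: "coeff g (\<lambda>x. cnj (\<gamma> x)) = cnj (coeff g \<gamma>)" for \<gamma>
    using fourier_coeff_cnj[of g \<gamma>] by (simp add: g_def)
  have T_cnj: "(\<lambda>x. cnj (\<gamma> x)) \<in> T" if "\<gamma> \<in> T" for \<gamma>
    using that by (auto simp: T_def spectrum_def coeff_cnj character_cnj)
  have "g x = (\<Sum>\<gamma>\<in>insert (\<lambda>_. 1) T. coeff g \<gamma> * \<gamma> x)"
    using T character_one by (intro trig_poly_eq[OF g]) (auto simp: T_def)
  also have "insert (\<lambda>_. 1) T = insert (\<lambda>_. 1) (P \<union> N)"
    using T(2) freq_eq_0_iff by (fastforce simp: P_def N_def pos_characters_def)
  also have "(\<Sum>\<gamma>\<in>insert (\<lambda>_. 1) (P \<union> N). coeff g \<gamma> * \<gamma> x) =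
      coeff g (\<lambda>_. 1) * 1 + (\<Sum>\<gamma>\<in>P \<union> N. coeff g \<gamma> * \<gamma> x)"
    using T(1) freq_one by (subst sum.insert) (auto simp: P_def N_def pos_characters_def)
  also have "(\<Sum>\<gamma>\<in>P \<union> N. coeff g \<gamma> * \<gamma> x) =
      (\<Sum>\<gamma>\<in>P. coeff g \<gamma> * \<gamma> x) + (\<Sum>\<gamma>\<in>N. coeff g \<gamma> * \<gamma> x)"
    using T(1) by (intro sum.union_disjoint) (auto simp: P_def N_def pos_characters_def)
  also have "(\<Sum>\<gamma>\<in>N. coeff g \<gamma> * \<gamma> x) = (\<Sum>\<gamma>\<in>P. cnj (coeff g \<gamma> * \<gamma> x))"
    by (rule sum.reindex_bij_witness[of _ "\<lambda>\<gamma> x. cnj (\<gamma> x)" "\<lambda>\<gamma> x. cnj (\<gamma> x)"])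
       (use T(2) T_cnj in \<open>auto simp: P_def N_def pos_characters_def coeff_cnj character_cnj freq_cnj\<close>)
  also have "(\<Sum>\<gamma>\<in>P. cnj (coeff g \<gamma> * \<gamma> x)) = cnj (\<Sum>\<gamma>\<in>P. coeff g \<gamma> * \<gamma> x)"
    by (rule cnj_sum[symmetric])
  also have "(\<Sum>\<gamma>\<in>P. coeff g \<gamma> * \<gamma> x) = riesz g x"
    by (simp add: spectral_part_def P_def T_def)
  also have "coeff g (\<lambda>_. 1) = complex_of_real (LINT x|m. h x)"
    by (simp add: fourier_coeff_def g_def)
  finally show ?thesis by (simp add: g_def)
qed

text \<open>
  With \<open>c\<close> the mean of \<open>h\<close>, the polynomial \<open>F = c + 2 riesz h\<close> is analytic with real part \<open>h\<close>. The
  term \<open>B \<bar>c\<bar>\<^sup>p\<close> that the mean of \<open>F\<^sup>p\<close> contributes also controls the constant \<open>c\<close>.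
\<close>

lemma riesz_positive_bounded:
  assumes p: "1 < p" "p \<le> 2"
  obtains C where "C \<ge> 0"
    "\<And>h \<delta>. trig_poly characters (\<lambda>x. complex_of_real (h x)) \<Longrightarrow> \<delta> > 0 \<Longrightarrow> (\<And>x. h x \<ge> \<delta>) \<Longrightarrow>
      pmean p (riesz (\<lambda>x. complex_of_real (h x))) \<le> C * pmean p (\<lambda>x. complex_of_real (h x))"
proof -
  obtain A B where AB: "A > 0" "B > 0"
    "\<And>z. Re z > 0 \<Longrightarrow> norm z powr p \<le> A * Re z powr p - B * Re (z powr of_real p)"
    using right_half_plane_powr_bound[OF p] by blast
  have p0: "p > 0" using p by simp
  define C where "C = 2 powr p * (A + A / B)"
  show thesis
  proof (rule that)
    show "C \<ge> 0" using AB by (simp add: C_def)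
    fix h :: "'g \<Rightarrow> real" and \<delta> :: real
    assume h: "trig_poly characters (\<lambda>x. complex_of_real (h x))" and \<delta>: "\<delta> > 0" "\<And>x. h x \<ge> \<delta>"
    define g where "g = (\<lambda>x. complex_of_real (h x))"
    define c where "c = (LINT x|m. h x)"
    define F where "F = (\<lambda>x. complex_of_real c + 2 * riesz g x)"
    have rg: "trig_poly nonneg_characters (riesz g)"
      by (rule trig_poly_mono[OF trig_poly_spectral_part])
         (auto simp: nonneg_characters_def pos_characters_def)
    have F: "trig_poly nonneg_characters F"
      unfolding F_def by (intro trig_poly.add trig_poly_cmult rg trig_poly_const one_nonneg)
    have ReF: "Re (F x) = h x" for x
      using arg_cong[OF real_trig_poly_decomposition[OF h, of x], of Re]
      by (simp add: F_def g_def c_def)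
    have rg_int: "integrable m (riesz g)"
      by (rule trig_poly_integrable[OF trig_poly_spectral_part'])
    have "(LINT x|m. riesz g x) = coeff (riesz g) (\<lambda>_. 1)"
      by (simp add: fourier_coeff_def)
    also have "\<dots> = 0"
      using fourier_coeff_spectral_part[of g "\<lambda>_. 1" pos_characters] h character_one freq_one
      by (simp add: g_def pos_characters_def)
    finally have mean: "(LINT x|m. F x) = complex_of_real c"
      unfolding F_def using rg_int by simp
    have "pmean p F + B * \<bar>c\<bar> powr p \<le> A * (LINT x|m. Re (F x) powr p)"
      using analytic_pmean_le[OF p(1) AB F \<delta>(1) _ mean] \<delta>(2) ReF by simp
    also have "(LINT x|m. Re (F x) powr p) = pmean p g"
      unfolding pmean_def ReF g_def using \<delta> by (simp add: abs_of_nonneg order_trans[OF less_imp_le])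
    finally have main: "pmean p F + B * \<bar>c\<bar> powr p \<le> A * pmean p g" .
    have Fle: "pmean p F \<le> A * pmean p g"
    proof -
      have "B * \<bar>c\<bar> powr p \<ge> 0" using AB(2) by simp
      then show ?thesis using main by linarith
    qed
    have "B * \<bar>c\<bar> powr p \<le> A * pmean p g"
      using main pmean_nonneg[of p F] by linarith
    then have cle: "\<bar>c\<bar> powr p \<le> A / B * pmean p g"
      using AB(2) by (simp add: pos_le_divide_eq mult.commute)
    have half: "norm (1 / 2 :: complex) powr p \<le> 1"
      using p0 powr_mono2[of p "1/2" 1] by (simp add: norm_divide)
    have FL: "F \<in> Lp p m"
      by (rule trig_poly_Lp[OF trig_poly_mono[OF F nonneg_subset] p0])
    have cL: "(\<lambda>_. complex_of_real c) \<in> Lp p m"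
      by (intro continuous_in_Lp p0) auto
    have "riesz g = (\<lambda>x. 1 / 2 * (F x - complex_of_real c))"
      by (simp add: F_def fun_eq_iff)
    then have "pmean p (riesz g) = norm (1 / 2 :: complex) powr p * pmean p (\<lambda>x. F x - complex_of_real c)"
      by (simp only: pmean_cmult)
    also have "\<dots> \<le> 1 * pmean p (\<lambda>x. F x - complex_of_real c)"
      by (intro mult_right_mono half pmean_nonneg)
    also have "\<dots> \<le> 2 powr p * (pmean p F + pmean p (\<lambda>_. complex_of_real c))"
      using Lp_diff(2)[OF FL cL p0] by simp
    also have "\<dots> \<le> 2 powr p * (A * pmean p g + A / B * pmean p g)"
      using Fle cle by (intro mult_left_mono add_mono) (auto simp: pmean_def)
    also have "\<dots> = C * pmean p g" by (simp add: C_def algebra_simps)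
    finally show "pmean p (riesz (\<lambda>x. complex_of_real (h x))) \<le> C * pmean p (\<lambda>x. complex_of_real (h x))"
      by (simp add: g_def)
  qed
qed

text \<open>
  A real polynomial is the difference of two positive functions that are only continuous;
  the error made in replacing them by positive polynomials is uniformly small, and hence so is the
  mean square of its Riesz projection.
\<close>

lemma riesz_real_bounded:
  assumes p: "1 < p" "p \<le> 2"
  obtains C where "C \<ge> 0"
    "\<And>u. trig_poly characters (\<lambda>x. complex_of_real (u x)) \<Longrightarrow>
      pmean p (riesz (\<lambda>x. complex_of_real (u x))) \<le> C * pmean p (\<lambda>x. complex_of_real (u x))"
proof -
  have p0: "p > 0" "p \<ge> 0" using p by auto
  obtain C0 where C0: "C0 \<ge> 0"
    "\<And>h \<delta>. trig_poly characters (\<lambda>x. complex_of_real (h x)) \<Longrightarrow> \<delta> > 0 \<Longrightarrow> (\<And>x. h x \<ge> \<delta>) \<Longrightarrow>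
      pmean p (riesz (\<lambda>x. complex_of_real (h x))) \<le> C0 * pmean p (\<lambda>x. complex_of_real (h x))"
    using riesz_positive_bounded[OF p] by blast
  define C where "C = 2 powr p * (2 powr p * (2 * (C0 * 2 powr p)))"
  show thesis
  proof (rule that)
    show "C \<ge> 0" using C0(1) by (simp add: C_def)
    fix u :: "'g \<Rightarrow> real"
    assume u: "trig_poly characters (\<lambda>x. complex_of_real (u x))"
    let ?c = "\<lambda>u x. complex_of_real (u x)"
    have "continuous_on UNIV (?c u)" by (rule trig_poly_continuous[OF u]) auto
    from continuous_on_Re[OF this] have u_cont: "continuous_on UNIV u" by simp
    have L: "f \<in> Lp p m" if "trig_poly characters f" for f by (rule trig_poly_Lp[OF that p0(1)])
    show "pmean p (riesz (?c u)) \<le> C * pmean p (?c u)"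
    proof (rule le_if_le_add_small)
      fix d :: real assume d: "0 < d" "d \<le> 1"
      \<comment> \<open>The \<open>p\<close>-th power of an error of order \<open>e\<close> is linear in \<open>d\<close>.\<close>
      define e where "e = d powr (1 / p)"
      have e: "e > 0" using d by (simp add: e_def)
      have e_powr: "(k * e) powr p = k powr p * d" if "k \<ge> 0" for k
        using p0 d that by (simp add: e_def powr_mult powr_powr)
      have approx: "\<exists>h. trig_poly characters (?c h) \<and> (\<forall>x. h x \<ge> e) \<and>
          (\<forall>x. \<bar>max (w x) 0 + 2 * e - h x\<bar> < e)" if "continuous_on UNIV w" for w :: "'g \<Rightarrow> real"
      proof -
        have "continuous_on UNIV (\<lambda>x. max (w x) 0 + 2 * e)" by (intro continuous_intros that)
        then obtain h where h: "trig_poly characters (?c h)" "\<And>x. \<bar>max (w x) 0 + 2 * e - h x\<bar> < e"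
          using trig_polys_dense_real e by blast
        have "h x \<ge> e" for x using h(2)[of x] max.cobounded2[of 0 "w x"] by linarith
        then show ?thesis using h by blast
      qed
      obtain h1 where h1: "trig_poly characters (?c h1)" "\<And>x. h1 x \<ge> e"
        "\<And>x. \<bar>max (u x) 0 + 2 * e - h1 x\<bar> < e"
        using approx[OF u_cont] by blast
      obtain h2 where h2: "trig_poly characters (?c h2)" "\<And>x. h2 x \<ge> e"
        "\<And>x. \<bar>max (- u x) 0 + 2 * e - h2 x\<bar> < e"
        using approx[of "\<lambda>x. - u x"] u_cont by (auto intro: continuous_intros)
      have size: "pmean p (?c h) \<le> 2 powr p * (pmean p (?c u) + 3 powr p * d)"
        if h: "trig_poly characters (?c h)" and le: "\<And>x. \<bar>h x\<bar> \<le> \<bar>u x\<bar> + 3 * e" for h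
      proof -
        have c1: "(\<lambda>x. complex_of_real \<bar>u x\<bar>) \<in> Lp p m" "(\<lambda>_. complex_of_real (3 * e)) \<in> Lp p m"
          by (intro continuous_in_Lp continuous_intros u_cont p0)+
        have "pmean p (?c h) \<le> pmean p (\<lambda>x. complex_of_real \<bar>u x\<bar> + complex_of_real (3 * e))"
        proof (rule pmean_mono[OF L[OF h] Lp_add(1)[OF c1 p0(1)] p0(2)])
          have "norm (complex_of_real \<bar>u x\<bar> + complex_of_real (3 * e)) = \<bar>u x\<bar> + 3 * e" for x
            unfolding of_real_add[symmetric] norm_of_real using e by simp
          then show "norm (?c h x) \<le> norm (complex_of_real \<bar>u x\<bar> + complex_of_real (3 * e))" for x
            using le[of x] by simp
        qed
        also have "\<dots> \<le> 2 powr p * (pmean p (\<lambda>x. complex_of_real \<bar>u x\<bar>) + pmean p (\<lambda>_. complex_of_real (3 * e)))"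
          by (rule Lp_add(2)[OF c1 p0(1)])
        also have "pmean p (\<lambda>_. complex_of_real (3 * e)) = 3 powr p * d"
          using e e_powr[of 3] by (simp add: pmean_def norm_mult)
        also have "pmean p (\<lambda>x. complex_of_real \<bar>u x\<bar>) = pmean p (?c u)"
          by (simp add: pmean_def)
        finally show ?thesis .
      qed
      have n1: "pmean p (?c h1) \<le> 2 powr p * (pmean p (?c u) + 3 powr p * d)"
      proof (rule size[OF h1(1)])
        show "\<bar>h1 x\<bar> \<le> \<bar>u x\<bar> + 3 * e" for x using h1(2,3)[of x] e by (auto simp: max_def abs_if split: if_splits)
      qed
      have n2: "pmean p (?c h2) \<le> 2 powr p * (pmean p (?c u) + 3 powr p * d)"
      proof (rule size[OF h2(1)])
        show "\<bar>h2 x\<bar> \<le> \<bar>u x\<bar> + 3 * e" for x using h2(2,3)[of x] e by (auto simp: max_def abs_if split: if_splits)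
      qed
      define r where "r x = ?c u x - (?c h1 x - ?c h2 x)" for x
      have h12: "trig_poly characters (\<lambda>x. ?c h1 x - ?c h2 x)" by (intro trig_poly_diff h1 h2)
      have r: "trig_poly characters r" unfolding r_def by (intro trig_poly_diff u h12)
      have r_small: "norm (r x) \<le> 2 * e" for x
      proof -
        have "r x = complex_of_real (u x - (h1 x - h2 x))" by (simp add: r_def)
        then have "norm (r x) = \<bar>u x - (h1 x - h2 x)\<bar>" by (simp only: norm_of_real)
        then show ?thesis using h1(3)[of x] h2(3)[of x] by (auto simp: max_def split: if_splits)
      qed
      have "(LINT x|m. (norm (riesz r x))\<^sup>2) \<le> (LINT x|m. (norm (r x))\<^sup>2)"
        by (rule mean_square_spectral_part_le[OF r])
      also have "\<dots> \<le> (LINT x|m. (2 * e)\<^sup>2)"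
        by (intro integral_mono continuous_integrable continuous_intros trig_poly_continuous[OF r] power_mono r_small) auto
      finally have ms: "(LINT x|m. (norm (riesz r x))\<^sup>2) \<le> (2 * e)\<^sup>2" by simp
      have rr_cont: "continuous_on UNIV (riesz r)"
        by (rule trig_poly_continuous[OF trig_poly_spectral_part']) auto
      have "pmean p (riesz r) \<le> (LINT x|m. (2 * e) powr p * (1 + (norm (riesz r x))\<^sup>2 / (2 * e)\<^sup>2))"
        unfolding pmean_def
      proof (intro integral_mono)
        show "integrable m (\<lambda>x. norm (riesz r x) powr p)"
          using L[OF trig_poly_spectral_part'[of pos_characters r]] by (simp add: Lp_def)
        show "integrable m (\<lambda>x. (2 * e) powr p * (1 + (norm (riesz r x))\<^sup>2 / (2 * e)\<^sup>2))"
          using e by (intro continuous_integrable continuous_intros rr_cont) auto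
        show "norm (riesz r x) powr p \<le> (2 * e) powr p * (1 + (norm (riesz r x))\<^sup>2 / (2 * e)\<^sup>2)" for x
          using e p by (intro powr_le_scaled_square) auto
      qed
      also have "\<dots> = (2 * e) powr p * (1 + (LINT x|m. (norm (riesz r x))\<^sup>2) / (2 * e)\<^sup>2)"
      proof -
        have "integrable m (\<lambda>x. (norm (riesz r x))\<^sup>2)"
          by (intro continuous_integrable continuous_intros rr_cont)
        then show ?thesis by simp
      qed
      also have "\<dots> \<le> (2 * e) powr p * (1 + 1)"
        using ms e by (intro mult_left_mono add_left_mono) (auto simp: divide_le_eq)
      finally have nr: "pmean p (riesz r) \<le> 2 * (2 powr p * d)" using e_powr[of 2] by simp
      have "riesz (?c u) = (\<lambda>x. (riesz (?c h1) x - riesz (?c h2) x) + riesz r x)"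
      proof
        fix x
        have "riesz r x = riesz (?c u) x - riesz (\<lambda>x. ?c h1 x - ?c h2 x) x"
          unfolding r_def[abs_def] by (rule spectral_part_diff[OF u h12])
        then show "riesz (?c u) x = (riesz (?c h1) x - riesz (?c h2) x) + riesz r x"
          by (simp add: spectral_part_diff[OF h1(1) h2(1)])
      qed
      then have "pmean p (riesz (?c u)) = pmean p (\<lambda>x. (riesz (?c h1) x - riesz (?c h2) x) + riesz r x)"
        by simp
      also have "\<dots> \<le> 2 powr p * (pmean p (\<lambda>x. riesz (?c h1) x - riesz (?c h2) x) + pmean p (riesz r))"
        by (intro Lp_add(2) Lp_diff(1) L trig_poly_spectral_part' p0)
      also have "\<dots> \<le> 2 powr p * (2 powr p * (pmean p (riesz (?c h1)) + pmean p (riesz (?c h2))) + 2 * (2 powr p * d))"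
        by (intro mult_left_mono add_mono Lp_diff(2) L trig_poly_spectral_part' p0 nr) auto
      also have "\<dots> \<le> 2 powr p * (2 powr p * (C0 * pmean p (?c h1) + C0 * pmean p (?c h2)) + 2 * (2 powr p * d))"
        by (intro mult_left_mono add_mono C0(2)[OF h1(1) e h1(2)] C0(2)[OF h2(1) e h2(2)]) auto
      also have "\<dots> \<le> 2 powr p * (2 powr p * (C0 * (2 powr p * (pmean p (?c u) + 3 powr p * d))
          + C0 * (2 powr p * (pmean p (?c u) + 3 powr p * d))) + 2 * (2 powr p * d))"
        by (intro mult_left_mono add_mono n1 n2 C0(1)) auto
      also have "\<dots> = C * pmean p (?c u) + (C * 3 powr p + 2 powr p * (2 * 2 powr p)) * d"
        by (simp add: C_def algebra_simps)
      finally show "pmean p (riesz (?c u)) \<le> C * pmean p (?c u) + (C * 3 powr p + 2 powr p * (2 * 2 powr p)) * d" .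
    qed
  qed
qed

lemma riesz_bounded_le_2:
  assumes p: "1 < p" "p \<le> 2"
  obtains C where "C \<ge> 0" "\<And>f. trig_poly characters f \<Longrightarrow> pmean p (riesz f) \<le> C * pmean p f"
proof -
  have p0: "p > 0" "p \<ge> 0" using p by auto
  obtain C where C: "C \<ge> 0" "\<And>u. trig_poly characters (\<lambda>x. complex_of_real (u x)) \<Longrightarrow>
      pmean p (riesz (\<lambda>x. complex_of_real (u x))) \<le> C * pmean p (\<lambda>x. complex_of_real (u x))"
    using riesz_real_bounded[OF p] by blast
  show thesis
  proof (rule that)
    show "2 powr p * (2 * C) \<ge> 0" using C(1) by simp
    fix f :: "'g \<Rightarrow> complex" assume f: "trig_poly characters f"
    let ?u = "\<lambda>x. complex_of_real (Re (f x))" and ?v = "\<lambda>x. complex_of_real (Im (f x))"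
    have u: "trig_poly characters ?u" and v: "trig_poly characters ?v"
      by (rule trig_poly_Re[OF f], rule trig_poly_Im[OF f])
    have L: "f \<in> Lp p m" if "trig_poly characters f" for f by (rule trig_poly_Lp[OF that p0(1)])
    have f_eq: "f = (\<lambda>x. ?u x + \<i> * ?v x)" by (auto simp: complex_eq_iff)
    have "riesz f x = riesz ?u x + \<i> * riesz ?v x" for x
      by (subst (1) f_eq) (simp add: spectral_part_add[OF u trig_poly_cmult[OF v]] spectral_part_cmult[OF v])
    then have "riesz f = (\<lambda>x. riesz ?u x + \<i> * riesz ?v x)" by blast
    then have "pmean p (riesz f) = pmean p (\<lambda>x. riesz ?u x + \<i> * riesz ?v x)" by simp
    also have "\<dots> \<le> 2 powr p * (pmean p (riesz ?u) + pmean p (\<lambda>x. \<i> * riesz ?v x))"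
      by (intro Lp_add(2) L trig_poly_cmult trig_poly_spectral_part' p0)
    also have "\<dots> = 2 powr p * (pmean p (riesz ?u) + pmean p (riesz ?v))"
      by (simp add: pmean_cmult)
    also have "\<dots> \<le> 2 powr p * (C * pmean p ?u + C * pmean p ?v)"
      by (intro mult_left_mono add_mono C u v) auto
    also have "\<dots> \<le> 2 powr p * (C * pmean p f + C * pmean p f)"
      using abs_Re_le_cmod abs_Im_le_cmod
      by (intro mult_left_mono add_mono C(1) pmean_mono L u v f p0) auto
    finally show "pmean p (riesz f) \<le> 2 powr p * (2 * C) * pmean p f" by (simp add: algebra_simps)
  qed
qed

text \<open>
  Duality: test \<open>w = riesz f\<close> against \<open>g = \<bar>w\<bar>\<^sup>p\<^sup>-\<^sup>2 w\<close>, whose \<open>q\<close>-th power has the same mean as \<open>\<bar>w\<bar>\<^sup>p\<close>.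
  Since \<open>g\<close> is continuous, it may be replaced by a polynomial, and then the projection can be moved
  to the other factor, where the case \<open>q \<le> 2\<close> applies.
\<close>

lemma riesz_bounded_gt_2:
  assumes p: "p > 2"
  obtains C where "C \<ge> 0" "\<And>f. trig_poly characters f \<Longrightarrow> pmean p (riesz f) \<le> C * pmean p f"
proof -
  have p0: "p > 0" using p by simp
  define q where "q = p / (p - 1)"
  have q: "1 < q" "q \<le> 2" using p by (auto simp: q_def field_simps)
  have pq: "1 / p + 1 / q = 1" "(p - 1) * q = p" using p by (auto simp: q_def field_simps)
  obtain D where D: "D \<ge> 0" "\<And>f. trig_poly characters f \<Longrightarrow> pmean q (riesz f) \<le> D * pmean q f"
    using riesz_bounded_le_2[OF q] by blast
  \<comment> \<open>The weight in Young's inequality that leaves half of the left-hand side.\<close>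
  define s where "s = (2 * (D + 1) * 2 powr q) powr (1 / q)"
  have s: "s > 0" using D(1) by (simp add: s_def)
  have s_q: "s powr q = 2 * (D + 1) * 2 powr q" using q D(1) by (simp add: s_def powr_powr)
  have young: "a * b \<le> s powr p * a powr p + b powr q / s powr q" if "a \<ge> 0" "b \<ge> 0" for a b
  proof -
    have "a * b = (s * a) * (b / s)" using s by simp
    also have "\<dots> \<le> (s * a) powr p / p + (b / s) powr q / q"
      using p q pq that s by (intro Youngs_inequality) auto
    also have "\<dots> \<le> (s * a) powr p / 1 + (b / s) powr q / 1"
      using p q by (intro add_mono divide_left_mono) auto
    finally show ?thesis using s that by (simp add: powr_mult powr_divide)
  qed
  show thesis
  proof (rule that)
    show "2 * s powr p \<ge> 0" by simp
    fix f :: "'g \<Rightarrow> complex" assume f: "trig_poly characters f"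
    define w where "w = riesz f"
    define g where "g x = complex_of_real (norm (w x) powr (p - 2)) * w x" for x
    define N where "N = pmean p w"
    define W where "W = (LINT x|m. norm (w x))"
    have w: "trig_poly characters w" unfolding w_def by (rule trig_poly_spectral_part')
    have w_cont: "continuous_on UNIV w" by (rule trig_poly_continuous[OF w]) auto
    have f_cont: "continuous_on UNIV f" by (rule trig_poly_continuous[OF f]) auto
    have "continuous_on UNIV (\<lambda>x. norm (w x) powr (p - 2))"
      using p by (intro continuous_on_powr' continuous_intros w_cont) auto
    then have g_cont: "continuous_on UNIV g"
      unfolding g_def by (intro continuous_on_mult continuous_on_of_real w_cont)
    have norm_g: "norm (g x) = norm (w x) powr (p - 1)" for x
      using powr_add[of "norm (w x)" "p - 2" 1] by (cases "w x = 0") (auto simp: g_def norm_mult)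
    have g_q: "pmean q g = N"
      by (simp add: pmean_def N_def norm_g powr_powr pq)
    have wg: "w x * cnj (g x) = complex_of_real (norm (w x) powr p)" for x
    proof -
      have "w x * cnj (g x) = complex_of_real (norm (w x) powr (p - 2)) * (w x * cnj (w x))"
        by (simp add: g_def)
      also have "\<dots> = complex_of_real (norm (w x) powr (p - 2) * (norm (w x))\<^sup>2)"
        by (simp add: complex_norm_square[symmetric])
      also have "norm (w x) powr (p - 2) * (norm (w x))\<^sup>2 = norm (w x) powr p"
        using powr_add[of "norm (w x)" "p - 2" 2] by (cases "w x = 0") auto
      finally show ?thesis .
    qed
    have "N \<le> 2 * s powr p * pmean p f + (1 + 2 * W) * e" if e: "0 < e" "e \<le> 1" for e
    proof -
      obtain h where h: "trig_poly characters h" "\<And>x. norm (g x - h x) < e"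
        using trig_polys_dense[OF g_cont e(1)] by blast
      have h_cont: "continuous_on UNIV h" by (rule trig_poly_continuous[OF h(1)]) auto
      have rh: "trig_poly characters (riesz h)" by (rule trig_poly_spectral_part')
      have rh_cont: "continuous_on UNIV (riesz h)" by (rule trig_poly_continuous[OF rh]) auto
      have Lq: "h \<in> Lp q m" "g \<in> Lp q m" "(\<lambda>x. h x - g x) \<in> Lp q m" "riesz h \<in> Lp q m" "f \<in> Lp p m"
        using q p0 by (auto intro!: continuous_in_Lp continuous_intros h_cont g_cont rh_cont f_cont)
      have "pmean q (\<lambda>x. h x - g x) \<le> pmean q (\<lambda>_. complex_of_real e)"
      proof (rule pmean_mono)
        show "(\<lambda>_. complex_of_real e) \<in> Lp q m" using q by (intro continuous_in_Lp) auto
        show "norm (h x - g x) \<le> norm (complex_of_real e)" for x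
          using h(2)[of x] e by (simp add: norm_minus_commute)
      qed (use q Lq in auto)
      also have "\<dots> = e powr q" using e by (simp add: pmean_def)
      also have "\<dots> \<le> e" using e q powr_le_one_le[of e q] by simp
      finally have hg: "pmean q (\<lambda>x. h x - g x) \<le> e" .
      have "pmean q h \<le> 2 powr q * (pmean q g + pmean q (\<lambda>x. h x - g x))"
        using Lp_add(2)[OF Lq(2,3)] q by simp
      also have "\<dots> \<le> 2 powr q * (N + e)" using hg g_q by (intro mult_left_mono) auto
      finally have hq: "pmean q h \<le> 2 powr q * (N + e)" .
      have rhq: "pmean q (riesz h) / s powr q \<le> (N + e) / 2"
      proof -
        have "pmean q (riesz h) \<le> D * pmean q h" by (rule D(2)[OF h(1)])
        also have "\<dots> \<le> (D + 1) * (2 powr q * (N + e))"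
          using hq D(1) pmean_nonneg by (intro mult_mono) auto
        also have "\<dots> = s powr q * ((N + e) / 2)" by (simp add: s_q field_simps)
        finally show ?thesis using s by (simp add: pos_divide_le_eq mult.commute)
      qed
      have "complex_of_real N = (LINT x|m. w x * cnj (g x))"
        by (simp add: wg N_def pmean_def)
      also have "\<dots> = (LINT x|m. w x * cnj (h x) + w x * cnj (g x - h x))"
        by (simp add: algebra_simps)
      also have "\<dots> = (LINT x|m. w x * cnj (h x)) + (LINT x|m. w x * cnj (g x - h x))"
        by (intro Bochner_Integration.integral_add continuous_integrable continuous_intros w_cont g_cont h_cont)
      also have "(LINT x|m. w x * cnj (h x)) = (LINT x|m. f x * cnj (riesz h x))"
        unfolding w_def by (rule spectral_part_self_adjoint[OF f h(1)])
      finally have "N \<le> norm ((LINT x|m. f x * cnj (riesz h x)) + (LINT x|m. w x * cnj (g x - h x)))"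
        by (metis abs_ge_self norm_of_real)
      also have "\<dots> \<le> (LINT x|m. norm (f x * cnj (riesz h x))) + (LINT x|m. norm (w x * cnj (g x - h x)))"
        by (intro order_trans[OF norm_triangle_ineq] add_mono integral_norm_bound)
      also have "\<dots> \<le> (LINT x|m. s powr p * norm (f x) powr p + norm (riesz h x) powr q / s powr q) + (LINT x|m. norm (w x) * e)"
      proof (intro add_mono integral_mono)
        show "integrable m (\<lambda>x. s powr p * norm (f x) powr p + norm (riesz h x) powr q / s powr q)"
          using Lq by (intro Bochner_Integration.integrable_add integrable_mult_right integrable_divide) (auto simp: Lp_def)
        show "norm (f x * cnj (riesz h x)) \<le> s powr p * norm (f x) powr p + norm (riesz h x) powr q / s powr q" for x
          unfolding norm_mult complex_mod_cnj by (intro young) auto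
        show "norm (w x * cnj (g x - h x)) \<le> norm (w x) * e" for x
          unfolding norm_mult complex_mod_cnj using h(2)[of x] by (intro mult_left_mono) auto
      qed (intro continuous_integrable continuous_intros f_cont rh_cont w_cont g_cont h_cont)+
      also have "(LINT x|m. s powr p * norm (f x) powr p + norm (riesz h x) powr q / s powr q) =
          s powr p * pmean p f + pmean q (riesz h) / s powr q"
        using Lq by (simp add: Lp_def pmean_def)
      also have "(LINT x|m. norm (w x) * e) = W * e" by (simp add: W_def)
      finally have "N \<le> s powr p * pmean p f + pmean q (riesz h) / s powr q + W * e" .
      then have "N \<le> s powr p * pmean p f + (N + e) / 2 + W * e" using rhq by linarith
      moreover have "N \<le> 2 * X + e + 2 * Y" if "N \<le> X + (N + e) / 2 + Y" for X Y :: real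
        using that by (simp add: field_simps)
      ultimately have "N \<le> 2 * (s powr p * pmean p f) + e + 2 * (W * e)" by blast
      then show ?thesis by (simp add: algebra_simps)
    qed
    then show "pmean p (riesz f) \<le> 2 * s powr p * pmean p f"
      unfolding N_def w_def by (rule le_if_le_add_small)
  qed
qed

theorem riesz_bounded:
  assumes p: "1 < p"
  obtains C where "C \<ge> 0" "\<And>f. trig_poly characters f \<Longrightarrow> pmean p (riesz f) \<le> C * pmean p f"
proof (cases "p \<le> 2")
  case True
  show thesis by (rule riesz_bounded_le_2[OF p True that])
next
  case False
  then show thesis using riesz_bounded_gt_2 that by (metis not_le)
qed

end

section \<open>Approximation within the spectrum\<close>

lemma powr_tangent_le:
  fixes a t p :: real
  assumes p: "1 < p" and a: "a \<ge> 0" and t: "t \<ge> 0"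
  shows "a powr p + p * a powr (p - 1) * (t - a) \<le> t powr p"
proof -
  define q where "q = p / (p - 1)"
  have q: "q > 1" "1 / p + 1 / q = 1" "(p - 1) * q = p" "p / q = p - 1"
    using p by (auto simp: q_def field_simps)
  have "t * a powr (p - 1) \<le> t powr p / p + (a powr (p - 1)) powr q / q"
    using p q a t by (intro Youngs_inequality) auto
  also have "(a powr (p - 1)) powr q = a powr p" by (simp add: powr_powr q)
  finally have "p * (t * a powr (p - 1)) \<le> p * (t powr p / p + a powr p / q)"
    using p by (intro mult_left_mono) auto
  also have "\<dots> = t powr p + (p / q) * a powr p" using p by (simp add: algebra_simps)
  finally have *: "p * (t * a powr (p - 1)) \<le> t powr p + (p - 1) * a powr p" by (simp add: q)
  have "a powr (p - 1) * a = a powr p"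
    using powr_add[of a "p - 1" 1] a by (cases "a = 0") auto
  then have "a powr p + p * a powr (p - 1) * (t - a) = p * (t * a powr (p - 1)) - (p - 1) * a powr p"
    by (simp add: algebra_simps)
  then show ?thesis using * by linarith
qed

context haar_on_dirichlet_group
begin

lemma outer_regular:
  assumes A: "A \<in> sets borel" and e: "e > 0"
  obtains U where "open U" "A \<subseteq> U" "measure m U < measure m A + e"
proof -
  have "emeasure m A = (INF U\<in>{U. A \<subseteq> U \<and> open U}. emeasure m U)"
    using haar A unfolding normalized_haar_def by blast
  moreover have "emeasure m A < emeasure m A + ennreal e"
    using e by (simp add: emeasure_eq_measure ennreal_plus[symmetric] ennreal_less_iff del: ennreal_plus)
  ultimately have "(INF U\<in>{U. A \<subseteq> U \<and> open U}. emeasure m U) < emeasure m A + ennreal e"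
    by simp
  then obtain U where U: "A \<subseteq> U" "open U" "emeasure m U < emeasure m A + ennreal e"
    unfolding INF_less_iff by blast
  from U(3) have "measure m U < measure m A + e"
    using e by (simp add: emeasure_eq_measure ennreal_plus[symmetric] ennreal_less_iff del: ennreal_plus)
  with U(1,2) show thesis by (intro that)
qed

lemma inner_regular:
  assumes A: "A \<in> sets borel" and e: "e > 0"
  obtains K where "compact K" "K \<subseteq> A" "measure m A < measure m K + e"
proof (cases "measure m A < e")
  case True
  then show thesis using that[of "{}"] by simp
next
  case False
  have "emeasure m A = (SUP K\<in>{K. K \<subseteq> A \<and> compact K}. emeasure m K)"
    using haar A unfolding normalized_haar_def by blast
  moreover have "ennreal (measure m A - e) < emeasure m A"
    using e False by (simp add: emeasure_eq_measure ennreal_less_iff)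
  ultimately have "ennreal (measure m A - e) < (SUP K\<in>{K. K \<subseteq> A \<and> compact K}. emeasure m K)"
    by simp
  then obtain K where K: "K \<subseteq> A" "compact K" "ennreal (measure m A - e) < emeasure m K"
    unfolding less_SUP_iff by blast
  from K(3) have "measure m A < measure m K + e"
    using False by (simp add: emeasure_eq_measure ennreal_less_iff)
  with K(1,2) show thesis by (intro that)
qed

definition approximable :: "real \<Rightarrow> ('g \<Rightarrow> complex) \<Rightarrow> bool" where
  "approximable p f \<longleftrightarrow> f \<in> Lp p m \<and>
     (\<forall>e>0. \<exists>g. continuous_on UNIV g \<and> pmean p (\<lambda>x. f x - g x) < e)"

text \<open>
  Regularity of the measure and Urysohn's lemma.
\<close>

lemma approximable_indicator:
  assumes p: "p > 0" and A: "A \<in> sets borel"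
  shows "approximable p (\<lambda>x. complex_of_real (indicator A x))"
  unfolding approximable_def
proof (intro conjI allI impI)
  have A': "A \<in> sets m" using A by simp
  have fin: "integrable m (indicator B :: 'g \<Rightarrow> real)" if "B \<in> sets m" for B
    using that by (intro integrable_real_indicator) (auto simp: less_top[symmetric])
  have "norm (complex_of_real (indicator A x)) powr p = indicator A x" for x
    using p by (auto simp: indicator_def)
  then show L: "(\<lambda>x. complex_of_real (indicator A x)) \<in> Lp p m"
    using A' fin[OF A'] by (auto simp: Lp_def)
  fix e :: real assume e: "e > 0"
  obtain U where U: "open U" "A \<subseteq> U" "measure m U < measure m A + e / 2"
    by (rule outer_regular[OF A half_gt_zero[OF e]])
  obtain K where K: "compact K" "K \<subseteq> A" "measure m A < measure m K + e / 2"
    by (rule inner_regular[OF A half_gt_zero[OF e]])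
  have K_closed: "closed K" using K(1) by (rule compact_imp_closed)
  obtain g :: "'g \<Rightarrow> real" where g: "continuous_on UNIV g" "\<And>x. 0 \<le> g x \<and> g x \<le> 1"
    "\<And>x. x \<in> - U \<Longrightarrow> g x = 0" "\<And>x. x \<in> K \<Longrightarrow> g x = 1"
  proof (rule Urysohn_compact[OF compact_UNIV])
    show "closed (- U)" using U(1) by (rule closed_Compl)
    show "- U \<inter> K = {}" using U(2) K(2) by blast
  qed (use K_closed in auto)
  have cont: "continuous_on UNIV (\<lambda>x. complex_of_real (g x))" by (intro continuous_intros g(1))
  have UK: "U - K \<in> sets m" using U(1) K_closed by auto
  have "pmean p (\<lambda>x. complex_of_real (indicator A x) - complex_of_real (g x)) \<le> (LINT x|m. indicator (U - K) x)"
    unfolding pmean_def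
  proof (intro integral_mono)
    show "integrable m (\<lambda>x. norm (complex_of_real (indicator A x) - complex_of_real (g x)) powr p)"
      using Lp_diff(1)[OF L continuous_in_Lp[OF cont p] p] by (simp add: Lp_def)
    show "integrable m (indicator (U - K) :: 'g \<Rightarrow> real)" by (rule fin[OF UK])
    show "norm (complex_of_real (indicator A x) - complex_of_real (g x)) powr p \<le> indicator (U - K) x" for x
    proof (cases "x \<in> U - K")
      case True
      have "\<bar>indicator A x - g x\<bar> \<le> 1" using g(2)[of x] by (auto simp: indicator_def)
      then have "\<bar>indicator A x - g x\<bar> powr p \<le> 1 powr p" using p by (intro powr_mono2) auto
      then show ?thesis using True by (simp flip: of_real_diff)
    next
      case False
      then have "indicator A x = g x" using g(3,4)[of x] U(2) K(2) by (auto simp: indicator_def)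
      then show ?thesis by simp
    qed
  qed
  also have "\<dots> = measure m (U - K)" by (simp add: UK)
  also have "\<dots> = measure m U - measure m K"
    using U K K_closed by (intro finite_measure_Diff) auto
  also have "\<dots> < e" using U(3) K(3) by linarith
  finally show "\<exists>g. continuous_on UNIV g \<and> pmean p (\<lambda>x. complex_of_real (indicator A x) - g x) < e"
    using cont by blast
qed

lemma approximable_add:
  assumes p: "p > 0" and f: "approximable p f" and g: "approximable p g"
  shows "approximable p (\<lambda>x. f x + g x)"
  unfolding approximable_def
proof (intro conjI allI impI)
  have L: "f \<in> Lp p m" "g \<in> Lp p m" using f g by (auto simp: approximable_def)
  show "(\<lambda>x. f x + g x) \<in> Lp p m" by (rule Lp_add(1)[OF L p])
  fix e :: real assume e: "e > 0"
  define d where "d = e / (2 powr p * 2)"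
  have d: "d > 0" using e by (simp add: d_def)
  obtain a where a: "continuous_on UNIV a" "pmean p (\<lambda>x. f x - a x) < d"
    using f d by (auto simp: approximable_def)
  obtain b where b: "continuous_on UNIV b" "pmean p (\<lambda>x. g x - b x) < d"
    using g d by (auto simp: approximable_def)
  have "pmean p (\<lambda>x. (f x - a x) + (g x - b x)) \<le> 2 powr p * (pmean p (\<lambda>x. f x - a x) + pmean p (\<lambda>x. g x - b x))"
    by (intro Lp_add(2) Lp_diff(1) L continuous_in_Lp a b p)
  also have "\<dots> < 2 powr p * (d + d)" using a b by (intro mult_strict_left_mono add_strict_mono) auto
  also have "\<dots> = e" by (simp add: d_def)
  finally have "pmean p (\<lambda>x. (f x + g x) - (a x + b x)) < e" by (simp add: algebra_simps)
  moreover have "continuous_on UNIV (\<lambda>x. a x + b x)" by (intro continuous_intros a b)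
  ultimately show "\<exists>h. continuous_on UNIV h \<and> pmean p (\<lambda>x. f x + g x - h x) < e"
    by (intro exI[of _ "\<lambda>x. a x + b x"]) auto
qed

lemma approximable_cmult:
  assumes f: "approximable p f"
  shows "approximable p (\<lambda>x. c * f x)"
  unfolding approximable_def
proof (intro conjI allI impI)
  show "(\<lambda>x. c * f x) \<in> Lp p m" using f by (intro Lp_cmult) (auto simp: approximable_def)
  fix e :: real assume e: "e > 0"
  define k where "k = norm c powr p + 1"
  have k: "k > 0" unfolding k_def by (rule add_nonneg_pos) auto
  have "e / k > 0" using e k by simp
  then obtain a where a: "continuous_on UNIV a" "pmean p (\<lambda>x. f x - a x) < e / k"
    using f unfolding approximable_def by blast
  have "pmean p (\<lambda>x. c * (f x - a x)) \<le> k * pmean p (\<lambda>x. f x - a x)"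
    unfolding pmean_cmult k_def by (intro mult_right_mono pmean_nonneg) auto
  also have "\<dots> < k * (e / k)" using a k by (intro mult_strict_left_mono) auto
  finally have "pmean p (\<lambda>x. c * f x - c * a x) < e" using k by (simp add: right_diff_distrib)
  moreover have "continuous_on UNIV (\<lambda>x. c * a x)" by (intro continuous_intros a)
  ultimately show "\<exists>h. continuous_on UNIV h \<and> pmean p (\<lambda>x. c * f x - h x) < e"
    by (intro exI[of _ "\<lambda>x. c * a x"]) auto
qed

lemma approximable_simple_function:
  assumes p: "p > 0" and s: "simple_function m s"
  shows "approximable p s"
proof -
  have fin: "finite (range s)" using simple_functionD(1)[OF s] by simp
  have sets: "s -` {y} \<in> sets borel" for y using simple_functionD(2)[OF s, of "{y}"] by simp
  have "approximable p (\<lambda>x. \<Sum>y\<in>I. y * complex_of_real (indicator (s -` {y}) x))" if "finite I" for I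
    using that
  proof (induction I)
    case empty
    have "continuous_on UNIV (\<lambda>_::'g. 0 :: complex)" by simp
    moreover from this have "(\<lambda>_::'g. 0 :: complex) \<in> Lp p m" using p by (rule continuous_in_Lp)
    ultimately show ?case
      using p by (auto simp: approximable_def pmean_def intro!: exI[of _ "\<lambda>_. 0"])
  next
    case (insert y I)
    then show ?case
      using approximable_add[OF p approximable_cmult[OF approximable_indicator[OF p sets[of y]], of y] insert.IH]
      by simp
  qed
  from this[OF fin] have "approximable p (\<lambda>x. \<Sum>y\<in>range s. y * complex_of_real (indicator (s -` {y}) x))" .
  moreover have "s x = (\<Sum>y\<in>range s. y * complex_of_real (indicator (s -` {y}) x))" for x
  proof -
    have "(\<Sum>y\<in>range s. y * complex_of_real (indicator (s -` {y}) x)) = (\<Sum>y\<in>range s. if s x = y then y else 0)"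
      by (intro sum.cong refl) (auto simp: indicator_def)
    then show ?thesis using fin by simp
  qed
  ultimately show ?thesis by (metis (no_types, lifting) ext)
qed

lemma approximable_Lp:
  assumes p: "p > 0" and f: "f \<in> Lp p m"
  shows "approximable p f"
  unfolding approximable_def
proof (intro conjI allI impI f)
  fix e :: real assume e: "e > 0"
  have f_meas [measurable]: "f \<in> borel_measurable m"
    and f_int: "integrable m (\<lambda>x. norm (f x) powr p)"
    using f by (auto simp: Lp_def)
  obtain s where s: "\<And>i. simple_function m (s i)" "\<And>x. (\<lambda>i. s i x) \<longlonglongrightarrow> f x"
    "\<And>i x. dist (s i x) 0 \<le> 2 * dist (f x) 0"
    using borel_measurable_implies_sequence_metric[OF f_meas, of 0] by auto
  have s_meas [measurable]: "s i \<in> borel_measurable m" for i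
    using s(1) by (rule borel_measurable_simple_function)
  have bound: "norm (f x - s i x) powr p \<le> 3 powr p * norm (f x) powr p" for i x
  proof -
    have "norm (f x - s i x) \<le> 3 * norm (f x)"
      using norm_triangle_ineq4[of "f x" "s i x"] s(3)[of i x] by simp
    then have "norm (f x - s i x) powr p \<le> (3 * norm (f x)) powr p"
      using p by (intro powr_mono2) auto
    then show ?thesis by (simp add: powr_mult)
  qed
  have "(\<lambda>i. LINT x|m. norm (f x - s i x) powr p) \<longlonglongrightarrow> (LINT x|m. 0)"
  proof (rule integral_dominated_convergence[where w = "\<lambda>x. 3 powr p * norm (f x) powr p"])
    show "AE x in m. (\<lambda>i. norm (f x - s i x) powr p) \<longlonglongrightarrow> 0"
    proof (rule AE_I2)
      fix x
      have "(\<lambda>i. f x - s i x) \<longlonglongrightarrow> f x - f x" by (intro tendsto_intros s(2))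
      then have "(\<lambda>i. norm (f x - s i x)) \<longlonglongrightarrow> 0" by (simp add: tendsto_norm_zero)
      then show "(\<lambda>i. norm (f x - s i x) powr p) \<longlonglongrightarrow> 0"
        using p by (intro tendsto_zero_powrI[OF _ tendsto_const]) auto
    qed
  qed (use f_int bound in auto)
  then have "(\<lambda>i. pmean p (\<lambda>x. f x - s i x)) \<longlonglongrightarrow> 0" by (simp add: pmean_def)
  define d where "d = e / (2 powr p * 2)"
  have d: "d > 0" using e by (simp add: d_def)
  with \<open>(\<lambda>i. pmean p (\<lambda>x. f x - s i x)) \<longlonglongrightarrow> 0\<close>
  have "eventually (\<lambda>i. pmean p (\<lambda>x. f x - s i x) < d) sequentially"
    by (rule order_tendstoD(2))
  then obtain i where i: "pmean p (\<lambda>x. f x - s i x) < d"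
    using eventually_happens'[OF sequentially_bot] by blast
  have si: "approximable p (s i)" by (rule approximable_simple_function[OF p s(1)])
  then obtain g where g: "continuous_on UNIV g" "pmean p (\<lambda>x. s i x - g x) < d"
    using d by (auto simp: approximable_def)
  have siL: "s i \<in> Lp p m" using si by (simp add: approximable_def)
  have "pmean p (\<lambda>x. (f x - s i x) + (s i x - g x)) \<le> 2 powr p * (pmean p (\<lambda>x. f x - s i x) + pmean p (\<lambda>x. s i x - g x))"
    by (intro Lp_add(2) Lp_diff(1) f siL continuous_in_Lp g p)
  also have "\<dots> < 2 powr p * (d + d)" using i g by (intro mult_strict_left_mono add_strict_mono) auto
  also have "\<dots> = e" by (simp add: d_def)
  finally show "\<exists>g. continuous_on UNIV g \<and> pmean p (\<lambda>x. f x - g x) < e" using g(1) by auto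
qed

lemma trig_polys_dense_Lp:
  assumes p: "p > 0" and f: "f \<in> Lp p m" and e: "e > 0"
  obtains Q where "trig_poly characters Q" "pmean p (\<lambda>x. f x - Q x) < e"
proof -
  define d where "d = e / (2 powr p * 2)"
  have d: "d > 0" using e by (simp add: d_def)
  obtain g where g: "continuous_on UNIV g" "pmean p (\<lambda>x. f x - g x) < d"
    using approximable_Lp[OF p f] d by (auto simp: approximable_def)
  have d': "d powr (1 / p) > 0" using d by simp
  obtain Q where Q: "trig_poly characters Q" "\<And>x. norm (g x - Q x) < d powr (1 / p)"
    using trig_polys_dense[OF g(1) d'] by blast
  have QL: "Q \<in> Lp p m" by (rule trig_poly_Lp[OF Q(1) p])
  have gL: "g \<in> Lp p m" by (rule continuous_in_Lp[OF g(1) p])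
  have "pmean p (\<lambda>x. g x - Q x) \<le> pmean p (\<lambda>_. complex_of_real (d powr (1 / p)))"
    using p Q(2) by (intro pmean_mono Lp_diff(1) gL QL continuous_in_Lp) (auto intro: less_imp_le)
  also have "\<dots> = d" using d p by (simp add: pmean_def powr_powr)
  finally have gQ: "pmean p (\<lambda>x. g x - Q x) \<le> d" .
  have "pmean p (\<lambda>x. (f x - g x) + (g x - Q x)) \<le> 2 powr p * (pmean p (\<lambda>x. f x - g x) + pmean p (\<lambda>x. g x - Q x))"
    by (intro Lp_add(2) Lp_diff(1) f gL QL p)
  also have "\<dots> < 2 powr p * (d + d)" using g gQ by (intro mult_strict_left_mono add_less_le_mono) auto
  also have "\<dots> = e" by (simp add: d_def)
  finally show thesis using that[OF Q(1)] by simp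
qed

text \<open>
  The product \<open>\<psi>\<close> of tent functions is non-negative, not identically zero, and vanishes wherever some
  \<open>\<gamma>\<close> in \<open>S\<close> is not close to \<open>1\<close>. A polynomial close to \<open>\<psi>\<close> from above, divided by its mean, has
  almost the same properties.
\<close>

lemma positive_trig_poly_kernel:
  assumes S: "finite S" "S \<subseteq> characters" and e: "e > 0"
  obtains K where "trig_poly characters (\<lambda>x. complex_of_real (K x))" "\<And>x. K x \<ge> 0"
    "(LINT x|m. K x) = 1"
    "\<And>\<gamma>. \<gamma> \<in> S \<Longrightarrow> norm (coeff (\<lambda>x. complex_of_real (K x)) \<gamma> - 1) \<le> e"
proof -
  define d where "d = e / 2"
  have d: "d > 0" using e by (simp add: d_def)
  define \<psi> where "\<psi> x = (\<Prod>\<gamma>\<in>S. max 0 (1 - norm (cnj (\<gamma> x) - 1) / d))" for x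
  have \<gamma>_cont: "continuous_on UNIV \<gamma>" if "\<gamma> \<in> S" for \<gamma>
    using S(2) that characterD(1) by auto
  have \<psi>_cont: "continuous_on UNIV \<psi>"
    unfolding \<psi>_def using d by (intro continuous_intros \<gamma>_cont) auto
  have \<psi>_nonneg: "\<psi> x \<ge> 0" for x unfolding \<psi>_def by (intro prod_nonneg) auto
  have "\<psi> 0 = 1"
    unfolding \<psi>_def
  proof (intro prod.neutral ballI)
    fix \<gamma> assume "\<gamma> \<in> S"
    then have "\<gamma> 0 = 1" using S(2) by (intro characterD(5)) auto
    then show "max 0 (1 - norm (cnj (\<gamma> 0) - 1) / d) = 1" by simp
  qed
  then have I: "(LINT x|m. \<psi> x) > 0"
    by (intro continuous_integral_pos[of _ 0] \<psi>_cont \<psi>_nonneg) simp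
  have \<psi>_near: "\<psi> x * norm (cnj (\<gamma> x) - 1) \<le> d * \<psi> x" if "\<gamma> \<in> S" for \<gamma> x
  proof (cases "norm (cnj (\<gamma> x) - 1) \<le> d")
    case True
    then show ?thesis using mult_left_mono[OF True \<psi>_nonneg[of x]] by (simp add: mult.commute)
  next
    case False
    then have "max 0 (1 - norm (cnj (\<gamma> x) - 1) / d) = 0" using d by simp
    then have "\<psi> x = 0" unfolding \<psi>_def using S(1) that by (intro prod_zero) auto
    then show ?thesis by simp
  qed
  define \<eta> where "\<eta> = d * (LINT x|m. \<psi> x) / 4"
  have \<eta>: "\<eta> > 0" using d I by (simp add: \<eta>_def)
  have \<psi>\<eta>_cont: "continuous_on UNIV (\<lambda>x. \<psi> x + \<eta>)" by (intro continuous_intros \<psi>_cont)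
  obtain k where k: "trig_poly characters (\<lambda>x. complex_of_real (k x))" "\<And>x. \<bar>\<psi> x + \<eta> - k x\<bar> < \<eta>"
    using trig_polys_dense_real[OF \<psi>\<eta>_cont \<eta>] by blast
  have k_ge: "\<psi> x \<le> k x" and k_le: "k x \<le> \<psi> x + 2 * \<eta>" for x
    using k(2)[of x] by linarith+
  have "continuous_on UNIV (\<lambda>x. complex_of_real (k x))" by (rule trig_poly_continuous[OF k(1)]) auto
  from continuous_on_Re[OF this] have k_cont: "continuous_on UNIV k" by simp
  define c where "c = (LINT x|m. k x)"
  have c_ge: "c \<ge> (LINT x|m. \<psi> x)"
    unfolding c_def by (intro integral_mono continuous_integrable \<psi>_cont k_cont k_ge)
  then have c: "c > 0" using I by linarith
  define K where "K x = k x / c" for x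
  have K_cont: "continuous_on UNIV K" unfolding K_def using c by (intro continuous_intros k_cont) auto
  have K_nonneg: "K x \<ge> 0" for x using k_ge[of x] \<psi>_nonneg[of x] c by (simp add: K_def)
  show thesis
  proof (rule that[OF _ K_nonneg])
    show "trig_poly characters (\<lambda>x. complex_of_real (K x))"
      using trig_poly_cmult[OF k(1), of "complex_of_real (1 / c)"] by (simp add: K_def)
    show K_int: "(LINT x|m. K x) = 1" using c by (simp add: K_def c_def)
    fix \<gamma> assume \<gamma>S: "\<gamma> \<in> S"
    note cont = K_cont \<gamma>_cont[OF \<gamma>S]
    have le: "K x * norm (cnj (\<gamma> x) - 1) \<le> d * K x + 4 * \<eta> / c" for x
    proof -
      have "norm (cnj (\<gamma> x) - 1) \<le> 2"
        using norm_triangle_ineq4[of "cnj (\<gamma> x)" 1] \<gamma>S S(2) characterD(3)[of \<gamma> x] by auto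
      then have "(\<psi> x + 2 * \<eta>) * norm (cnj (\<gamma> x) - 1) \<le> d * \<psi> x + 2 * \<eta> * 2"
        unfolding distrib_right using \<psi>_near[OF \<gamma>S, of x] \<eta>
        by (intro add_mono mult_left_mono) auto
      then have "k x * norm (cnj (\<gamma> x) - 1) \<le> d * \<psi> x + 4 * \<eta>"
        using mult_right_mono[OF k_le[of x], of "norm (cnj (\<gamma> x) - 1)"] by simp
      also have "\<dots> \<le> d * k x + 4 * \<eta>" using d k_ge by (intro add_right_mono mult_left_mono) auto
      finally show ?thesis using c by (simp add: K_def field_simps)
    qed
    have "coeff (\<lambda>x. complex_of_real (K x)) \<gamma> - 1 =
        (LINT x|m. complex_of_real (K x) * cnj (\<gamma> x)) - (LINT x|m. complex_of_real (K x))"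
      by (simp add: fourier_coeff_def K_int)
    also have "\<dots> = (LINT x|m. complex_of_real (K x) * cnj (\<gamma> x) - complex_of_real (K x))"
      by (intro Bochner_Integration.integral_diff[symmetric] continuous_integrable continuous_intros cont)
    also have "norm \<dots> \<le> (LINT x|m. norm (complex_of_real (K x) * cnj (\<gamma> x) - complex_of_real (K x)))"
      by (rule integral_norm_bound)
    also have "\<dots> \<le> (LINT x|m. d * K x + 4 * \<eta> / c)"
    proof (intro integral_mono continuous_integrable continuous_intros cont)
      fix x
      have "complex_of_real (K x) * cnj (\<gamma> x) - complex_of_real (K x) = complex_of_real (K x) * (cnj (\<gamma> x) - 1)"
        by (simp add: algebra_simps)
      then show "norm (complex_of_real (K x) * cnj (\<gamma> x) - complex_of_real (K x)) \<le> d * K x + 4 * \<eta> / c"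
        using le[of x] K_nonneg[of x] by (simp add: norm_mult)
    qed
    also have "\<dots> = d + 4 * \<eta> / c" using continuous_integrable[OF K_cont] K_int by simp
    also have "4 * \<eta> / c \<le> d" using c c_ge d by (simp add: \<eta>_def field_simps)
    finally show "norm (coeff (\<lambda>x. complex_of_real (K x)) \<gamma> - 1) \<le> e" by (simp add: d_def)
  qed
qed

definition convolution :: "('g \<Rightarrow> complex) \<Rightarrow> ('g \<Rightarrow> complex) \<Rightarrow> 'g \<Rightarrow> complex" where
  "convolution k f x = (\<Sum>\<gamma>\<in>spectrum k. coeff k \<gamma> * coeff f \<gamma> * \<gamma> x)"

lemma convolution_eq_integral:
  assumes k: "trig_poly characters k" and f: "integrable m f"
  shows "convolution k f x = (LINT y|m. f y * k (x - y))"
proof -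
  have "k (x - y) = (\<Sum>\<gamma>\<in>spectrum k. coeff k \<gamma> * \<gamma> x * cnj (\<gamma> y))" for y
  proof -
    have "k (x - y) = (\<Sum>\<gamma>\<in>spectrum k. coeff k \<gamma> * \<gamma> (x - y))"
      by (rule trig_poly_eq[OF k order_refl finite_spectrum'[OF k] order_refl spectrum_characters])
    also have "\<dots> = (\<Sum>\<gamma>\<in>spectrum k. coeff k \<gamma> * \<gamma> x * cnj (\<gamma> y))"
    proof (intro sum.cong refl)
      fix \<gamma> assume "\<gamma> \<in> spectrum k"
      then have \<gamma>: "character \<gamma>" by (simp add: spectrum_def)
      have "\<gamma> (x - y) = \<gamma> x * cnj (\<gamma> y)"
        using characterD(2)[OF \<gamma>, of x "- y"] characterD(6)[OF \<gamma>, of y] by simp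
      then show "coeff k \<gamma> * \<gamma> (x - y) = coeff k \<gamma> * \<gamma> x * cnj (\<gamma> y)" by simp
    qed
    finally show ?thesis .
  qed
  then have "(LINT y|m. f y * k (x - y)) =
      (LINT y|m. (\<Sum>\<gamma>\<in>spectrum k. (coeff k \<gamma> * \<gamma> x) * (f y * cnj (\<gamma> y))))"
    by (simp add: sum_distrib_left mult_ac)
  also have "\<dots> = (\<Sum>\<gamma>\<in>spectrum k. (LINT y|m. (coeff k \<gamma> * \<gamma> x) * (f y * cnj (\<gamma> y))))"
    by (intro Bochner_Integration.integral_sum integrable_mult_right integrable_times_cnj_character f)
       (simp add: spectrum_def)
  also have "\<dots> = (\<Sum>\<gamma>\<in>spectrum k. (coeff k \<gamma> * \<gamma> x) * coeff f \<gamma>)"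
    unfolding fourier_coeff_def[of m f] by (simp only: integral_mult_right_zero)
  also have "\<dots> = convolution k f x"
    by (simp add: convolution_def mult_ac)
  finally show ?thesis by simp
qed

lemma trig_poly_convolution: "trig_poly (spectrum f) (convolution k f)"
  unfolding convolution_def[abs_def]
proof (intro trig_poly_sum)
  fix \<gamma> assume "\<gamma> \<in> spectrum k"
  then show "trig_poly (spectrum f) (\<lambda>x. coeff k \<gamma> * coeff f \<gamma> * \<gamma> x)"
    by (cases "coeff f \<gamma> = 0") (auto intro: trig_poly.intros simp: spectrum_def)
qed

lemma trig_poly_convolution': "trig_poly characters (convolution k f)"
  by (rule trig_poly_mono[OF trig_poly_convolution spectrum_characters])

text \<open>
  Jensen's inequality for the probability densities \<open>y \<mapsto> K (x - y)\<close>. Since \<open>K\<close> is a trigonometric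
  polynomial, interchanging the two integrations only involves finite sums.
\<close>

lemma pmean_convolution_le:
  assumes p: "1 < p" and f: "f \<in> Lp p m"
    and k: "trig_poly characters (\<lambda>x. complex_of_real (K x))" and K: "\<And>x. K x \<ge> 0" "(LINT x|m. K x) = 1"
  shows "pmean p (convolution (\<lambda>x. complex_of_real (K x)) f) \<le> pmean p f"
proof -
  define k where "k = (\<lambda>x. complex_of_real (K x))"
  have k: "trig_poly characters k" using assms(3) by (simp add: k_def)
  have k_cont: "continuous_on UNIV k" by (rule trig_poly_continuous[OF k]) auto
  from continuous_on_Re[OF this] have K_cont: "continuous_on UNIV K" by (simp add: k_def)
  obtain M where M: "\<And>x. \<bar>K x\<bar> \<le> M" using continuous_bounded[OF K_cont] by (metis real_norm_def)
  have p1: "p \<ge> 1" "p > 0" using p by auto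
  have fp: "integrable m (\<lambda>x. norm (f x) powr p)"
    using f by (auto simp: Lp_def)
  have f_int: "integrable m f" by (rule Lp_integrable[OF f p1(1)])
  have K_meas: "(\<lambda>y. K (x - y)) \<in> borel_measurable m" for x
    by (intro continuous_measurable continuous_on_compose2[OF K_cont] continuous_intros) auto
  have weight: "integrable m (\<lambda>y. g y * K (x - y))" if g: "integrable m g" for g :: "'g \<Rightarrow> real" and x
  proof (rule Bochner_Integration.integrable_bound)
    show "integrable m (\<lambda>y. M * g y)" using g by (rule integrable_mult_right)
    show "(\<lambda>y. g y * K (x - y)) \<in> borel_measurable m"
      using K_meas g by (intro borel_measurable_times) auto
    have "norm (g y * K (x - y)) \<le> norm (M * g y)" for y
    proof -
      have "\<bar>g y\<bar> * \<bar>K (x - y)\<bar> \<le> \<bar>g y\<bar> * \<bar>M\<bar>"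
        using M[of "x - y"] by (intro mult_left_mono) auto
      then show ?thesis by (simp add: abs_mult mult.commute)
    qed
    then show "AE y in m. norm (g y * K (x - y)) \<le> norm (M * g y)" by simp
  qed
  have real_conv: "convolution k (\<lambda>y. complex_of_real (g y)) x = complex_of_real (LINT y|m. g y * K (x - y))"
    if g: "integrable m g" for g x
  proof -
    have "convolution k (\<lambda>y. complex_of_real (g y)) x = (LINT y|m. complex_of_real (g y * K (x - y)))"
      using convolution_eq_integral[OF k, of "\<lambda>y. complex_of_real (g y)" x] g by (simp add: k_def)
    then show ?thesis by (simp only: integral_complex_of_real)
  qed
  have coeff_k_1: "coeff k (\<lambda>_. 1) = 1"
    by (simp add: fourier_coeff_def k_def K(2))
  have conv_mean: "(LINT x|m. convolution k g x) = (LINT x|m. g x)" for g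
  proof -
    have "(LINT x|m. convolution k g x) = coeff (convolution k g) (\<lambda>_. 1)"
      by (simp add: fourier_coeff_def)
    also have "\<dots> = (if (\<lambda>_. 1) \<in> spectrum k then coeff k (\<lambda>_. 1) * coeff g (\<lambda>_. 1) else 0)"
      unfolding convolution_def[abs_def]
      by (rule fourier_coeff_sum_characters[OF finite_spectrum'[OF k] spectrum_characters character_one])
    also have "\<dots> = (LINT x|m. g x)"
      using coeff_k_1 character_one[where ?'a = 'g] by (simp add: spectrum_def fourier_coeff_def[of m g])
    finally show ?thesis .
  qed
  have weight_one: "(LINT y|m. K (x - y)) = 1" for x
  proof -
    have "convolution k (\<lambda>_. 1) x = (\<Sum>\<gamma>\<in>spectrum k. if \<gamma> = (\<lambda>_. 1) then 1 else 0)"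
      unfolding convolution_def
    proof (intro sum.cong refl)
      fix \<gamma> assume "\<gamma> \<in> spectrum k"
      then have "character \<gamma>" by (simp add: spectrum_def)
      then show "coeff k \<gamma> * coeff (\<lambda>_. 1) \<gamma> * \<gamma> x = (if \<gamma> = (\<lambda>_. 1) then 1 else 0)"
        using fourier_coeff_character[OF character_one, of \<gamma>] coeff_k_1 by auto
    qed
    also have "\<dots> = 1"
      using finite_spectrum'[OF k] coeff_k_1 character_one by (simp add: spectrum_def)
    finally have "complex_of_real (LINT y|m. 1 * K (x - y)) = 1"
      using real_conv[of "\<lambda>_. 1" x] by simp
    then show ?thesis by simp
  qed
  define b where "b x = (LINT y|m. norm (f y) powr p * K (x - y))" for x
  have b: "complex_of_real (b x) = convolution k (\<lambda>y. complex_of_real (norm (f y) powr p)) x" for x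
    unfolding b_def using real_conv[OF fp] by simp
  have jensen: "norm (convolution k f x) powr p \<le> b x" for x
  proof -
    define a where "a = (LINT y|m. norm (f y) * K (x - y))"
    have a0: "a \<ge> 0" unfolding a_def using K(1) by simp
    have fK: "integrable m (\<lambda>y. norm (f y) * K (x - y))" by (intro weight integrable_norm f_int)
    have K1: "integrable m (\<lambda>y. K (x - y))" using weight[of "\<lambda>_. 1" x] by simp
    have "norm (convolution k f x) \<le> (LINT y|m. norm (f y * k (x - y)))"
      unfolding convolution_eq_integral[OF k f_int] by (rule integral_norm_bound)
    also have "\<dots> = a" using K(1) by (simp add: a_def k_def norm_mult)
    finally have "norm (convolution k f x) powr p \<le> a powr p" using p1 by (intro powr_mono2) auto
    also have "a powr p = (LINT y|m. a powr p * K (x - y) + p * a powr (p - 1) * (norm (f y) * K (x - y) - a * K (x - y)))"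
      using fK K1 weight_one[of x] by (simp add: a_def[symmetric])
    also have "\<dots> \<le> b x"
      unfolding b_def
    proof (intro integral_mono)
      show "integrable m (\<lambda>y. a powr p * K (x - y) + p * a powr (p - 1) * (norm (f y) * K (x - y) - a * K (x - y)))"
        by (intro Bochner_Integration.integrable_add Bochner_Integration.integrable_diff integrable_mult_right fK K1)
      show "integrable m (\<lambda>y. norm (f y) powr p * K (x - y))" by (rule weight[OF fp])
      fix y
      have "(a powr p + p * a powr (p - 1) * (norm (f y) - a)) * K (x - y) \<le> norm (f y) powr p * K (x - y)"
        using p a0 K(1) by (intro mult_right_mono powr_tangent_le) auto
      then show "a powr p * K (x - y) + p * a powr (p - 1) * (norm (f y) * K (x - y) - a * K (x - y)) \<le>
          norm (f y) powr p * K (x - y)"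
        by (simp add: algebra_simps)
    qed
    finally show ?thesis .
  qed
  have conv_b: "integrable m (convolution k (\<lambda>y. complex_of_real (norm (f y) powr p)))"
    by (rule trig_poly_integrable[OF trig_poly_convolution'])
  then have "integrable m (\<lambda>x. complex_of_real (b x))" by (simp add: b)
  then have b_int: "integrable m b" by (simp add: complex_of_real_integrable_eq)
  have "pmean p (convolution k f) \<le> (LINT x|m. b x)"
    unfolding pmean_def
  proof (intro integral_mono b_int jensen)
    show "integrable m (\<lambda>x. norm (convolution k f x) powr p)"
      using trig_poly_Lp[OF trig_poly_convolution' p1(2)] by (simp add: Lp_def)
  qed
  also have "(LINT x|m. b x) = pmean p f"
  proof -
    have "complex_of_real (LINT x|m. b x) = (LINT x|m. complex_of_real (norm (f x) powr p))"
      using conv_mean by (simp add: b flip: integral_complex_of_real)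
    then show ?thesis by (simp add: pmean_def)
  qed
  finally show ?thesis by (simp add: k_def)
qed

text \<open>
  Choose a polynomial \<open>Q\<^sub>0\<close> close to \<open>f\<close> and then a kernel \<open>K\<close> that hardly changes \<open>Q\<^sub>0\<close>. In
  \<open>f - K * f = (f - Q\<^sub>0) + (Q\<^sub>0 - K * Q\<^sub>0) - K * (f - Q\<^sub>0)\<close> all three terms are small, and the
  coefficients of \<open>K * f\<close> vanish together with those of \<open>f\<close>.
\<close>

theorem approximation_within_spectrum:
  assumes p: "1 < p" and f: "f \<in> Lp p m" and e: "e > 0"
  obtains Q where "trig_poly (spectrum f) Q" "pmean p (\<lambda>x. f x - Q x) < e"
proof -
  have p0: "p > 0" "p \<ge> 1" using p by auto
  define d where "d = e / (2 powr p * (2 * 2 powr p + 1) + 1)"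
  have pos: "2 powr p * (2 * 2 powr p + 1) + 1 > 0" by (intro add_nonneg_pos) auto
  have d: "d > 0" using e pos by (simp add: d_def)
  obtain Q0 where Q0: "trig_poly characters Q0" "pmean p (\<lambda>x. f x - Q0 x) < d"
    using trig_polys_dense_Lp[OF p0(1) f d] by blast
  define S where "S = spectrum Q0"
  have S: "finite S" "S \<subseteq> characters"
    using finite_spectrum'[OF Q0(1)] spectrum_characters by (auto simp: S_def)
  define c where "c = (\<Sum>\<gamma>\<in>S. norm (coeff Q0 \<gamma>)) + 1"
  have c: "c > 0" unfolding c_def by (intro add_nonneg_pos sum_nonneg) auto
  have dc: "d powr (1 / p) / c > 0" using d c by simp
  obtain K where K: "trig_poly characters (\<lambda>x. complex_of_real (K x))" "\<And>x. K x \<ge> 0" "(LINT x|m. K x) = 1"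
    "\<And>\<gamma>. \<gamma> \<in> S \<Longrightarrow> norm (coeff (\<lambda>x. complex_of_real (K x)) \<gamma> - 1) \<le> d powr (1 / p) / c"
    using positive_trig_poly_kernel[OF S dc] by blast
  define k where "k = (\<lambda>x. complex_of_real (K x))"
  have k: "trig_poly characters k" using K(1) by (simp add: k_def)
  have Q0L: "Q0 \<in> Lp p m" by (rule trig_poly_Lp[OF Q0(1) p0(1)])
  have fQ0: "(\<lambda>x. f x - Q0 x) \<in> Lp p m" by (rule Lp_diff(1)[OF f Q0L p0(1)])
  have convL: "convolution k g \<in> Lp p m" for g by (rule trig_poly_Lp[OF trig_poly_convolution' p0(1)])
  have conv_diff: "convolution k (\<lambda>x. f x - Q0 x) x = convolution k f x - convolution k Q0 x" for x
  proof -
    have coeff: "coeff (\<lambda>x. f x - Q0 x) \<gamma> = coeff f \<gamma> - coeff Q0 \<gamma>" if "\<gamma> \<in> spectrum k" for \<gamma>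
      using that by (intro fourier_coeff_diff Lp_integrable[of _ p] f Q0L p0) (simp add: spectrum_def)
    show ?thesis
      by (simp add: convolution_def coeff left_diff_distrib right_diff_distrib sum_subtractf)
  qed
  have conv_Q0: "norm (Q0 x - convolution k Q0 x) \<le> d powr (1 / p)" for x
  proof -
    have "convolution k Q0 x = (\<Sum>\<gamma>\<in>spectrum k \<union> S. coeff k \<gamma> * coeff Q0 \<gamma> * \<gamma> x)"
      unfolding convolution_def
      using finite_spectrum'[OF k] S by (intro sum.mono_neutral_left) (auto simp: spectrum_def)
    also have "\<dots> = (\<Sum>\<gamma>\<in>S. coeff k \<gamma> * coeff Q0 \<gamma> * \<gamma> x)"
      using finite_spectrum'[OF k] S spectrum_characters[of k]
      by (intro sum.mono_neutral_right) (auto simp: S_def spectrum_def)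
    finally have "Q0 x - convolution k Q0 x = (\<Sum>\<gamma>\<in>S. coeff Q0 \<gamma> * \<gamma> x * (1 - coeff k \<gamma>))"
      using trig_poly_eq[OF Q0(1) order_refl S(1) _ S(2), of x]
      by (simp add: S_def algebra_simps flip: sum_subtractf)
    also have "norm \<dots> \<le> (\<Sum>\<gamma>\<in>S. norm (coeff Q0 \<gamma>) * (d powr (1 / p) / c))"
    proof (rule sum_norm_le)
      fix \<gamma> assume \<gamma>: "\<gamma> \<in> S"
      then have "norm (\<gamma> x) = 1" using S(2) characterD(3) by auto
      moreover have "norm (1 - coeff k \<gamma>) \<le> d powr (1 / p) / c"
        using K(4)[OF \<gamma>] by (simp add: k_def norm_minus_commute)
      ultimately show "norm (coeff Q0 \<gamma> * \<gamma> x * (1 - coeff k \<gamma>)) \<le>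
          norm (coeff Q0 \<gamma>) * (d powr (1 / p) / c)"
        using mult_left_mono[of _ _ "norm (coeff Q0 \<gamma>)"] by (simp only: norm_mult mult_1_right norm_ge_zero)
    qed
    also have "\<dots> = (\<Sum>\<gamma>\<in>S. norm (coeff Q0 \<gamma>)) * (d powr (1 / p) / c)"
      by (rule sum_distrib_right[symmetric])
    also have "\<dots> = (c - 1) * (d powr (1 / p) / c)" by (simp add: c_def)
    also have "\<dots> \<le> c * (d powr (1 / p) / c)" using dc by (intro mult_right_mono) auto
    also have "\<dots> = d powr (1 / p)" using c by simp
    finally show ?thesis .
  qed
  have small: "pmean p (\<lambda>x. Q0 x - convolution k Q0 x) \<le> d"
  proof -
    have "pmean p (\<lambda>x. Q0 x - convolution k Q0 x) \<le> pmean p (\<lambda>_. complex_of_real (d powr (1 / p)))"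
      using conv_Q0 p0 by (intro pmean_mono Lp_diff(1) Q0L convL continuous_in_Lp) auto
    then show ?thesis using d p0 by (simp add: pmean_def powr_powr)
  qed
  have conv_small: "pmean p (convolution k (\<lambda>x. f x - Q0 x)) \<le> d"
    using pmean_convolution_le[OF p fQ0 K(1-3)] Q0(2) by (simp add: k_def)
  have "pmean p (\<lambda>x. f x - convolution k f x) =
      pmean p (\<lambda>x. ((f x - Q0 x) + (Q0 x - convolution k Q0 x)) - convolution k (\<lambda>x. f x - Q0 x) x)"
    by (simp add: conv_diff algebra_simps)
  also have "\<dots> \<le> 2 powr p * (pmean p (\<lambda>x. (f x - Q0 x) + (Q0 x - convolution k Q0 x)) + pmean p (convolution k (\<lambda>x. f x - Q0 x)))"
    by (intro Lp_diff(2) Lp_add(1) Lp_diff(1) f Q0L convL p0)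
  also have "\<dots> \<le> 2 powr p * (2 powr p * (pmean p (\<lambda>x. f x - Q0 x) + pmean p (\<lambda>x. Q0 x - convolution k Q0 x)) + d)"
    by (intro mult_left_mono add_mono conv_small Lp_add(2) Lp_diff(1) f Q0L convL p0) auto
  also have "\<dots> \<le> 2 powr p * (2 powr p * (d + d) + d)"
    using Q0(2) small by (intro mult_left_mono add_mono) auto
  also have "\<dots> < (2 powr p * (2 * 2 powr p + 1) + 1) * d" using d by (simp add: algebra_simps)
  also have "\<dots> = e" unfolding d_def using pos by simp
  finally show thesis using that[OF trig_poly_convolution] by blast
qed

section \<open>Frequency cuts and uniqueness\<close>

lemma spectral_part_character:
  assumes \<gamma>: "character \<gamma>"
  shows "spectral_part S \<gamma> x = (if \<gamma> \<in> S then \<gamma> x else 0)"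
proof -
  have "spectral_part S \<gamma> x = (\<Sum>\<delta>\<in>{\<gamma>} \<inter> S. coeff \<gamma> \<delta> * \<delta> x)"
    using \<gamma> by (intro spectral_part_eq) (auto simp: spectrum_def fourier_coeff_character split: if_splits)
  then show ?thesis using fourier_coeff_character[OF \<gamma> \<gamma>] by simp
qed

text \<open>Multiplication by a character shifts the frequencies, so a cut at any frequency is a Riesz projection.\<close>

lemma riesz_shift:
  assumes Q: "trig_poly characters Q" and \<delta>: "character \<delta>"
  shows "riesz (\<lambda>x. Q x * cnj (\<delta> x)) x = spectral_part {\<gamma>. freq \<gamma> > freq \<delta>} Q x * cnj (\<delta> x)"
  using Q
proof (induction rule: trig_poly.induct)
  case (single \<gamma> c)
  then have \<gamma>: "character \<gamma>" by simp
  let ?\<gamma>\<delta> = "\<lambda>x. \<gamma> x * cnj (\<delta> x)"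
  have \<gamma>\<delta>: "character ?\<gamma>\<delta>" by (intro character_mult character_cnj \<gamma> \<delta>)
  have pos: "?\<gamma>\<delta> \<in> pos_characters \<longleftrightarrow> freq \<gamma> > freq \<delta>"
    using \<gamma>\<delta> by (simp add: pos_characters_def freq_mult[OF \<gamma> character_cnj[OF \<delta>]] freq_cnj[OF \<delta>])
  have "riesz (\<lambda>x. c * ?\<gamma>\<delta> x) x = c * riesz ?\<gamma>\<delta> x"
    using \<gamma>\<delta> by (intro spectral_part_cmult trig_poly_character) simp
  moreover have "spectral_part {\<gamma>. freq \<gamma> > freq \<delta>} (\<lambda>x. c * \<gamma> x) x = c * spectral_part {\<gamma>. freq \<gamma> > freq \<delta>} \<gamma> x"
    using \<gamma> by (intro spectral_part_cmult trig_poly_character) simp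
  ultimately show ?case
    by (simp add: spectral_part_character \<gamma> \<gamma>\<delta> pos mult.assoc)
next
  case zero
  show ?case by (simp add: spectral_part_def spectrum_def fourier_coeff_def)
next
  case (add f g)
  have shift: "trig_poly characters (\<lambda>x. h x * cnj (\<delta> x))" if "trig_poly characters h" for h
    using \<delta> by (intro trig_poly_characters_mult that trig_poly_character) (simp add: character_cnj)
  show ?case
    using spectral_part_add[OF shift[OF add.hyps(1)] shift[OF add.hyps(2)]]
      spectral_part_add[OF add.hyps] add.IH
    by (simp add: distrib_right)
qed

lemma pmean_times_cnj_character: "character \<delta> \<Longrightarrow> pmean p (\<lambda>x. f x * cnj (\<delta> x)) = pmean p f"
  by (simp add: pmean_def norm_mult characterD(3))

lemma frequency_cut_bounded:
  assumes p: "1 < p"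
  obtains C where "C \<ge> 0" "\<And>Q \<delta>. trig_poly characters Q \<Longrightarrow> character \<delta> \<Longrightarrow>
    pmean p (spectral_part {\<gamma>. freq \<gamma> > freq \<delta>} Q) \<le> C * pmean p Q"
proof -
  obtain C where C: "C \<ge> 0" "\<And>f. trig_poly characters f \<Longrightarrow> pmean p (riesz f) \<le> C * pmean p f"
    using riesz_bounded[OF p] by blast
  show thesis
  proof (rule that[OF C(1)])
    fix Q \<delta> :: "'g \<Rightarrow> complex" assume Q: "trig_poly characters Q" and \<delta>: "character \<delta>"
    have shift: "trig_poly characters (\<lambda>x. Q x * cnj (\<delta> x))"
      using \<delta> by (intro trig_poly_characters_mult Q trig_poly_character) (simp add: character_cnj)
    have "riesz (\<lambda>x. Q x * cnj (\<delta> x)) = (\<lambda>x. spectral_part {\<gamma>. freq \<gamma> > freq \<delta>} Q x * cnj (\<delta> x))"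
      using riesz_shift[OF Q \<delta>] by blast
    then show "pmean p (spectral_part {\<gamma>. freq \<gamma> > freq \<delta>} Q) \<le> C * pmean p Q"
      using C(2)[OF shift] by (simp add: pmean_times_cnj_character[OF \<delta>])
  qed
qed

lemma pmean_zero_if_spectrum_empty:
  assumes p: "1 < p" and f: "f \<in> Lp p m" and empty: "spectrum f = {}"
  shows "pmean p f = 0"
proof (rule ccontr)
  assume "pmean p f \<noteq> 0"
  then have "pmean p f > 0" using pmean_nonneg[of p f] by linarith
  then obtain Q where Q: "trig_poly (spectrum f) Q" "pmean p (\<lambda>x. f x - Q x) < pmean p f"
    using approximation_within_spectrum[OF p f] by blast
  obtain F c where "F \<subseteq> spectrum f" "Q = (\<lambda>x. \<Sum>\<gamma>\<in>F. c \<gamma> * \<gamma> x)"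
    using trig_poly_representation[OF Q(1)] by blast
  then have "Q = (\<lambda>x. 0)" using empty by simp
  then show False using Q(2) by simp
qed

lemma pmean_cong_coefficients:
  assumes p: "1 < p" and f: "f \<in> Lp p m" and g: "g \<in> Lp p m"
    and eq: "\<And>\<gamma>. character \<gamma> \<Longrightarrow> coeff f \<gamma> = coeff g \<gamma>"
  shows "pmean p f = pmean p g"
proof -
  have p0: "p > 0" "p \<ge> 1" using p by auto
  have L: "(\<lambda>x. f x - g x) \<in> Lp p m" by (rule Lp_diff(1)[OF f g p0(1)])
  have "spectrum (\<lambda>x. f x - g x) = {}"
    by (auto simp: spectrum_def fourier_coeff_diff Lp_integrable[OF f p0(2)] Lp_integrable[OF g p0(2)] eq)
  from pmean_zero_if_spectrum_empty[OF p L this]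
  have "AE x in m. norm (f x - g x) powr p = 0"
    using L by (subst (asm) pmean_def) (simp add: Lp_def integral_nonneg_eq_0_iff_AE)
  then have "AE x in m. f x = g x" by eventually_elim (use p0 in simp)
  then show ?thesis
    unfolding pmean_def using f g by (intro integral_cong_AE) (auto simp: Lp_def)
qed

end

section \<open>Convergence of the partial sums\<close>

locale dirichlet_series_group = haar_on_dirichlet_group \<beta> m
  for \<beta> :: "real \<Rightarrow> 'g::{topological_ab_group_add, t2_space}" and m :: "'g measure" +
  fixes lam :: "nat \<Rightarrow> real" and p :: real
  assumes frequency: "frequency lam" and lam_group: "lambda_dirichlet_group lam \<beta>" and p_gt_1: "1 < p"
begin

abbreviation h :: "nat \<Rightarrow> 'g \<Rightarrow> complex" where
  "h n \<equiv> freq_character \<beta> (lam n)"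

lemma p_pos: "p > 0" "p \<ge> 1" using p_gt_1 by auto

lemma h_extends: "extends_frequency \<beta> (lam n) (h n)"
proof -
  obtain \<gamma> where "extends_frequency \<beta> (lam n) \<gamma>"
    using lam_group by (auto simp: lambda_dirichlet_group_def)
  then show ?thesis using freq_character_eq by simp
qed

lemma character_h: "character (h n)"
  using h_extends by (simp add: extends_frequency_def)

lemma freq_h: "freq (h n) = lam n"
  by (rule freq_unique[OF h_extends])

lemma h_less_iff: "freq (h k) > freq (h n) \<longleftrightarrow> k > n"
  using frequency by (simp add: freq_h frequency_def strict_mono_less)

lemma h_inj: "h k = h n \<Longrightarrow> k = n"
  using h_less_iff[of k n] h_less_iff[of n k] by (metis less_irrefl nat_neq_iff)

lemma h_cont: "continuous_on UNIV (h n)"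
  by (rule characterD(1)[OF character_h])

lemma Hp_group_iff: "f \<in> Hp_group p lam m \<beta> \<longleftrightarrow> f \<in> Lp p m \<and> spectrum f \<subseteq> range h"
  by (auto simp: Hp_group_def spectrum_def)

lemma fourier_coeff_h: "coeff (h n) (h k) = (if k = n then 1 else 0)"
  using fourier_coeff_character[OF character_h character_h, of n k] h_inj[of n k] by auto

definition partial_sum :: "(nat \<Rightarrow> complex) \<Rightarrow> nat \<Rightarrow> 'g \<Rightarrow> complex" where
  "partial_sum c N x = (\<Sum>n<N. c n * h n x)"

lemma partial_sum_cont: "continuous_on UNIV (partial_sum c N)"
  unfolding partial_sum_def[abs_def] by (intro continuous_intros h_cont)

lemma partial_sum_Lp: "partial_sum c N \<in> Lp p m"
  by (rule continuous_in_Lp[OF partial_sum_cont p_pos(1)])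

lemma fourier_coeff_partial_sum:
  assumes \<gamma>: "character \<gamma>"
  shows "coeff (partial_sum c N) \<gamma> = (\<Sum>n<N. if h n = \<gamma> then c n else 0)"
proof -
  have "coeff (partial_sum c N) \<gamma> = (LINT x|m. (\<Sum>n<N. c n * (h n x * cnj (\<gamma> x))))"
    by (simp add: fourier_coeff_def partial_sum_def sum_distrib_right mult.assoc)
  also have "\<dots> = (\<Sum>n<N. LINT x|m. c n * (h n x * cnj (\<gamma> x)))"
    by (intro Bochner_Integration.integral_sum integrable_mult_right
        integrable_times_cnj_character continuous_integrable h_cont \<gamma>)
  also have "\<dots> = (\<Sum>n<N. if h n = \<gamma> then c n else 0)"
    using fourier_coeff_character[OF character_h \<gamma>]
    by (intro sum.cong refl) (simp add: fourier_coeff_def)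
  finally show ?thesis .
qed

lemma fourier_coeff_partial_sum_h:
  "coeff (partial_sum c N) (h k) = (if k < N then c k else 0)"
proof -
  have "(\<Sum>n<N. if h n = h k then c n else 0) = (\<Sum>n<N. if n = k then c n else 0)"
    using h_inj by (intro sum.cong refl) auto
  then show ?thesis by (simp add: fourier_coeff_partial_sum[OF character_h])
qed

lemma remainder_in_Hp:
  assumes f: "f \<in> Hp_group p lam m \<beta>" and a: "represents lam m \<beta> f a"
  shows "(\<lambda>x. f x - partial_sum c N x) \<in> Hp_group p lam m \<beta>"
    and "represents lam m \<beta> (\<lambda>x. f x - partial_sum c N x) (\<lambda>k. a k - (if k < N then c k else 0))"
proof -
  have fL: "f \<in> Lp p m" and sf: "spectrum f \<subseteq> range h" using f by (auto simp: Hp_group_iff)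
  have coeff: "coeff (\<lambda>x. f x - partial_sum c N x) \<gamma> =
      coeff f \<gamma> - coeff (partial_sum c N) \<gamma>" if "character \<gamma>" for \<gamma>
    by (intro fourier_coeff_diff Lp_integrable[of _ p] fL partial_sum_Lp p_pos that)
  have "spectrum (\<lambda>x. f x - partial_sum c N x) \<subseteq> range h"
  proof
    fix \<gamma> assume "\<gamma> \<in> spectrum (\<lambda>x. f x - partial_sum c N x)"
    then have \<gamma>: "character \<gamma>" and nz: "coeff f \<gamma> - (\<Sum>n<N. if h n = \<gamma> then c n else 0) \<noteq> 0"
      by (auto simp: spectrum_def coeff fourier_coeff_partial_sum)
    show "\<gamma> \<in> range h"
    proof (rule ccontr)
      assume no: "\<gamma> \<notin> range h"
      then have "coeff f \<gamma> = 0" using sf \<gamma> by (auto simp: spectrum_def)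
      moreover have "(\<Sum>n<N. if h n = \<gamma> then c n else 0) = 0" using no by (intro sum.neutral) auto
      ultimately show False using nz by simp
    qed
  qed
  then show "(\<lambda>x. f x - partial_sum c N x) \<in> Hp_group p lam m \<beta>"
    using Lp_diff(1)[OF fL partial_sum_Lp p_pos(1)] by (simp add: Hp_group_iff)
  show "represents lam m \<beta> (\<lambda>x. f x - partial_sum c N x) (\<lambda>k. a k - (if k < N then c k else 0))"
    using a by (simp add: represents_def coeff[OF character_h] fourier_coeff_partial_sum_h)
qed

lemma Hp_norm_eq:
  assumes f: "f \<in> Hp_group p lam m \<beta>" and a: "represents lam m \<beta> f a"
  shows "Hp_norm p lam m \<beta> a = pmean p f powr (1 / p)"
  unfolding Hp_norm_def
proof (rule the_equality)
  show "\<exists>g\<in>Hp_group p lam m \<beta>. represents lam m \<beta> g a \<and> pmean p f powr (1 / p) = Lp_norm p m g"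
    using f a by (auto simp: Lp_norm_def pmean_def)
  fix r assume "\<exists>g\<in>Hp_group p lam m \<beta>. represents lam m \<beta> g a \<and> r = Lp_norm p m g"
  then obtain g where g: "g \<in> Hp_group p lam m \<beta>" "represents lam m \<beta> g a" "r = Lp_norm p m g" by blast
  have "coeff g \<gamma> = coeff f \<gamma>" if \<gamma>: "character \<gamma>" for \<gamma>
  proof (cases "\<gamma> \<in> range h")
    case True
    then show ?thesis using a g(2) by (auto simp: represents_def)
  next
    case False
    then have "\<gamma> \<notin> spectrum f" "\<gamma> \<notin> spectrum g" using f g(1) by (auto simp: Hp_group_iff)
    then show ?thesis using \<gamma> by (simp add: spectrum_def)
  qed
  then have "pmean p g = pmean p f"
    using f g(1) p_gt_1 by (intro pmean_cong_coefficients) (auto simp: Hp_group_iff)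
  then show "r = pmean p f powr (1 / p)" using g(3) by (simp add: Lp_norm_def pmean_def)
qed

lemma sum_scaled_monomials:
  "a - (\<Sum>n<N. scale_series (c n) (monomial n)) = (\<lambda>k. a k - (if k < N then c k else 0))"
proof -
  have "(\<Sum>n<N. scale_series (c n) (monomial n)) k = (if k < N then c k else 0)" for k
    by (induction N) (auto simp: scale_series_def monomial_def less_Suc_eq)
  then show ?thesis by (auto simp: fun_eq_iff)
qed

lemma norm_remainder:
  assumes "f \<in> Hp_group p lam m \<beta>" "represents lam m \<beta> f a"
  shows "Hp_norm p lam m \<beta> (a - (\<Sum>n<N. scale_series (c n) (monomial n))) =
    pmean p (\<lambda>x. f x - partial_sum c N x) powr (1 / p)"
  unfolding sum_scaled_monomials by (rule Hp_norm_eq[OF remainder_in_Hp[OF assms]])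

lemma spectral_polynomial_eq_partial_sum:
  assumes Q: "trig_poly (range h) Q"
  shows "\<exists>K. \<forall>N\<ge>K. \<forall>x. Q x = partial_sum (\<lambda>n. coeff Q (h n)) N x"
proof -
  have sub: "range h \<subseteq> characters" using character_h by auto
  have s: "finite (spectrum Q)" "spectrum Q \<subseteq> range h"
    using finite_spectrum[OF Q sub] spectrum_subset[OF Q sub] .
  obtain I where I: "finite I" "spectrum Q = h ` I"
    using finite_subset_image[OF s(1), of h UNIV] s(2) by auto
  obtain K where K: "I \<subseteq> {..<K}" using finite_nat_iff_bounded I(1) by blast
  have "Q x = partial_sum (\<lambda>n. coeff Q (h n)) N x" if "N \<ge> K" for N x
  proof -
    have "Q x = (\<Sum>\<gamma>\<in>h ` {..<N}. coeff Q \<gamma> * \<gamma> x)"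
      using K I(2) that by (intro trig_poly_eq[OF Q sub]) (auto simp: character_h)
    also have "\<dots> = partial_sum (\<lambda>n. coeff Q (h n)) N x"
      unfolding partial_sum_def using h_inj by (subst sum.reindex) (auto intro: inj_onI)
    finally show ?thesis .
  qed
  then show ?thesis by blast
qed

lemma remainder_eq_frequency_cut:
  assumes Q: "trig_poly (range h) Q"
  shows "Q x - partial_sum (\<lambda>n. coeff Q (h n)) (Suc N) x = spectral_part {\<gamma>. freq \<gamma> > freq (h N)} Q x"
proof -
  obtain K where K: "\<And>M x. M \<ge> K \<Longrightarrow> Q x = partial_sum (\<lambda>n. coeff Q (h n)) M x"
    using spectral_polynomial_eq_partial_sum[OF Q] by blast
  define M where "M = max K (Suc N)"
  have spec: "spectrum Q \<subseteq> h ` {..<M}"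
  proof
    fix \<gamma> assume "\<gamma> \<in> spectrum Q"
    then have \<gamma>: "character \<gamma>" "coeff Q \<gamma> \<noteq> 0" by (auto simp: spectrum_def)
    have "Q = partial_sum (\<lambda>n. coeff Q (h n)) M" using K[of M] by (auto simp: M_def)
    then have "(\<Sum>n<M. if h n = \<gamma> then coeff Q (h n) else 0) \<noteq> 0"
      using fourier_coeff_partial_sum[OF \<gamma>(1)] \<gamma>(2) by metis
    moreover have "(\<Sum>n<M. if h n = \<gamma> then coeff Q (h n) else 0) = 0"
      if "\<forall>n<M. h n \<noteq> \<gamma>"
      using that by (intro sum.neutral) auto
    ultimately obtain n where "n < M" "h n = \<gamma>" by blast
    then show "\<gamma> \<in> h ` {..<M}" by blast
  qed
  have inj: "inj_on h A" for A using h_inj by (auto intro: inj_onI)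
  have "spectral_part {\<gamma>. freq \<gamma> > freq (h N)} Q x =
      (\<Sum>\<gamma>\<in>h ` {..<M} \<inter> {\<gamma>. freq \<gamma> > freq (h N)}. coeff Q \<gamma> * \<gamma> x)"
    using spec character_h by (intro spectral_part_eq) auto
  also have "h ` {..<M} \<inter> {\<gamma>. freq \<gamma> > freq (h N)} = h ` {Suc N..<M}"
    by (auto simp: h_less_iff)
  also have "(\<Sum>\<gamma>\<in>h ` {Suc N..<M}. coeff Q \<gamma> * \<gamma> x) = (\<Sum>n=Suc N..<M. coeff Q (h n) * h n x)"
    by (subst sum.reindex[OF inj]) simp
  also have "\<dots> = (\<Sum>n<M. coeff Q (h n) * h n x) - (\<Sum>n<Suc N. coeff Q (h n) * h n x)"
    using sum_diff_nat_ivl[of 0 "Suc N" M "\<lambda>n. coeff Q (h n) * h n x"]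
    by (simp add: M_def atLeast0LessThan)
  also have "(\<Sum>n<M. coeff Q (h n) * h n x) = Q x"
    using K[of M x] by (simp add: M_def partial_sum_def)
  finally show ?thesis by (simp add: partial_sum_def)
qed

text \<open>
  The number of summands is fixed, so continuity of the individual coefficients suffices.
\<close>

lemma partial_sum_small:
  assumes g: "g \<in> Lp p m" and \<eta>: "\<eta> > 0"
    and small: "pmean p g \<le> (\<eta> powr (1 / p) / (2 * (real N + 1))) powr p"
  shows "pmean p (partial_sum (\<lambda>n. coeff g (h n)) N) \<le> \<eta>"
proof -
  define t where "t = \<eta> powr (1 / p)"
  define d where "d = t / (2 * (real N + 1))"
  have t: "t > 0" and d: "d > 0" using \<eta> by (auto simp: t_def d_def)
  have mean: "(LINT x|m. norm (g x)) \<le> 2 * d"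
  proof -
    have "(LINT x|m. norm (g x)) \<le> d + d powr (1 - p) * pmean p g"
      by (rule mean_norm_le[OF g p_pos(2) d])
    also have "\<dots> \<le> d + d powr (1 - p) * d powr p"
      using small by (intro add_left_mono mult_left_mono) (auto simp: d_def t_def)
    also have "d powr (1 - p) * d powr p = d" using d by (simp flip: powr_add)
    finally show ?thesis by simp
  qed
  have "norm (partial_sum (\<lambda>n. coeff g (h n)) N x) \<le> norm (complex_of_real t)" for x
  proof -
    have "norm (partial_sum (\<lambda>n. coeff g (h n)) N x) \<le> (\<Sum>n<N. 2 * d)"
      unfolding partial_sum_def
    proof (rule sum_norm_le)
      fix n
      have "norm (coeff g (h n)) \<le> 2 * d"
        using norm_fourier_coeff_le[OF Lp_integrable[OF g p_pos(2)] character_h, of n] mean by linarith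
      then show "norm (coeff g (h n) * h n x) \<le> 2 * d"
        by (simp add: norm_mult characterD(3)[OF character_h])
    qed
    also have "\<dots> \<le> (2 * (real N + 1)) * d" using d by (simp add: algebra_simps)
    also have "\<dots> = t" by (simp add: d_def)
    finally show ?thesis using t by simp
  qed
  then have "pmean p (partial_sum (\<lambda>n. coeff g (h n)) N) \<le> pmean p (\<lambda>_. complex_of_real t)"
    using p_pos by (intro pmean_mono partial_sum_Lp continuous_in_Lp) auto
  also have "\<dots> = \<eta>" using \<eta> p_pos by (simp add: pmean_def t_def powr_powr)
  finally show ?thesis .
qed

text \<open>
  Let \<open>S\<close> be the partial sum operator of order \<open>N + 1\<close>, and let \<open>Q\<close> and \<open>R\<close> be polynomials close to \<open>f\<close>
  with \<open>S Q = Q\<close>. Then \<open>f - S f = (f - R) + (1 - S)(R - Q) - S (f - R)\<close>. The frequency cut \<open>1 - S\<close> is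
  bounded on polynomials independently of \<open>N\<close>. To treat the last term, \<open>R\<close> may depend on \<open>N\<close>.
\<close>

theorem fourier_series_converges:
  assumes f: "f \<in> Hp_group p lam m \<beta>"
  shows "(\<lambda>N. pmean p (\<lambda>x. f x - partial_sum (\<lambda>n. coeff f (h n)) N x)) \<longlonglongrightarrow> 0"
proof -
  have fL: "f \<in> Lp p m" and sf: "spectrum f \<subseteq> range h" using f by (auto simp: Hp_group_iff)
  have sub: "range h \<subseteq> characters" using character_h by auto
  obtain C where C: "C \<ge> 0" "\<And>Q \<delta>. trig_poly characters Q \<Longrightarrow> character \<delta> \<Longrightarrow>
      pmean p (spectral_part {\<gamma>. freq \<gamma> > freq \<delta>} Q) \<le> C * pmean p Q"
    using frequency_cut_bounded[OF p_gt_1] by blast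
  have approx: "\<exists>Q. trig_poly (range h) Q \<and> pmean p (\<lambda>x. f x - Q x) < \<eta>" if "\<eta> > 0" for \<eta>
    using approximation_within_spectrum[OF p_gt_1 fL that] trig_poly_mono[OF _ sf] by metis
  let ?c = "\<lambda>g n. coeff g (h n)"
  define B where "B = 2 powr p * (2 powr p * (1 + C * (2 powr p * 2)) + 1)"
  have B: "B > 0"
    unfolding B_def using C(1) by (intro mult_pos_pos add_nonneg_pos mult_nonneg_nonneg add_nonneg_nonneg) auto
  have main: "\<exists>K. \<forall>N\<ge>K. pmean p (\<lambda>x. f x - partial_sum (?c f) N x) \<le> B * \<eta>" if \<eta>: "\<eta> > 0" for \<eta>
  proof -
    obtain Q where Q: "trig_poly (range h) Q" "pmean p (\<lambda>x. f x - Q x) < \<eta>"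
      using approx[OF \<eta>] by blast
    obtain K where K: "\<And>N x. N \<ge> K \<Longrightarrow> Q x = partial_sum (?c Q) N x"
      using spectral_polynomial_eq_partial_sum[OF Q(1)] by blast
    have "pmean p (\<lambda>x. f x - partial_sum (?c f) (Suc N) x) \<le> B * \<eta>" if N: "N \<ge> K" for N
    proof -
      \<comment> \<open>A second approximation, so close to \<open>f\<close> that the first \<open>N + 1\<close> coefficients nearly agree.\<close>
      define \<zeta> where "\<zeta> = min \<eta> ((\<eta> powr (1 / p) / (2 * (real (Suc N) + 1))) powr p)"
      have "\<zeta> > 0" using \<eta> by (simp add: \<zeta>_def)
      then obtain R where R: "trig_poly (range h) R" "pmean p (\<lambda>x. f x - R x) < \<zeta>"
        using approx by blast
      have Qc: "trig_poly characters Q" and Rc: "trig_poly characters R"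
        using trig_poly_mono[OF Q(1) sub] trig_poly_mono[OF R(1) sub] .
      have QL: "Q \<in> Lp p m" and RL: "R \<in> Lp p m" by (rule trig_poly_Lp[OF Qc p_pos(1)], rule trig_poly_Lp[OF Rc p_pos(1)])
      have RQ: "trig_poly (range h) (\<lambda>x. R x - Q x)" by (rule trig_poly_diff[OF R(1) Q(1)])
      have coeff: "coeff (\<lambda>x. u x - v x) (h n) = ?c u n - ?c v n" if "u \<in> Lp p m" "v \<in> Lp p m" for u v n
        by (intro fourier_coeff_diff Lp_integrable[of _ p] that p_pos character_h)
      have ps_diff: "partial_sum (?c (\<lambda>x. u x - v x)) M x = partial_sum (?c u) M x - partial_sum (?c v) M x"
        if "u \<in> Lp p m" "v \<in> Lp p m" for u v M x
        by (simp add: partial_sum_def coeff[OF that] left_diff_distrib sum_subtractf)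
      define T where "T = spectral_part {\<gamma>. freq \<gamma> > freq (h N)} (\<lambda>x. R x - Q x)"
      have T_eq: "R x - partial_sum (?c R) (Suc N) x = T x" for x
      proof -
        have "T x = (R x - Q x) - partial_sum (?c (\<lambda>x. R x - Q x)) (Suc N) x"
          unfolding T_def by (rule remainder_eq_frequency_cut[OF RQ, symmetric])
        also have "\<dots> = R x - partial_sum (?c R) (Suc N) x"
          using K[of "Suc N" x] N by (simp add: ps_diff[OF RL QL])
        finally show ?thesis by simp
      qed
      have fR: "(\<lambda>x. f x - R x) \<in> Lp p m" by (rule Lp_diff(1)[OF fL RL p_pos(1)])
      have TL: "T \<in> Lp p m" unfolding T_def by (rule trig_poly_Lp[OF trig_poly_spectral_part' p_pos(1)])
      have "pmean p (\<lambda>x. R x - Q x) = pmean p (\<lambda>x. (f x - Q x) - (f x - R x))" by simp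
      also have "\<dots> \<le> 2 powr p * (pmean p (\<lambda>x. f x - Q x) + pmean p (\<lambda>x. f x - R x))"
        by (intro Lp_diff fL QL RL p_pos)
      also have "\<dots> \<le> 2 powr p * (\<eta> + \<eta>)"
        using Q(2) R(2) by (intro mult_left_mono add_mono) (auto simp: \<zeta>_def)
      finally have RQ_small: "pmean p (\<lambda>x. R x - Q x) \<le> 2 powr p * (\<eta> + \<eta>)" .
      have "pmean p T \<le> C * pmean p (\<lambda>x. R x - Q x)"
        unfolding T_def by (rule C(2)[OF trig_poly_diff[OF Rc Qc] character_h])
      also have "\<dots> \<le> C * (2 powr p * (\<eta> + \<eta>))" by (intro mult_left_mono RQ_small C(1))
      finally have T_small: "pmean p T \<le> C * (2 powr p * (\<eta> + \<eta>))" .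
      define D where "D = partial_sum (?c (\<lambda>x. f x - R x)) (Suc N)"
      have DL: "D \<in> Lp p m" unfolding D_def by (rule partial_sum_Lp)
      have D_small: "pmean p D \<le> \<eta>"
        unfolding D_def by (rule partial_sum_small[OF fR \<eta>]) (use R(2) in \<open>simp add: \<zeta>_def\<close>)
      have "f x - partial_sum (?c f) (Suc N) x = ((f x - R x) + T x) - D x" for x
        unfolding D_def ps_diff[OF fL RL] using T_eq[of x] by (simp add: algebra_simps)
      then have "pmean p (\<lambda>x. f x - partial_sum (?c f) (Suc N) x) = pmean p (\<lambda>x. ((f x - R x) + T x) - D x)"
        by (simp only:)
      also have "\<dots> \<le> 2 powr p * (pmean p (\<lambda>x. (f x - R x) + T x) + pmean p D)"
        by (intro Lp_diff(2) Lp_add(1) fR TL DL p_pos)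
      also have "\<dots> \<le> 2 powr p * (2 powr p * (pmean p (\<lambda>x. f x - R x) + pmean p T) + \<eta>)"
        by (intro mult_left_mono add_mono Lp_add(2) fR TL p_pos D_small) auto
      also have "\<dots> \<le> 2 powr p * (2 powr p * (\<eta> + C * (2 powr p * (\<eta> + \<eta>))) + \<eta>)"
        using R(2) by (intro mult_left_mono add_mono T_small) (auto simp: \<zeta>_def)
      also have "\<dots> = B * \<eta>" by (simp add: B_def algebra_simps)
      finally show ?thesis .
    qed
    then have "pmean p (\<lambda>x. f x - partial_sum (?c f) N x) \<le> B * \<eta>" if "N \<ge> Suc K" for N
      using that by (cases N) auto
    then show ?thesis by blast
  qed
  show ?thesis
  proof (rule LIMSEQ_I)
    fix e :: real assume e: "e > 0"
    then have "e / (2 * B) > 0" using B by simp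
    from main[OF this] obtain K where K: "\<And>N. N \<ge> K \<Longrightarrow>
        pmean p (\<lambda>x. f x - partial_sum (?c f) N x) \<le> B * (e / (2 * B))" by blast
    have "B * (e / (2 * B)) < e" using B e by simp
    then have "norm (pmean p (\<lambda>x. f x - partial_sum (?c f) N x) - 0) < e" if "N \<ge> K" for N
      using K[OF that] pmean_nonneg[of p "\<lambda>x. f x - partial_sum (?c f) N x"] by simp
    then show "\<exists>no. \<forall>n\<ge>no. norm (pmean p (\<lambda>x. f x - partial_sum (?c f) n x) - 0) < e" by blast
  qed
qed

lemma coefficients_of_null_remainders:
  assumes f: "f \<in> Hp_group p lam m \<beta>"
    and lim: "(\<lambda>N. pmean p (\<lambda>x. f x - partial_sum c N x)) \<longlonglongrightarrow> 0"
  shows "c k = coeff f (h k)"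
proof -
  have fL: "f \<in> Lp p m" using f by (simp add: Hp_group_iff)
  have bound: "norm (coeff f (h k) - c k) \<le> d" if d: "d > 0" for d
  proof -
    have "norm (coeff f (h k) - c k) \<le> d + d powr (1 - p) * pmean p (\<lambda>x. f x - partial_sum c N x)"
      if "N > k" for N
    proof -
      have L: "(\<lambda>x. f x - partial_sum c N x) \<in> Lp p m"
        by (rule Lp_diff(1)[OF fL partial_sum_Lp p_pos(1)])
      have "coeff f (h k) - c k = coeff (\<lambda>x. f x - partial_sum c N x) (h k)"
        using that by (simp add: fourier_coeff_partial_sum_h
            fourier_coeff_diff[OF Lp_integrable[OF fL p_pos(2)] Lp_integrable[OF partial_sum_Lp p_pos(2)] character_h])
      then have "norm (coeff f (h k) - c k) \<le> (LINT x|m. norm (f x - partial_sum c N x))"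
        using norm_fourier_coeff_le[OF Lp_integrable[OF L p_pos(2)] character_h] by simp
      also have "\<dots> \<le> d + d powr (1 - p) * pmean p (\<lambda>x. f x - partial_sum c N x)"
        by (rule mean_norm_le[OF L p_pos(2) d])
      finally show ?thesis .
    qed
    then have "eventually (\<lambda>N. norm (coeff f (h k) - c k) \<le>
        d + d powr (1 - p) * pmean p (\<lambda>x. f x - partial_sum c N x)) sequentially"
      unfolding eventually_sequentially by (intro exI[of _ "Suc k"]) auto
    moreover have "(\<lambda>N. d + d powr (1 - p) * pmean p (\<lambda>x. f x - partial_sum c N x)) \<longlonglongrightarrow> d + d powr (1 - p) * 0"
      by (intro tendsto_intros lim)
    ultimately show ?thesis
      using tendsto_lowerbound[of _ "d + d powr (1 - p) * 0" sequentially] by simp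
  qed
  have "norm (coeff f (h k) - c k) \<le> 0"
    by (rule field_le_epsilon) (simp add: bound)
  then show ?thesis by simp
qed

lemma monomial_in_Hp_series: "monomial n \<in> Hp_series p lam m \<beta>"
proof -
  have "h n \<in> Lp p m" by (rule continuous_in_Lp[OF h_cont p_pos(1)])
  moreover have "spectrum (h n) \<subseteq> range h"
    by (auto simp: spectrum_def fourier_coeff_character[OF character_h] split: if_splits)
  moreover have "represents lam m \<beta> (h n) (monomial n)"
    by (simp add: represents_def monomial_def fourier_coeff_h)
  ultimately show ?thesis unfolding Hp_series_def using Hp_group_iff by blast
qed

theorem monomials_schauder_basis:
  "schauder_basis scale_series (Hp_series p lam m \<beta>) (Hp_norm p lam m \<beta>) monomial"
  unfolding schauder_basis_def
proof (intro conjI ballI)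
  show "range monomial \<subseteq> Hp_series p lam m \<beta>" using monomial_in_Hp_series by blast
  fix a assume "a \<in> Hp_series p lam m \<beta>"
  then obtain f where f: "f \<in> Hp_group p lam m \<beta>" and a: "represents lam m \<beta> f a"
    by (auto simp: Hp_series_def)
  have a_eq: "a n = coeff f (h n)" for n using a by (simp add: represents_def)
  show "\<exists>!c. (\<lambda>N. Hp_norm p lam m \<beta> (a - (\<Sum>n<N. scale_series (c n) (monomial n)))) \<longlonglongrightarrow> 0"
    unfolding norm_remainder[OF f a]
  proof (rule ex1I)
    have "(\<lambda>N. pmean p (\<lambda>x. f x - partial_sum a N x)) \<longlonglongrightarrow> 0"
      using fourier_series_converges[OF f] by (simp flip: a_eq)
    then show "(\<lambda>N. pmean p (\<lambda>x. f x - partial_sum a N x) powr (1 / p)) \<longlonglongrightarrow> 0"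
      using p_pos by (intro tendsto_zero_powrI[OF _ tendsto_const]) (auto simp: pmean_nonneg)
  next
    fix c assume "(\<lambda>N. pmean p (\<lambda>x. f x - partial_sum c N x) powr (1 / p)) \<longlonglongrightarrow> 0"
    from tendsto_zero_powrI[OF this tendsto_const]
    have "(\<lambda>N. (pmean p (\<lambda>x. f x - partial_sum c N x) powr (1 / p)) powr p) \<longlonglongrightarrow> 0"
      using p_pos by simp
    then have "(\<lambda>N. pmean p (\<lambda>x. f x - partial_sum c N x)) \<longlonglongrightarrow> 0"
      using p_pos by (simp add: powr_powr pmean_nonneg)
    from coefficients_of_null_remainders[OF f this] show "c = a" by (auto simp: a_eq)
  qed
qed

end

theorem theorem4p16:
  fixes p :: real and lam :: "nat \<Rightarrow> real"
    and \<beta> :: "real \<Rightarrow> 'g::{topological_ab_group_add, t2_space}" and m :: "'g measure"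
  assumes "1 < p"
    and "frequency lam"
    and "lambda_dirichlet_group lam \<beta>"
    and "normalized_haar m"
  shows "schauder_basis scale_series (Hp_series p lam m \<beta>) (Hp_norm p lam m \<beta>) monomial"
proof -
  interpret dirichlet_series_group \<beta> m lam p
    using assms by unfold_locales (auto simp: lambda_dirichlet_group_def)
  show ?thesis by (rule monomials_schauder_basis)
qed

end
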